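(* Let $(\mathcal{X}_1\times\mathcal{X}_2,\ \rho^B_{x_1,x_2},\ \mathcal{H}^B)$ be a classical-quantum multiple access channel and let $p=p_{X_1}p_{X_2}$ be a product distribution on $\mathcal{X}_1\times\mathcal{X}_2$. Suppose the rates $R_1,R_2\ge 0$ satisfy $$R_1\le I(X_1;B|X_2)_\theta,\qquad R_2\le I(X_2;B|X_1)_\theta,\qquad R_1+R_2\le I(X_1X_2;B)_\theta .$$ Then for all $\epsilon,\delta>0$ and all sufficiently large $n$ the following holds. Let $\mathcal{M}_1,\mathcal{M}_2$ be message sets with $|\mathcal{M}_i|=2^{n(R_i-\delta)}$, and let $\{X_1^n(m_1)\}_{m_1\in\mathcal{M}_1}$ and $\{X_2^n(m_2)\}_{m_2\in\mathcal{M}_2}$ be random codebooks whose codewords are drawn independently according to the product distributions $p_{X_1^n}=\prod_{i=1}^n p_{X_1}$ and $p_{X_2^n}=\prod_{i=1}^n p_{X_2}$. Then there exists a (codebook-dependent) POVM $\{\Lambda_{m_1,m_2}\}_{m_1\in\mathcal{M}_1,m_2\in\mathcal{M}_2}$ on $B^n$ (a simultaneous decoder for both messages) such that $$\mathbb{E}_{X_1^n,X_2^n}\left\{\frac{1}{|\mathcal{M}_1||\mathcal{M}_2|}\sum_{m_1,m_2}\mathrm{Tr}\left[(I-\Lambda_{m_1,m_2})\,\rho^{B^n}_{X_1^n(m_1),X_2^n(m_2)}\right]\right\}\le\epsilon .$$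
   Context: A classical-quantum multiple access channel consists of finite input alphabets $\mathcal{X}_1,\mathcal{X}_2$ and a density operator $\rho^B_{x_1,x_2}$ on a finite-dimensional Hilbert space $\mathcal{H}^B$ for each $(x_1,x_2)$. For sequences, $\rho^{B^n}_{x_1^n,x_2^n}=\rho^{B}_{x_{11},x_{21}}\otimes\cdots\otimes\rho^{B}_{x_{1n},x_{2n}}$. The mutual informations are quantum (Holevo) mutual informations, with logarithms base 2, computed on the classical-quantum state $\theta^{X_1X_2B}=\sum_{x_1,x_2}p_{X_1}(x_1)p_{X_2}(x_2)|x_1\rangle\langle x_1|^{X_1}\otimes|x_2\rangle\langle x_2|^{X_2}\otimes\rho^B_{x_1,x_2}$; e.g. $I(X_1;B|X_2)=H(X_1|X_2)+H(B|X_2)-H(X_1B|X_2)$ with von Neumann entropies. *)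

theory Defs
  imports Complex_Main "Jordan_Normal_Form.Matrix" "Jordan_Normal_Form.Char_Poly"
    "HOL-Library.Multiset" "HOL-Library.FuncSet"
begin

text \<open>Finite alphabets are rendered as initial segments {0..<k} of nat; a d-dimensional
Hilbert space is C^d; operators are complex d x d matrices (Jordan_Normal_Form).\<close>

definition psd :: "nat \<Rightarrow> complex mat \<Rightarrow> bool" where
  "psd n A \<longleftrightarrow> A \<in> carrier_mat n n \<and>
     (\<forall>v :: nat \<Rightarrow> complex.
        let z = (\<Sum>i<n. \<Sum>j<n. cnj (v i) * A $$ (i,j) * v j) in Im z = 0 \<and> 0 \<le> Re z)"

definition mtrace :: "complex mat \<Rightarrow> complex" where
  "mtrace A = (\<Sum>i<dim_row A. A $$ (i,i))"

definition density :: "nat \<Rightarrow> complex mat \<Rightarrow> bool" where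
  "density n A \<longleftrightarrow> psd n A \<and> mtrace A = 1"

definition msum :: "nat \<Rightarrow> ('i \<Rightarrow> complex mat) \<Rightarrow> 'i set \<Rightarrow> complex mat" where
  "msum n F S = mat n n (\<lambda>(i,j). \<Sum>s\<in>S. F s $$ (i,j))"

definition kron :: "complex mat \<Rightarrow> complex mat \<Rightarrow> complex mat" where
  "kron A B = mat (dim_row A * dim_row B) (dim_col A * dim_col B)
     (\<lambda>(i,j). A $$ (i div dim_row B, j div dim_col B) * B $$ (i mod dim_row B, j mod dim_col B))"

definition ketbra :: "nat \<Rightarrow> nat \<Rightarrow> complex mat" where
  "ketbra k x = mat k k (\<lambda>(i,j). if i = x \<and> j = x then 1 else 0)"

text \<open>Partial trace of the middle factor of a matrix on C^a (x) C^b (x) C^c;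
  with a = 1 or c = 1 this is the partial trace over the first / last factor.\<close>
definition ptrace_mid :: "nat \<Rightarrow> nat \<Rightarrow> nat \<Rightarrow> complex mat \<Rightarrow> complex mat" where
  "ptrace_mid a b c M = mat (a*c) (a*c) (\<lambda>(i,j).
      \<Sum>k<b. M $$ ((i div c) * (b*c) + k*c + i mod c, (j div c) * (b*c) + k*c + j mod c))"

text \<open>Eigenvalues with algebraic multiplicity: the multiset of roots of the characteristic
  polynomial (which splits over C).\<close>
definition eigvals :: "complex mat \<Rightarrow> complex multiset" where
  "eigvals A = (THE m. char_poly A = (\<Prod>a\<in>#m. [:- a, 1:]))"

definition eta :: "real \<Rightarrow> real" where
  "eta x = (if x \<le> 0 then 0 else x * log 2 x)"

definition vN_entropy :: "complex mat \<Rightarrow> real" where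
  "vN_entropy A = - (\<Sum>e\<in>#eigvals A. eta (Re e))"

definition cq_state :: "nat \<Rightarrow> nat \<Rightarrow> nat \<Rightarrow> (nat \<Rightarrow> real) \<Rightarrow> (nat \<Rightarrow> real)
    \<Rightarrow> (nat \<Rightarrow> nat \<Rightarrow> complex mat) \<Rightarrow> complex mat" where
  "cq_state k1 k2 d p1 p2 \<rho> =
     msum (k1*k2*d)
       (\<lambda>(x1,x2). complex_of_real (p1 x1 * p2 x2) \<cdot>\<^sub>m
           kron (kron (ketbra k1 x1) (ketbra k2 x2)) (\<rho> x1 x2))
       ({..<k1} \<times> {..<k2})"

definition H_X1X2B where "H_X1X2B k1 k2 d p1 p2 \<rho> = vN_entropy (cq_state k1 k2 d p1 p2 \<rho>)"
definition H_X1X2 where "H_X1X2 k1 k2 d p1 p2 \<rho> = vN_entropy (ptrace_mid (k1*k2) d 1 (cq_state k1 k2 d p1 p2 \<rho>))"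
definition H_X2B where "H_X2B k1 k2 d p1 p2 \<rho> = vN_entropy (ptrace_mid 1 k1 (k2*d) (cq_state k1 k2 d p1 p2 \<rho>))"
definition H_X1B where "H_X1B k1 k2 d p1 p2 \<rho> = vN_entropy (ptrace_mid k1 k2 d (cq_state k1 k2 d p1 p2 \<rho>))"
definition H_X1 where "H_X1 k1 k2 d p1 p2 \<rho> = vN_entropy (ptrace_mid k1 (k2*d) 1 (cq_state k1 k2 d p1 p2 \<rho>))"
definition H_X2 where "H_X2 k1 k2 d p1 p2 \<rho> = vN_entropy (ptrace_mid 1 k1 k2 (ptrace_mid (k1*k2) d 1 (cq_state k1 k2 d p1 p2 \<rho>)))"
definition H_B where "H_B k1 k2 d p1 p2 \<rho> = vN_entropy (ptrace_mid 1 (k1*k2) d (cq_state k1 k2 d p1 p2 \<rho>))"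

text \<open>Conditional mutual informations, via H(A|C) = H(AC) - H(C) and
  I(A;B|C) = H(A|C) + H(B|C) - H(AB|C).\<close>
definition I_X1_B_given_X2 where
  "I_X1_B_given_X2 k1 k2 d p1 p2 \<rho> =
     (H_X1X2 k1 k2 d p1 p2 \<rho> - H_X2 k1 k2 d p1 p2 \<rho>)
   + (H_X2B k1 k2 d p1 p2 \<rho> - H_X2 k1 k2 d p1 p2 \<rho>)
   - (H_X1X2B k1 k2 d p1 p2 \<rho> - H_X2 k1 k2 d p1 p2 \<rho>)"

definition I_X2_B_given_X1 where
  "I_X2_B_given_X1 k1 k2 d p1 p2 \<rho> =
     (H_X1X2 k1 k2 d p1 p2 \<rho> - H_X1 k1 k2 d p1 p2 \<rho>)
   + (H_X1B k1 k2 d p1 p2 \<rho> - H_X1 k1 k2 d p1 p2 \<rho>)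
   - (H_X1X2B k1 k2 d p1 p2 \<rho> - H_X1 k1 k2 d p1 p2 \<rho>)"

definition I_X1X2_B where
  "I_X1X2_B k1 k2 d p1 p2 \<rho> =
     H_X1X2 k1 k2 d p1 p2 \<rho> + H_B k1 k2 d p1 p2 \<rho> - H_X1X2B k1 k2 d p1 p2 \<rho>"

fun tensor_out :: "(nat \<Rightarrow> nat \<Rightarrow> complex mat) \<Rightarrow> (nat \<Rightarrow> nat) \<Rightarrow> (nat \<Rightarrow> nat) \<Rightarrow> nat \<Rightarrow> complex mat" where
  "tensor_out \<rho> u v 0 = 1\<^sub>m 1"
| "tensor_out \<rho> u v (Suc n) = kron (tensor_out \<rho> u v n) (\<rho> (u n) (v n))"

definition povm :: "nat \<Rightarrow> nat \<Rightarrow> nat \<Rightarrow> (nat \<Rightarrow> nat \<Rightarrow> complex mat) \<Rightarrow> bool" where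
  "povm D M1 M2 \<Lambda> \<longleftrightarrow> (\<forall>m1<M1. \<forall>m2<M2. psd D (\<Lambda> m1 m2)) \<and>
     msum D (\<lambda>(m1,m2). \<Lambda> m1 m2) ({..<M1} \<times> {..<M2}) = 1\<^sub>m D"

end

theory Submission
  imports Defs "Jordan_Normal_Form.Spectral_Radius"
begin

text \<open>A test for the message pair \<open>(x\<^sub>1, x\<^sub>2)\<close> is the projection onto the large eigenvalues of the output
  \<open>\<rho>(x\<^sub>1, x\<^sub>2)\<close>, sandwiched between projections onto the small eigenvalues of the averaged outputs
  \<open>\<rho>(x\<^sub>1)\<close> and \<open>\<rho>\<close>; the square-root measurement built from these tests is the decoder.  The
  Hayashi--Nagaoka inequality reduces its error to the probability of missing the correct test,
  which decays exponentially by a Chernoff bound on the eigenvalues, and to the traces of the wrong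
  tests against the output.  To bound all three kinds of wrong tests at once, the output is first
  compressed by the projection onto the small eigenvalues of \<open>\<rho>(x\<^sub>2)\<close>: a wrong first message
  is controlled by this compression, a wrong second message by the factor \<open>\<rho>(x\<^sub>1)\<close> of the test,
  and a wrong pair by the factor \<open>\<rho>\<close>.\<close>

text \<open>The obstacle is that the projections for \<rho>(x1), \<rho>(x2) and \<rho> need not
  commute. If a test also carried the projection for x2, then for a wrong second message this factor
  would vary together with the output that it encloses, and the average would no longer reduce to
  \<rho>(x1). The projection for x2 is therefore attached to the transmitted output, where x2 is the
  true input and stays fixed when only the first message is wrong. The exchange costs constant
  factors, because an effect E satisfies E \<le> 2 P E P + 2 (1 - P) for every projection P. The
  projections cut the spectrum of a tensor product at one threshold instead of collecting typical
  sequences: powers of eigenvalues are multiplicative over tensor factors, so each Chernoff bound,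
  averaged over random words, is exactly an n-th power. The thresholds are 2^(-nH) up to a slack
  \<delta>/4 in the exponent; each confusion term meets two of them, and at least half of \<delta>
  survives as its decay rate. Only wrong messages are counted, so M - 1 enters instead of M, and
  rounding the number of messages up is free.\<close>

section \<open>Finitely supported operators\<close>

text \<open>All the spaces \<open>\<complex>\<^sup>n\<close> are embedded in one space of sequences, so that operators form a
  single (non-unital) ring; the identity of \<open>\<complex>\<^sup>n\<close> becomes the projection \<open>one n\<close>.\<close>

typedef fop = "{f :: nat \<Rightarrow> nat \<Rightarrow> complex. \<exists>n. \<forall>i j. n \<le> i \<or> n \<le> j \<longrightarrow> f i j = 0}"
  morphisms ent Op
  by (rule exI[of _ "\<lambda>_ _. 0"]) auto

definition supp :: "nat \<Rightarrow> fop \<Rightarrow> bool" where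
  "supp n A \<longleftrightarrow> (\<forall>i j. n \<le> i \<or> n \<le> j \<longrightarrow> ent A i j = 0)"

lemma fop_eqI: "(\<And>i j. ent A i j = ent B i j) \<Longrightarrow> A = B"
  using ent_inject by blast

lemma ex_supp: "\<exists>n. supp n A"
  using ent[of A] by (auto simp: supp_def)

lemma supp_mono: "supp m A \<Longrightarrow> m \<le> n \<Longrightarrow> supp n A"
  unfolding supp_def by (meson le_trans)

lemma ex_supp3: obtains n where "supp n A" "supp n B" "supp n C"
proof -
  obtain a b c where "supp a A" "supp b B" "supp c C" using ex_supp by meson
  then have "supp (a+b+c) A" "supp (a+b+c) B" "supp (a+b+c) C"
    by (auto elim!: supp_mono)
  then show ?thesis using that by blast
qed

lemma ent_Op: "(\<And>i j. n \<le> i \<or> n \<le> j \<Longrightarrow> f i j = 0) \<Longrightarrow> ent (Op f) = f"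
  by (rule Op_inverse) blast

instantiation fop :: real_algebra
begin
definition zero_fop :: fop where "0 = Op (\<lambda>_ _. 0)"
definition plus_fop :: "fop \<Rightarrow> fop \<Rightarrow> fop" where "A + B = Op (\<lambda>i j. ent A i j + ent B i j)"
definition uminus_fop :: "fop \<Rightarrow> fop" where "- A = Op (\<lambda>i j. - ent A i j)"
definition minus_fop :: "fop \<Rightarrow> fop \<Rightarrow> fop" where "A - B = Op (\<lambda>i j. ent A i j - ent B i j)"
definition scaleR_fop :: "real \<Rightarrow> fop \<Rightarrow> fop" where "r *\<^sub>R A = Op (\<lambda>i j. of_real r * ent A i j)"
text \<open>The sum runs over the nonzero entries of one row, a finite set, so no dimension has to
  be chosen. A bound on the support of either factor recovers the usual finite sum.\<close>

definition times_fop :: "fop \<Rightarrow> fop \<Rightarrow> fop" where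
  "A * B = Op (\<lambda>i j. \<Sum>k | ent A i k \<noteq> 0. ent A i k * ent B k j)"

lemma ent_zero [simp]: "ent 0 i j = 0"
  unfolding zero_fop_def by (subst ent_Op) auto
lemma ent_plus [simp]: "ent (A + B) i j = ent A i j + ent B i j"
proof -
  obtain n where "supp n A" "supp n B" "supp n B" using ex_supp3 by metis
  then show ?thesis unfolding plus_fop_def by (subst ent_Op[of n]) (auto simp: supp_def)
qed
lemma ent_uminus [simp]: "ent (- A) i j = - ent A i j"
proof -
  obtain n where "supp n A" using ex_supp by metis
  then show ?thesis unfolding uminus_fop_def by (subst ent_Op[of n]) (auto simp: supp_def)
qed
lemma ent_minus [simp]: "ent (A - B) i j = ent A i j - ent B i j"
proof -
  obtain n where "supp n A" "supp n B" "supp n B" using ex_supp3 by metis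
  then show ?thesis unfolding minus_fop_def by (subst ent_Op[of n]) (auto simp: supp_def)
qed
lemma ent_scaleR [simp]: "ent (r *\<^sub>R A) i j = of_real r * ent A i j"
proof -
  obtain n where "supp n A" using ex_supp by metis
  then show ?thesis unfolding scaleR_fop_def by (subst ent_Op[of n]) (auto simp: supp_def)
qed
lemma ent_times_left:
  assumes "supp n A" shows "ent (A * B) i j = (\<Sum>k<n. ent A i k * ent B k j)"
proof -
  obtain m where m: "supp m A" "supp m B" "supp m B" using ex_supp3 by metis
  have "ent (A * B) i j = (\<Sum>k | ent A i k \<noteq> 0. ent A i k * ent B k j)"
    unfolding times_fop_def using m by (subst ent_Op[of m]) (auto simp: supp_def intro!: sum.neutral)
  also have "\<dots> = (\<Sum>k<n. ent A i k * ent B k j)"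
    using assms by (intro sum.mono_neutral_left) (auto simp: supp_def not_le[symmetric])
  finally show ?thesis .
qed
lemma ent_times_right:
  assumes "supp n B" shows "ent (A * B) i j = (\<Sum>k<n. ent A i k * ent B k j)"
proof -
  obtain m where m: "supp m A" "supp m A" "supp m A" using ex_supp3 by metis
  have "ent (A * B) i j = (\<Sum>k<m+n. ent A i k * ent B k j)"
    using m by (intro ent_times_left) (auto elim!: supp_mono)
  also have "\<dots> = (\<Sum>k<n. ent A i k * ent B k j)"
    using assms by (intro sum.mono_neutral_right) (auto simp: supp_def not_le[symmetric])
  finally show ?thesis .
qed

instance
proof
  fix A B C :: fop and r s :: real
  obtain n where n: "supp n A" "supp n B" "supp n C" using ex_supp3 by metis
  show "A * B * C = A * (B * C)"
    by (rule fop_eqI) (simp add: ent_times_left[OF n(1)] ent_times_left[OF n(2)] ent_times_right[OF n(3)]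
        sum_distrib_left sum_distrib_right mult.assoc, rule sum.swap)
  have nBC: "supp n (A + B)" using n by (auto simp: supp_def)
  show "(A + B) * C = A * C + B * C"
    by (rule fop_eqI) (simp add: ent_times_right[OF n(3)] sum.distrib algebra_simps)
  show "A * (B + C) = A * B + A * C"
    by (rule fop_eqI) (simp add: ent_times_left[OF n(1)] sum.distrib algebra_simps)
  show "(r *\<^sub>R A) * B = r *\<^sub>R (A * B)"
    by (rule fop_eqI) (simp add: ent_times_right[OF n(2)] sum_distrib_left mult_ac)
  show "A * (r *\<^sub>R B) = r *\<^sub>R (A * B)"
    by (rule fop_eqI) (simp add: ent_times_left[OF n(1)] sum_distrib_left mult_ac)
qed (auto intro!: fop_eqI simp: algebra_simps)
end

lemma ent_sum [simp]: "ent (sum f S) i j = (\<Sum>s\<in>S. ent (f s) i j)"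
  by (induction S rule: infinite_finite_induct) auto

lemma supp_0 [simp]: "supp n 0"
  and supp_plus [simp, intro]: "supp n A \<Longrightarrow> supp n B \<Longrightarrow> supp n (A + B)"
  and supp_minus [simp, intro]: "supp n A \<Longrightarrow> supp n B \<Longrightarrow> supp n (A - B)"
  and supp_scaleR [simp, intro]: "supp n A \<Longrightarrow> supp n (r *\<^sub>R A)"
  by (auto simp: supp_def)

lemma supp_sum [simp, intro]: "(\<And>s. s \<in> S \<Longrightarrow> supp n (f s)) \<Longrightarrow> supp n (sum f S)"
  by (auto simp: supp_def)

lemma supp_times [simp, intro]:
  assumes "supp n A" "supp n B" shows "supp n (A * B)"
  using assms unfolding supp_def
  by (auto simp: ent_times_left[OF assms(1)] supp_def)

section \<open>Diagonal operators and the embedded identities\<close>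

definition dg :: "nat \<Rightarrow> (nat \<Rightarrow> real) \<Rightarrow> fop" where
  "dg n f = Op (\<lambda>i j. if i = j \<and> i < n then of_real (f i) else 0)"

abbreviation one :: "nat \<Rightarrow> fop" where "one n \<equiv> dg n (\<lambda>_. 1)"

lemma ent_dg [simp]: "ent (dg n f) i j = (if i = j \<and> i < n then of_real (f i) else 0)"
  unfolding dg_def by (subst ent_Op[of n]) auto

lemma supp_dg [simp]: "supp n (dg n f)"
  by (auto simp: supp_def)

lemma ent_dg_times: "ent (dg n f * A) i j = (if i < n then of_real (f i) * ent A i j else 0)"
  by (simp add: ent_times_left[OF supp_dg] if_distrib[of "\<lambda>x. x * _"] cong: if_cong)

lemma ent_times_dg: "ent (A * dg n f) i j = (if j < n then ent A i j * of_real (f j) else 0)"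
proof -
  have "ent (A * dg n f) i j = (\<Sum>k<n. if k = j then (if j < n then ent A i j * of_real (f j) else 0) else 0)"
    by (simp only: ent_times_right[OF supp_dg]) (rule sum.cong, auto)
  then show ?thesis by simp
qed

lemma one_times [simp]: "supp n A \<Longrightarrow> one n * A = A"
  and times_one [simp]: "supp n A \<Longrightarrow> A * one n = A"
  by (auto intro!: fop_eqI simp: ent_dg_times ent_times_dg supp_def)

lemma one_times_iff: "supp n A \<longleftrightarrow> one n * A = A \<and> A * one n = A"
proof
  assume r: "one n * A = A \<and> A * one n = A"
  show "supp n A" unfolding supp_def
  proof (intro allI impI)
    fix i j assume "n \<le> i \<or> n \<le> j"
    then show "ent A i j = 0"
      by (metis r ent_dg_times ent_times_dg not_le)
  qed
qed auto

lemma dg_times_dg [simp]: "dg n f * dg n g = dg n (\<lambda>i. f i * g i)"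
  by (auto intro!: fop_eqI simp: ent_dg_times)

lemma dg_diff: "dg n f - dg n g = dg n (\<lambda>i. f i - g i)"
  and dg_scaleR: "r *\<^sub>R dg n f = dg n (\<lambda>i. r * f i)"
  by (auto intro!: fop_eqI)

lemma dg_cong: "(\<And>i. i < n \<Longrightarrow> f i = g i) \<Longrightarrow> dg n f = dg n g"
  by (auto intro!: fop_eqI)

section \<open>The adjoint\<close>

definition adj :: "fop \<Rightarrow> fop" where "adj A = Op (\<lambda>i j. cnj (ent A j i))"

lemma ent_adj [simp]: "ent (adj A) i j = cnj (ent A j i)"
proof -
  obtain n where "supp n A" using ex_supp by metis
  then show ?thesis unfolding adj_def by (subst ent_Op[of n]) (auto simp: supp_def)
qed

lemma adj_adj [simp]: "adj (adj A) = A"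
  and adj_0 [simp]: "adj 0 = 0"
  and adj_plus [simp]: "adj (A + B) = adj A + adj B"
  and adj_minus [simp]: "adj (A - B) = adj A - adj B"
  and adj_uminus [simp]: "adj (- A) = - adj A"
  and adj_scaleR [simp]: "adj (r *\<^sub>R A) = r *\<^sub>R adj A"
  and adj_dg [simp]: "adj (dg n f) = dg n f"
  by (auto intro!: fop_eqI)

lemma adj_sum [simp]: "adj (sum f S) = (\<Sum>s\<in>S. adj (f s))"
  by (auto intro!: fop_eqI)

lemma supp_adj [simp]: "supp n (adj A) = supp n A"
  by (auto simp: supp_def)

lemma adj_times [simp]: "adj (A * B) = adj B * adj A"
proof -
  obtain n where n: "supp n A" "supp n B" "supp n B" using ex_supp3 by metis
  show ?thesis
    using n by (intro fop_eqI) (simp add: ent_times_left[of n] mult.commute)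
qed

text \<open>Every trace needed is of a product of two Hermitian operators, hence real.\<close>
definition tr :: "fop \<Rightarrow> real" where "tr A = Re (\<Sum>i | ent A i i \<noteq> 0. ent A i i)"

lemma tr_eq: "supp n A \<Longrightarrow> tr A = Re (\<Sum>i<n. ent A i i)"
  unfolding tr_def
  by (intro arg_cong[of _ _ Re] sum.mono_neutral_left) (auto simp: supp_def not_le[symmetric])

lemma tr_0 [simp]: "tr 0 = 0"
  by (simp add: tr_eq[of 0])

lemma tr_plus [simp]: "tr (A + B) = tr A + tr B"
proof -
  obtain n where n: "supp n A" "supp n B" "supp n B" using ex_supp3 by metis
  then show ?thesis by (simp add: tr_eq[of n] supp_plus sum.distrib)
qed

lemma tr_scaleR [simp]: "tr (r *\<^sub>R A) = r * tr A"
proof -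
  obtain n where n: "supp n A" using ex_supp by metis
  then show ?thesis by (simp add: tr_eq[of n] supp_scaleR sum_distrib_left)
qed

lemma tr_uminus [simp]: "tr (- A) = - tr A"
  using tr_scaleR[of "-1" A] by simp

lemma tr_minus [simp]: "tr (A - B) = tr A - tr B"
  using tr_plus[of A "- B"] by simp

lemma tr_sum [simp]: "tr (sum f S) = (\<Sum>s\<in>S. tr (f s))"
  by (induction S rule: infinite_finite_induct) auto

lemma tr_dg [simp]: "tr (dg n f) = (\<Sum>i<n. f i)"
  by (simp add: tr_eq[OF supp_dg])

lemma tr_commute: "tr (A * B) = tr (B * A)"
proof -
  obtain n where n: "supp n A" "supp n B" "supp n B" using ex_supp3 by metis
  have "(\<Sum>i<n. \<Sum>k<n. ent A i k * ent B k i) = (\<Sum>i<n. \<Sum>k<n. ent B i k * ent A k i)"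
    by (subst sum.swap) (simp add: mult.commute)
  then show ?thesis using n by (simp add: tr_eq[of n] supp_times ent_times_left[of n])
qed

lemma tr_adj [simp]: "tr (adj A) = tr A"
proof -
  obtain n where n: "supp n A" using ex_supp by metis
  then show ?thesis by (simp add: tr_eq[of n])
qed

text \<open>The trace here is the squared Frobenius norm, the sum of the squared moduli of the
  entries.\<close>

lemma tr_adj_self: "tr (adj A * A) \<ge> 0"
  and tr_adj_self_eq_0: "tr (adj A * A) = 0 \<Longrightarrow> A = 0"
proof -
  obtain n where n: "supp n A" using ex_supp by metis
  have eq: "tr (adj A * A) = (\<Sum>i<n. \<Sum>k<n. (cmod (ent A k i))\<^sup>2)"
    using n by (simp add: tr_eq[of n] supp_times ent_times_right[of n] mult.commute complex_norm_square[symmetric]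
        flip: of_real_power)
  then show "tr (adj A * A) \<ge> 0" by (simp add: sum_nonneg)
  assume "tr (adj A * A) = 0"
  then have "(\<Sum>i<n. \<Sum>k<n. (cmod (ent A k i))\<^sup>2) = 0" using eq by simp
  then have "\<forall>i<n. (\<Sum>k<n. (cmod (ent A k i))\<^sup>2) = 0"
    by (subst (asm) sum_nonneg_eq_0_iff) (auto intro: sum_nonneg)
  then have "\<forall>i<n. \<forall>k<n. (cmod (ent A k i))\<^sup>2 = 0"
    by (auto simp: sum_nonneg_eq_0_iff)
  then show "A = 0" using n by (intro fop_eqI) (auto simp: supp_def, metis not_le)
qed

section \<open>The Loewner order\<close>

definition herm :: "fop \<Rightarrow> bool" where "herm A \<longleftrightarrow> adj A = A"

text \<open>The form is tested on operators \<open>V\<close> instead of vectors; a \<open>V\<close>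
  with one nonzero column plays the role of a vector. Stability under \<open>adj C * A * C\<close>
  is then a matter of associativity, with \<open>C * V\<close> in place of \<open>V\<close>.\<close>

definition pos :: "fop \<Rightarrow> bool" where
  "pos A \<longleftrightarrow> herm A \<and> (\<forall>V. 0 \<le> tr (adj V * A * V))"

text \<open>Polarization. The trace is only the real part, but since \<open>A\<close> is Hermitian
  both cross terms agree, so the bilinear form vanishes as well. Evaluated at \<open>A\<close> and
  the identity it is the Frobenius norm of \<open>A\<close>. This gives antisymmetry of the
  order.\<close>

lemma tr_polar:
  assumes A: "adj A = A" and z: "\<And>V. tr (adj V * A * V) = 0"
  shows "A = 0"
proof -
  have "tr (adj X * A * Y) = 0" for X Y
  proof -
    have e: "tr (adj Y * A * X) = tr (adj X * A * Y)"
      using tr_adj[of "adj Y * A * X"] A by (simp add: mult.assoc)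
    have "tr (adj (X + Y) * A * (X + Y)) = tr (adj X * A * X) + tr (adj Y * A * Y) + 2 * tr (adj X * A * Y)"
      using e by (simp add: algebra_simps)
    then show ?thesis using z[of X] z[of Y] z[of "X + Y"] by linarith
  qed
  note h = this
  obtain n where n: "supp n A" using ex_supp by metis
  have "tr (adj A * A) = 0" using h[of A "one n"] n A by (simp add: mult.assoc)
  then show ?thesis by (rule tr_adj_self_eq_0)
qed

text \<open>As a class instance, the Loewner order inherits \<open>add_mono\<close>,
  \<open>sum_mono\<close> and \<open>scaleR_left_mono\<close>, on which the later chains of operator
  inequalities rely.\<close>

instantiation fop :: ordered_real_vector
begin
definition less_eq_fop :: "fop \<Rightarrow> fop \<Rightarrow> bool" where "A \<le> B \<longleftrightarrow> pos (B - A)"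
definition less_fop :: "fop \<Rightarrow> fop \<Rightarrow> bool" where "A < B \<longleftrightarrow> A \<le> B \<and> \<not> B \<le> (A :: fop)"

lemma pos_plus: "pos A \<Longrightarrow> pos B \<Longrightarrow> pos (A + B)"
  by (auto simp: pos_def herm_def algebra_simps)

lemma pos_scaleR: "pos A \<Longrightarrow> 0 \<le> r \<Longrightarrow> pos (r *\<^sub>R A)"
  by (auto simp: pos_def herm_def)

instance
proof
  fix x y z :: fop and a b :: real
  show "(x < y) = (x \<le> y \<and> \<not> y \<le> x)" by (simp add: less_fop_def)
  show "x \<le> x" by (simp add: less_eq_fop_def pos_def herm_def)
  show "x \<le> z" if "x \<le> y" "y \<le> z"
    using pos_plus[of "z - y" "y - x"] that by (simp add: less_eq_fop_def)
  show "x = y" if "x \<le> y" "y \<le> x"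
  proof -
    have "y - x = 0"
    proof (rule tr_polar)
      fix V
      have "tr (adj V * (y - x) * V) = - tr (adj V * (x - y) * V)"
        by (simp add: algebra_simps)
      moreover have "0 \<le> tr (adj V * (y - x) * V)" "0 \<le> tr (adj V * (x - y) * V)"
        using that by (auto simp: less_eq_fop_def pos_def)
      ultimately show "tr (adj V * (y - x) * V) = 0" by linarith
    qed (use that in \<open>simp add: less_eq_fop_def pos_def herm_def\<close>)
    then show ?thesis by simp
  qed
  show "z + x \<le> z + y" if "x \<le> y" using that by (simp add: less_eq_fop_def)
  show "a *\<^sub>R x \<le> a *\<^sub>R y" if "x \<le> y" "0 \<le> a"
    using pos_scaleR[of "y - x" a] that by (simp add: less_eq_fop_def scaleR_diff_right)
  show "a *\<^sub>R x \<le> b *\<^sub>R x" if "a \<le> b" "0 \<le> x"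
    using pos_scaleR[of x "b - a"] that by (simp add: less_eq_fop_def scaleR_diff_left)
qed
end

lemma nonneg_fop: "0 \<le> A \<longleftrightarrow> pos A"
  by (simp add: less_eq_fop_def)

lemma nonneg_herm: "0 \<le> A \<Longrightarrow> adj A = A"
  by (simp add: nonneg_fop pos_def herm_def)

lemma sandwich_nonneg: "0 \<le> A \<Longrightarrow> 0 \<le> adj C * A * C"
proof -
  assume "0 \<le> A"
  then have A: "adj A = A" and t: "\<And>V. 0 \<le> tr (adj V * A * V)"
    by (auto simp: nonneg_fop pos_def herm_def)
  show ?thesis
    unfolding nonneg_fop pos_def herm_def
    using A t[of "C * _"] by (simp add: mult.assoc)
qed

lemma sandwich_mono: "A \<le> B \<Longrightarrow> adj C * A * C \<le> adj C * B * C"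
  using sandwich_nonneg[of "B - A" C] by (simp add: algebra_simps)

lemma sandwich_herm_mono: "A \<le> B \<Longrightarrow> adj C = C \<Longrightarrow> C * A * C \<le> C * B * C"
  using sandwich_mono[of A B C] by simp

lemma adj_self_nonneg: "0 \<le> adj A * A"
  unfolding nonneg_fop pos_def herm_def
  using tr_adj_self[of "A * _"] by (simp add: mult.assoc)

lemma dg_nonneg: "(\<And>i. i < n \<Longrightarrow> 0 \<le> f i) \<Longrightarrow> 0 \<le> dg n f"
proof -
  assume f: "\<And>i. i < n \<Longrightarrow> 0 \<le> f i"
  have "dg n f = adj (dg n (\<lambda>i. sqrt (f i))) * dg n (\<lambda>i. sqrt (f i))"
    using f by (auto intro!: dg_cong)
  then show ?thesis using adj_self_nonneg by metis
qed

lemma one_nonneg [simp]: "0 \<le> one n"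
  by (rule dg_nonneg) simp

lemma tr_nonneg: "0 \<le> A \<Longrightarrow> 0 \<le> tr A"
proof -
  assume A: "0 \<le> A"
  obtain n where n: "supp n A" using ex_supp by metis
  have "0 \<le> tr (adj (one n) * A * one n)" using A unfolding nonneg_fop pos_def by blast
  then show ?thesis using n by simp
qed

lemma tr_mono: "A \<le> B \<Longrightarrow> tr A \<le> tr B"
  using tr_nonneg[of "B - A"] by simp

section \<open>The spectral theorem\<close>

text \<open>The unit eigenvector is stored as an operator \<open>V\<close> whose only nonzero column
  is the last one; \<open>E\<close> is the projection onto the last basis vector. The phase of an
  eigenvector is free: it is chosen to make the last coordinate \<open>c\<close> real, as a
  reflection that swaps the two vectors requires, and nonpositive, so that this reflection may
  divide by \<open>1 - c\<close>.\<close>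

lemma hermitian_eigenvector:
  fixes n :: nat
  defines "E \<equiv> one (Suc n) - one n"
  assumes sA: "supp (Suc n) A" and hA: "adj A = A"
  obtains V l c where "supp (Suc n) V" "V * E = V" "adj V * V = E" "A * V = l *\<^sub>R V"
    "E * V = c *\<^sub>R E" "c \<le> 0"
proof -
  define M where "M = mat (Suc n) (Suc n) (\<lambda>(i,j). ent A i j)"
  have M: "M \<in> carrier_mat (Suc n) (Suc n)" by (simp add: M_def)
  have "spectrum M \<noteq> {}" by (rule spectrum_non_empty[OF M]) simp
  then obtain v \<mu> where v: "eigenvector M v \<mu>" by (auto simp: spectrum_def eigenvalue_def)
  have vc: "v \<in> carrier_vec (Suc n)" and v0: "v \<noteq> 0\<^sub>v (Suc n)" and ev: "M *\<^sub>v v = \<mu> \<cdot>\<^sub>v v"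
    using v M by (auto simp: eigenvector_def)
  have evi: "(\<Sum>j<Suc n. ent A i j * v $ j) = \<mu> * v $ i" if "i < Suc n" for i
    using arg_cong[OF ev, of "\<lambda>x. x $ i"] that vc
    by (simp add: M_def scalar_prod_def row_def lessThan_atLeast0 del: sum.lessThan_Suc)
  define s where "s = (\<Sum>i<Suc n. (cmod (v $ i))\<^sup>2)"
  have "s > 0"
  proof -
    obtain i where "i < Suc n" "v $ i \<noteq> 0" using v0 vc by (metis carrier_vecD dim_vec eq_vecI index_zero_vec)
    then show ?thesis unfolding s_def by (intro sum_pos2[of _ i]) auto
  qed
  define \<phi> where "\<phi> = (if v $ n = 0 then 1 else - cnj (v $ n) / of_real (cmod (v $ n)))"
  have \<phi>1: "cmod \<phi> = 1" by (simp add: \<phi>_def norm_divide)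
  have \<phi>n: "\<phi> * v $ n = - of_real (cmod (v $ n))"
  proof (cases "v $ n = 0")
    case False
    have "\<phi> * v $ n = - (v $ n * cnj (v $ n)) / of_real (cmod (v $ n))"
      using False by (simp add: \<phi>_def)
    also have "v $ n * cnj (v $ n) = of_real (cmod (v $ n)) * of_real (cmod (v $ n))"
      by (simp add: complex_norm_square[symmetric] power2_eq_square)
    finally show ?thesis using False by simp
  qed (simp add: \<phi>_def)
  define w where "w i = \<phi> * v $ i / of_real (sqrt s)" for i
  have w1: "(\<Sum>i<Suc n. cnj (w i) * w i) = 1"
  proof -
    have "cnj (w i) * w i = of_real ((cmod (v $ i))\<^sup>2 / s)" for i
    proof -
      have "cnj (w i) * w i = of_real ((cmod (w i))\<^sup>2)"
        by (metis complex_norm_square mult.commute of_real_power)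
      also have "(cmod (w i))\<^sup>2 = (cmod (v $ i))\<^sup>2 / s"
        using \<open>s > 0\<close> \<phi>1 by (simp add: w_def norm_mult norm_divide power_divide)
      finally show ?thesis .
    qed
    then have "(\<Sum>i<Suc n. cnj (w i) * w i) = of_real (\<Sum>i<Suc n. (cmod (v $ i))\<^sup>2 / s)"
      by (simp only: of_real_sum)
    also have "(\<Sum>i<Suc n. (cmod (v $ i))\<^sup>2 / s) = 1"
      using \<open>s > 0\<close> by (simp only: sum_divide_distrib[symmetric] s_def[symmetric]) simp
    finally show ?thesis by simp
  qed
  have evw: "(\<Sum>j<Suc n. ent A i j * w j) = \<mu> * w i" if "i < Suc n" for i
  proof -
    have "(\<Sum>j<Suc n. ent A i j * w j) = \<phi> / of_real (sqrt s) * (\<Sum>j<Suc n. ent A i j * v $ j)"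
      unfolding sum_distrib_left by (rule sum.cong) (auto simp: w_def)
    then show ?thesis using evi[OF that] by (simp add: w_def)
  qed
  define V where "V = Op (\<lambda>i j. if i < Suc n \<and> j = n then w i else 0)"
  have entV: "ent V i j = (if i < Suc n \<and> j = n then w i else 0)" for i j
    unfolding V_def by (subst ent_Op[of "Suc n"]) auto
  have sV: "supp (Suc n) V" by (auto simp: supp_def entV)
  have entE: "ent E i j = (if i = n \<and> j = n then 1 else 0)" for i j
    by (auto simp: E_def)
  have VE: "V * E = V"
    by (rule fop_eqI) (auto simp: E_def algebra_simps ent_times_dg entV)
  have VV: "adj V * V = E"
  proof (rule fop_eqI)
    fix i j
    show "ent (adj V * V) i j = ent E i j"
      using w1 unfolding ent_times_right[OF sV] by (auto simp: entV entE)
  qed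
  have AV: "ent (A * V) i j = \<mu> * ent V i j" for i j
  proof -
    have "ent (A * V) i j = (if j = n then \<Sum>k<Suc n. ent A i k * w k else 0)"
      unfolding ent_times_right[OF sV] by (auto simp: entV)
    also have "\<dots> = \<mu> * ent V i j"
      using evw[of i] sA by (cases "i < Suc n") (auto simp: entV supp_def simp del: sum.lessThan_Suc)
    finally show ?thesis .
  qed
  \<comment> \<open>The Hermitian operator \<open>adj V * A * V\<close> has \<open>\<mu>\<close> as
    a diagonal entry, so the eigenvalue is real.\<close>
  have "ent (adj V * (A * V)) n n = \<mu>"
    using w1 unfolding ent_times_right[OF supp_times[OF sA sV]] AV
    by (simp add: entV mult.left_commute[of _ \<mu>] sum_distrib_left[symmetric] flip: distrib_left)
  moreover have "ent (adj V * (A * V)) n n = cnj (ent (adj V * (A * V)) n n)"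
    by (subst ent_adj[symmetric]) (simp add: hA mult.assoc)
  ultimately have "cnj \<mu> = \<mu>" by simp
  then have \<mu>: "\<mu> = of_real (Re \<mu>)" by (simp add: complex_eq_iff)
  have "A * V = Re \<mu> *\<^sub>R V" by (rule fop_eqI) (simp add: AV \<mu>[symmetric])
  moreover have "E * V = (- cmod (v $ n) / sqrt s) *\<^sub>R E"
  proof (rule fop_eqI)
    fix i j
    show "ent (E * V) i j = ent ((- cmod (v $ n) / sqrt s) *\<^sub>R E) i j"
      by (cases "i = n") (auto simp: E_def left_diff_distrib ent_dg_times entV w_def \<phi>n)
  qed
  moreover have "- cmod (v $ n) / sqrt s \<le> 0" using \<open>s > 0\<close> by simp
  ultimately show ?thesis using that[OF sV VE VV] by blast
qed

text \<open>A Householder reflection moves an eigenvector to the last basis vector, which splits off.\<close>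
lemma spectral_decomp:
  assumes "supp n A" "adj A = A"
  obtains U f where "supp n U" "adj U * U = one n" "U * adj U = one n" "A = U * dg n f * adj U"
proof -
  have "\<exists>U f. supp n U \<and> adj U * U = one n \<and> U * adj U = one n \<and> A = U * dg n f * adj U"
    using assms
  proof (induction n arbitrary: A)
    case 0
    have "A = 0" using 0 by (intro fop_eqI) (auto simp: supp_def)
    moreover have "one 0 = 0" by (rule fop_eqI) simp
    ultimately show ?case by (intro exI[of _ 0]) auto
  next
    case (Suc n)
    define E where "E = one (Suc n) - one n"
    obtain V l c where sV: "supp (Suc n) V" and V: "V * E = V" "adj V * V = E" "A * V = l *\<^sub>R V"
      "E * V = c *\<^sub>R E" "c \<le> 0"
      using hermitian_eigenvector[OF Suc.prems] unfolding E_def by metis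
    have sE: "supp (Suc n) E" unfolding E_def by (intro supp_minus supp_dg supp_mono[OF supp_dg]) simp
    have hE: "adj E = E" by (simp add: E_def)
    have EE: "E * E = E" by (rule fop_eqI) (auto simp: E_def algebra_simps ent_dg_times)
    have sn: "supp (Suc n) X" if "supp n X" for X using that by (auto elim: supp_mono)
    have E0: "X * E = 0" "E * X = 0" if "supp n X" for X
      using that sn[OF that] by (simp_all add: E_def algebra_simps)
    define I where "I = one (Suc n)"
    have I: "I * X = X" "X * I = X" if "supp (Suc n) X" for X using that by (simp_all add: I_def)
    have hI: "adj I = I" and sI: "supp (Suc n) I" by (simp_all add: I_def)
    have EadjV: "adj V * E = c *\<^sub>R E" using arg_cong[OF V(4), of adj] by (simp add: hE)
    define Z where "Z = V - E"
    \<comment> \<open>By \<open>ZZ\<close> below, \<open>2 - 2 * c\<close> is the squared length of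
      the column of \<open>Z\<close>, and \<open>r\<close> is 2 divided by it: \<open>W\<close> is
      the Householder reflection that swaps the columns \<open>E\<close> and
      \<open>V\<close>.\<close>
    define r where "r = 1 / (1 - c)"
    have ZZ: "adj Z * Z = (2 - 2 * c) *\<^sub>R E"
    proof -
      have "adj Z * Z = E - c *\<^sub>R E - (c *\<^sub>R E - E)"
        by (simp add: Z_def left_diff_distrib right_diff_distrib hE V EadjV EE)
      also have "\<dots> = (2 - 2 * c) *\<^sub>R E" by (rule fop_eqI) (simp add: algebra_simps)
      finally show ?thesis .
    qed
    have ZE: "Z * E = Z" by (simp add: Z_def algebra_simps V EE)
    have sZ: "supp (Suc n) Z" using sV sE by (auto simp: Z_def)
    define W where "W = I - r *\<^sub>R (Z * adj Z)"
    have sW: "supp (Suc n) W" unfolding W_def using sZ sI by (intro supp_minus supp_scaleR supp_times) auto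
    have hW: "adj W = W" by (simp add: W_def hI)
    have ZZZZ: "Z * adj Z * (Z * adj Z) = (2 - 2 * c) *\<^sub>R (Z * adj Z)"
    proof -
      have "Z * adj Z * (Z * adj Z) = Z * (adj Z * Z) * adj Z" by (simp add: mult.assoc)
      also have "\<dots> = (2 - 2 * c) *\<^sub>R (Z * adj Z)" by (simp only: ZZ mult_scaleR_right mult_scaleR_left ZE)
      finally show ?thesis .
    qed
    have sZZ: "supp (Suc n) (Z * adj Z)" using sZ by auto
    have "r * (1 - c) = 1" using V(5) by (simp add: r_def)
    moreover have "r * (r * (2 - 2 * c)) = 2 * r * (r * (1 - c))" by (simp add: algebra_simps)
    ultimately have rr: "r * (r * (2 - 2 * c)) = 2 * r" by simp
    have WW: "W * W = I"
    proof -
      define P where "P = Z * adj Z"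
      have P: "P * P = (2 - 2 * c) *\<^sub>R P" "I * P = P" "P * I = P"
        using ZZZZ I[OF sZZ] by (simp_all only: P_def)
      have "W * W = I - r *\<^sub>R P - (r *\<^sub>R P - (r * (r * (2 - 2 * c))) *\<^sub>R P)"
        unfolding W_def P_def[symmetric] left_diff_distrib right_diff_distrib
          mult_scaleR_left mult_scaleR_right P I[OF sI] scaleR_diff_right scaleR_scaleR ..
      also have "\<dots> = I" unfolding rr by (rule fop_eqI) (simp add: algebra_simps)
      finally show ?thesis .
    qed
    have WE: "W * E = V"
    proof -
      have "adj Z * E = (c - 1) *\<^sub>R E" by (simp add: Z_def algebra_simps hE EadjV EE)
      then have "Z * adj Z * E = (c - 1) *\<^sub>R Z" by (simp add: mult.assoc ZE)
      then have "W * E = E - (r * (c - 1)) *\<^sub>R Z" by (simp add: W_def left_diff_distrib I sE)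
      also have "r * (c - 1) = - 1" using V(5) by (simp add: r_def field_simps)
      finally show ?thesis by (simp add: Z_def)
    qed
    have WV: "W * V = E" using WE WW I(1)[OF sE] by (metis mult.assoc)
    define B where "B = W * A * W"
    have sB: "supp (Suc n) B" unfolding B_def using sW Suc.prems by auto
    have hB: "adj B = B" using Suc.prems by (simp add: B_def hW mult.assoc)
    have BE: "B * E = l *\<^sub>R E" by (simp add: B_def mult.assoc WE V WV)
    have EB: "E * B = l *\<^sub>R E" using arg_cong[OF BE, of adj] by (simp add: hE hB)
    define B' where "B' = B - l *\<^sub>R E"
    \<comment> \<open>\<open>E\<close> is annihilated by \<open>B'\<close> from both sides, so
      \<open>I - E\<close>, which is \<open>one n\<close>, acts on \<open>B'\<close> as an
      identity.\<close>
    have "supp n B'"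
    proof -
      have o: "one n = I - E" by (simp add: I_def E_def)
      show ?thesis unfolding one_times_iff o
        by (simp add: B'_def left_diff_distrib right_diff_distrib BE EB EE I sB sE)
    qed
    moreover have "adj B' = B'" by (simp add: B'_def hB hE)
    ultimately obtain U f where U: "supp n U" "adj U * U = one n" "U * adj U = one n" "B' = U * dg n f * adj U"
      using Suc.IH by blast
    define U' where "U' = W * (U + E)"
    define g where "g i = (if i < n then f i else l)" for i
    have gE: "dg (Suc n) g = dg n f + l *\<^sub>R E" by (rule fop_eqI) (auto simp: g_def E_def less_Suc_eq)
    have oneE: "one n + E = I" "E + one n = I" by (rule fop_eqI, simp add: I_def E_def)+
    have sU': "supp (Suc n) (U + E)" using sn[OF U(1)] sE by auto
    have Uz: "U * E = 0" "E * U = 0" "adj U * E = 0" "E * adj U = 0" "dg n f * E = 0" "E * dg n f = 0"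
      using E0 U(1) by simp_all
    have "adj U' * U' = (adj U + E) * (W * W) * (U + E)" by (simp add: U'_def hW hE mult.assoc)
    also have "\<dots> = (adj U + E) * (U + E)" using sU' by (simp add: WW I mult.assoc)
    also have "\<dots> = I" by (simp add: left_diff_distrib distrib_left distrib_right Uz EE U oneE)
    finally have 1: "adj U' * U' = I" .
    have "(U + E) * (adj U + E) = I" by (simp add: distrib_left distrib_right Uz EE U oneE)
    then have "U' * adj U' = W * I * W" by (simp add: U'_def hW hE mult.assoc) (simp add: mult.assoc[symmetric])
    then have 2: "U' * adj U' = I" using sW by (simp add: I WW)
    have UEz: "U * (E * X) = 0" "U * (dg n f * (E * X)) = 0" "E * (dg n f * X) = 0" "E * (adj U) = 0" for X
      using Uz by (simp_all add: mult.assoc[symmetric])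
    have "(U + E) * dg (Suc n) g * (adj U + E) = B' + l *\<^sub>R E"
      by (simp add: gE U(4) algebra_simps Uz UEz EE)
    then have "U' * dg (Suc n) g * adj U' = W * B * W"
      by (simp add: U'_def hW hE mult.assoc B'_def) (simp add: mult.assoc[symmetric])
    also have "\<dots> = (W * W) * A * (W * W)" by (simp add: B_def mult.assoc)
    also have "\<dots> = A" using Suc.prems(1) by (simp only: WW) (simp add: I mult.assoc)
    finally have 3: "A = U' * dg (Suc n) g * adj U'" by simp
    have "supp (Suc n) U'" unfolding U'_def using sW sU' by blast
    with 1 2 3 show ?case unfolding I_def by blast
  qed
  then show ?thesis using that by blast
qed

text \<open>Undo the unitary, then test the inequality on the i-th coordinate projection. With
  \<open>c = 0\<close> this makes the eigenvalues of a nonnegative operator nonnegative; with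
  positive \<open>c\<close> it makes the sum of tests invertible.\<close>

lemma spectral_lower_bound:
  assumes U: "supp n U" "adj U * U = one n" "U * adj U = one n"
    and le: "c *\<^sub>R one n \<le> U * dg n f * adj U" and i: "i < n"
  shows "c \<le> f i"
proof -
  have "adj U * (c *\<^sub>R one n) * U \<le> adj U * (U * dg n f * adj U) * U"
    by (rule sandwich_mono[OF le])
  also have "\<dots> = (adj U * U) * dg n f * (adj U * U)" by (simp add: mult.assoc)
  also have "\<dots> = dg n f" by (simp only: U) simp
  finally have le': "c *\<^sub>R one n \<le> dg n f" using U by (simp add: mult.assoc)
  define e where "e = dg n (\<lambda>j. if j = i then 1 else 0)"
  have "tr (adj e * (c *\<^sub>R one n) * e) \<le> tr (adj e * dg n f * e)"
    by (rule tr_mono[OF sandwich_mono[OF le']])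
  then show ?thesis using i by (simp add: e_def dg_scaleR if_distrib[of "\<lambda>x. x * _"] if_distrib[of "\<lambda>x. _ * x"] cong: if_cong)
qed

lemma nonneg_spectral_decomp:
  assumes "supp n A" "0 \<le> A"
  obtains U f where "supp n U" "adj U * U = one n" "U * adj U = one n" "A = U * dg n f * adj U"
    "\<And>i. i < n \<Longrightarrow> 0 \<le> f i"
proof -
  obtain U f where *: "supp n U" "adj U * U = one n" "U * adj U = one n" "A = U * dg n f * adj U"
    using spectral_decomp[OF assms(1) nonneg_herm[OF assms(2)]] by metis
  moreover have "0 \<le> f i" if "i < n" for i
    by (rule spectral_lower_bound[OF *(1-3) _ that]) (use assms * in simp)
  ultimately show ?thesis using that by blast
qed

text \<open>The spectral decomposition gives \<open>A = C * adj C\<close>, and cyclicity turns the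
  trace into that of the nonnegative operator \<open>adj C * B * C\<close>.\<close>

lemma tr_mult_nonneg:
  assumes "0 \<le> A" "0 \<le> B" shows "0 \<le> tr (A * B)"
proof -
  obtain n where n: "supp n A" "supp n B" "supp n B" using ex_supp3 by metis
  obtain U f where U: "A = U * dg n f * adj U" "\<And>i. i < n \<Longrightarrow> 0 \<le> f i"
    using nonneg_spectral_decomp[OF n(1) assms(1)] by metis
  have A: "A = (U * dg n (\<lambda>i. sqrt (f i))) * (dg n (\<lambda>i. sqrt (f i)) * adj U)"
    unfolding U(1) mult.assoc using U(2)
    by (subst (3) mult.assoc[symmetric]) (auto intro!: arg_cong2[of _ _ _ _ "(*)"] dg_cong)
  define C where "C = U * dg n (\<lambda>i. sqrt (f i))"
  have "tr (A * B) = tr (C * (adj C * B))" unfolding A by (simp add: C_def mult.assoc)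
  also have "\<dots> = tr (adj C * B * C)" by (rule tr_commute)
  also have "\<dots> \<ge> 0" by (rule tr_nonneg[OF sandwich_nonneg[OF assms(2)]])
  finally show ?thesis .
qed

lemma tr_mult_mono: "A \<le> B \<Longrightarrow> 0 \<le> C \<Longrightarrow> tr (A * C) \<le> tr (B * C)"
  using tr_mult_nonneg[of "B - A" C] by (simp add: algebra_simps)

lemma tr_mult_mono': "A \<le> B \<Longrightarrow> 0 \<le> C \<Longrightarrow> tr (C * A) \<le> tr (C * B)"
  using tr_mult_mono[of A B C] by (simp add: tr_commute)

text \<open>If \<open>X - S\<close> had an eigenvector \<open>v\<close> with eigenvalue \<open>l < 0\<close>, then
  \<open>X\<^sup>2 - S\<^sup>2 = X (X - S) + (X - S) S\<close> gives \<open>l (\<langle>v, X v\<rangle> + \<langle>v, S v\<rangle>) \<ge> 0\<close>, so both forms vanish.\<close>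
lemma sqrt_mono:
  fixes S X :: fop
  assumes "0 \<le> S" "0 \<le> X" and le: "S * S \<le> X * X"
  shows "S \<le> X"
proof -
  define D where "D = X - S"
  obtain n where n: "supp n X" "supp n S" "supp n S" using ex_supp3 by metis
  have "supp n D" "adj D = D" using n assms nonneg_herm by (auto simp: D_def)
  then obtain U f where U: "supp n U" "adj U * U = one n" "U * adj U = one n" "D = U * dg n f * adj U"
    using spectral_decomp by metis
  have "0 \<le> f i" if i: "i < n" for i
  proof (rule ccontr)
    assume neg: "\<not> 0 \<le> f i"
    define e where "e = dg n (\<lambda>j. if j = i then 1 else 0)"
    define V where "V = U * e"
    have fe: "dg n f * e = f i *\<^sub>R e"
      by (rule fop_eqI) (auto simp: e_def ent_dg_times)
    have DV: "D * V = f i *\<^sub>R V"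
    proof -
      have "D * V = U * dg n f * (adj U * U) * e" by (simp add: U(4) V_def mult.assoc)
      also have "\<dots> = U * (dg n f * (one n * e))" by (simp only: U(2) mult.assoc)
      also have "one n * e = e" by (simp add: e_def)
      also have "U * (dg n f * e) = f i *\<^sub>R V" by (simp only: fe V_def mult_scaleR_right)
      finally show ?thesis .
    qed
    have VD: "adj V * D = f i *\<^sub>R adj V"
      using arg_cong[OF DV, of adj] \<open>adj D = D\<close> by simp
    have e1: "X * X - S * S = X * D + D * S" by (simp add: D_def algebra_simps)
    have "adj V * (X * X - S * S) * V = adj V * X * (D * V) + (adj V * D) * S * V"
      unfolding e1 by (simp add: algebra_simps)
    also have "tr \<dots> = f i * (tr (adj V * X * V) + tr (adj V * S * V))"
      by (simp add: DV VD algebra_simps)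
    finally have "0 \<le> f i * (tr (adj V * X * V) + tr (adj V * S * V))"
      using tr_nonneg[OF sandwich_nonneg[of "X * X - S * S" V]] le by simp
    moreover have p: "0 \<le> tr (adj V * X * V)" "0 \<le> tr (adj V * S * V)"
      using assms by (auto intro: tr_nonneg sandwich_nonneg)
    ultimately have z: "tr (adj V * X * V) = 0" "tr (adj V * S * V) = 0"
      using neg mult_neg_pos[of "f i" "tr (adj V * X * V) + tr (adj V * S * V)"] by linarith+
    \<comment> \<open>Both forms vanish at the eigenvector, hence so does their difference, the form
      of \<open>D\<close>. But its value there is the negative eigenvalue
      \<open>f i\<close>.\<close>
    have "tr (adj V * D * V) = 0" using z by (simp add: D_def algebra_simps)
    moreover have "tr (adj V * D * V) = f i * tr (adj V * V)" by (simp add: VD)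
    moreover have "adj V * V = e"
    proof -
      have "adj V * V = e * (adj U * U) * e" by (simp add: V_def e_def mult.assoc)
      then show ?thesis by (simp add: U(2)) (auto simp: e_def intro!: dg_cong)
    qed
    moreover have "tr e = 1" using i by (simp add: e_def)
    ultimately show False using neg by simp
  qed
  then have "0 \<le> adj (adj U) * dg n f * adj U" by (intro sandwich_nonneg dg_nonneg) auto
  then have "0 \<le> X - S" using U(4) by (simp only: D_def adj_adj)
  then show ?thesis by simp
qed

section \<open>The square-root measurement\<close>

text \<open>With I the identity, T - T T = T (I - T) T + (I - T) T (I - T), a sum of two nonnegative
  sandwiches.\<close>

lemma effect_square_le:
  assumes "0 \<le> T" "T \<le> one D" and sT: "supp D T"
  shows "T * T \<le> T"
proof -
  have hT: "adj T = T" by (rule nonneg_herm[OF assms(1)])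
  have "0 \<le> T * (one D - T) * T + (one D - T) * T * (one D - T)"
    using sandwich_nonneg[of "one D - T" T] sandwich_nonneg[OF assms(1), of "one D - T"] assms(2) hT
    by (intro add_nonneg_nonneg) simp_all
  also have "\<dots> = T - T * T"
    using sT supp_times[OF sT sT] by (simp add: algebra_simps)
  finally show ?thesis by simp
qed

text \<open>The Hayashi--Nagaoka inequality, with \<open>Q\<close> the sum of the competing operators and
  \<open>R\<close> the inverse square root of \<open>W = T + Q\<close>.\<close>
lemma hayashi_nagaoka:
  assumes T: "0 \<le> T" "T \<le> one D" "supp D T" and Q: "0 \<le> Q" "supp D Q"
    and R: "adj R = R" "supp D R" and X: "0 \<le> X" "supp D X"
    and W: "X * X = T + Q" and RX: "R * X = one D" "X * R = one D"
  shows "one D - R * T * R \<le> 2 *\<^sub>R (one D - T) + 4 *\<^sub>R Q"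
proof -
  define I where "I = one D"
  have I: "I * Y = Y" "Y * I = Y" if "supp D Y" for Y using that by (simp_all add: I_def)
  have sI: "supp D I" and hI: "adj I = I" by (simp_all add: I_def)
  note RX' = RX[folded I_def]
  have RRX: "R * (X * Y) = Y" "X * (R * Y) = Y" if "supp D Y" for Y
    using RX' I[OF that] by (simp_all add: mult.assoc[symmetric])
  have RWR: "R * (T + Q) * R = I"
    unfolding W[symmetric] using RX' I[OF sI] RRX(1)[OF sI] R(2) by (simp add: mult.assoc)
  then have "I - R * T * R = R * Q * R" by (simp add: algebra_simps)
  also have "\<dots> \<le> 2 *\<^sub>R ((R - I) * Q * (R - I)) + 2 *\<^sub>R Q"
  proof -
    \<comment> \<open>This is the Cauchy-Schwarz step: expanding the square yields twice the
      sandwich by \<open>R - I\<close>, plus \<open>2 *\<^sub>R Q\<close>, minus the operator to be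
      bounded.\<close>
    have "0 \<le> (R - 2 *\<^sub>R I) * Q * (R - 2 *\<^sub>R I)"
      using sandwich_nonneg[OF Q(1), of "R - 2 *\<^sub>R I"] R hI by simp
    also have "\<dots> = 2 *\<^sub>R ((R - I) * Q * (R - I)) + 2 *\<^sub>R Q - R * Q * R"
    proof -
      have s: "supp D (Q * R)" "supp D (R * Q)" using Q R by auto
      show ?thesis
        by (rule fop_eqI) (simp add: left_diff_distrib right_diff_distrib mult.assoc I Q s algebra_simps)
    qed
    finally show ?thesis by simp
  qed
  also have "\<dots> \<le> 2 *\<^sub>R (I - 2 *\<^sub>R X + (T + Q)) + 2 *\<^sub>R Q"
  proof -
    \<comment> \<open>Enlarging \<open>Q\<close> to \<open>T + Q = X * X\<close> makes the sandwich
      explicit: \<open>R\<close> inverts \<open>X\<close>, so the result is the square of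
      \<open>I - X\<close>.\<close>
    have "(R - I) * Q * (R - I) \<le> (R - I) * (T + Q) * (R - I)"
      by (rule sandwich_herm_mono) (use T R hI in auto)
    also have "\<dots> = I - 2 *\<^sub>R X + (T + Q)"
      unfolding W[symmetric]
    proof -
      have s: "supp D (X * X)" "supp D (X * R)" "supp D (X * (X * R))" "supp D X" using X R by auto
      have "(R - I) * (X * X) * (R - I) = (R * (X * (X * R))) - R * (X * X) - X * (X * R) + X * X"
        by (simp add: left_diff_distrib right_diff_distrib mult.assoc I s)
      also have "\<dots> = I - X - X + X * X"
        using RRX(1)[OF s(2)] RRX(1)[OF s(4)] RX' I s(4) by simp
      finally show "(R - I) * (X * X) * (R - I) = I - 2 *\<^sub>R X + X * X" by (simp add: scaleR_2)
    qed
    finally show ?thesis by (intro add_mono scaleR_left_mono order_refl) auto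
  qed
  also have "\<dots> \<le> 2 *\<^sub>R (I - 2 *\<^sub>R T + (T + Q)) + 2 *\<^sub>R Q"
  proof -
    \<comment> \<open>\<open>T * T \<le> T \<le> T + Q = X * X\<close>. Monotonicity of the root
      gives \<open>T \<le> X\<close>, and this replaces the term \<open>- 2 *\<^sub>R X\<close> by
      \<open>- 2 *\<^sub>R T\<close>.\<close>
    have "T * T \<le> X * X" using effect_square_le[OF T] Q(1) W by (metis add_increasing2 order_trans order_refl)
    then have "T \<le> X" by (rule sqrt_mono[OF T(1) X(1)])
    then show ?thesis by (intro add_mono diff_mono scaleR_left_mono order_refl) auto
  qed
  also have "\<dots> = 2 *\<^sub>R (I - T) + 4 *\<^sub>R Q"
    by (rule fop_eqI) (simp add: algebra_simps)
  finally show ?thesis by (simp add: I_def)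
qed

text \<open>Mixing a multiple of the identity into the tests makes their sum invertible, at the cost \<open>\<eta>\<close>.\<close>
lemma square_root_measurement:
  assumes S: "finite S" "S \<noteq> {}" and T: "\<And>i. i \<in> S \<Longrightarrow> 0 \<le> T i \<and> T i \<le> one D \<and> supp D (T i)"
    and \<eta>: "0 < \<eta>"
  obtains \<Lambda> where "\<And>i. i \<in> S \<Longrightarrow> 0 \<le> \<Lambda> i \<and> supp D (\<Lambda> i)" "(\<Sum>i\<in>S. \<Lambda> i) = one D"
    "\<And>i. i \<in> S \<Longrightarrow> one D - \<Lambda> i \<le> 2 *\<^sub>R (one D - T i) + 4 *\<^sub>R (\<Sum>j\<in>S - {i}. T j) + \<eta> *\<^sub>R one D"
proof -
  \<comment> \<open>Every competitor brings \<open>h *\<^sub>R one D\<close> into the term with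
    factor 4, so \<open>4 * card S * h\<close> must not exceed \<open>\<eta>\<close>. The cap 1
    keeps \<open>T'\<close> a convex combination.\<close>
  define h where "h = min 1 (\<eta> / (4 * card S))"
  have cS: "card S > 0" using S by (simp add: card_gt_0_iff)
  have h: "0 < h" "h \<le> 1" "4 * (card S * h) \<le> \<eta>"
    using cS \<eta> by (auto simp: h_def min_def field_simps)
  define T' where "T' i = (1 - h) *\<^sub>R T i + h *\<^sub>R one D" for i
  have T'0: "0 \<le> T' i" "h *\<^sub>R one D \<le> T' i" "supp D (T' i)" "T' i \<le> T i + h *\<^sub>R one D" "T' i \<le> one D"
    "one D - T' i \<le> one D - T i" if "i \<in> S" for i
  proof -
    note t = T[OF that]
    have a: "0 \<le> (1 - h) *\<^sub>R T i" using t h by (simp add: scaleR_nonneg_nonneg)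
    have b: "0 \<le> h *\<^sub>R one D" using h by (simp add: scaleR_nonneg_nonneg)
    show "0 \<le> T' i" "h *\<^sub>R one D \<le> T' i" using a b by (simp_all add: T'_def)
    show "supp D (T' i)" unfolding T'_def using t by (intro supp_plus supp_scaleR supp_dg) auto
    have "0 \<le> h *\<^sub>R T i" using t h by (simp add: scaleR_nonneg_nonneg)
    then show "T' i \<le> T i + h *\<^sub>R one D" by (simp add: T'_def scaleR_diff_left)
    have "(1 - h) *\<^sub>R T i \<le> (1 - h) *\<^sub>R one D" using t h by (intro scaleR_left_mono) auto
    then show "T' i \<le> one D" by (simp add: T'_def scaleR_diff_left algebra_simps)
    have "h *\<^sub>R T i \<le> h *\<^sub>R one D" using t h by (intro scaleR_left_mono) auto
    then show "one D - T' i \<le> one D - T i" by (simp add: T'_def scaleR_diff_left)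
  qed
  define W where "W = (\<Sum>i\<in>S. T' i)"
  have sW: "supp D W" using T'0 by (auto simp: W_def)
  obtain i0 where i0: "i0 \<in> S" using S by auto
  have W: "h *\<^sub>R one D \<le> W"
  proof -
    have "0 \<le> (\<Sum>i\<in>S - {i0}. T' i)" using T'0 by (auto intro!: sum_nonneg)
    then show ?thesis
      using T'0(2)[OF i0] i0 S unfolding W_def by (simp add: sum.remove add_increasing2)
  qed
  have "adj W = W" using T'0 nonneg_herm by (auto simp: W_def)
  then obtain U f where U: "supp D U" "adj U * U = one D" "U * adj U = one D" "W = U * dg D f * adj U"
    using spectral_decomp[OF sW] by metis
  have f: "f i > 0" if "i < D" for i
    using spectral_lower_bound[OF U(1-3) W[unfolded U(4)] that] h by linarith
  have prod: "(U * dg D a * adj U) * (U * dg D b * adj U) = U * dg D (\<lambda>i. a i * b i) * adj U" for a b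
  proof -
    have "(U * dg D a * adj U) * (U * dg D b * adj U) = U * (dg D a * ((adj U * U) * dg D b)) * adj U"
      by (simp add: mult.assoc)
    then show ?thesis by (simp add: U)
  qed
  define R where "R = U * dg D (\<lambda>i. 1 / sqrt (f i)) * adj U"
  define X where "X = U * dg D (\<lambda>i. sqrt (f i)) * adj U"
  have UU: "U * one D * adj U = one D" using U by simp
  have R: "adj R = R" "supp D R" using U by (auto simp: R_def mult.assoc)
  have X: "0 \<le> X" "supp D X"
  proof -
    have "0 \<le> adj (adj U) * dg D (\<lambda>i. sqrt (f i)) * adj U"
      by (intro sandwich_nonneg dg_nonneg) (use f in \<open>auto intro: less_imp_le\<close>)
    then show "0 \<le> X" by (simp add: X_def)
    show "supp D X" using U by (auto simp: X_def)
  qed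
  have XX: "X * X = W" unfolding X_def prod U(4)
    using f by (intro arg_cong2[of _ _ _ _ "(*)"] dg_cong refl) (simp add: abs_of_pos)
  have RX: "R * X = one D" "X * R = one D"
  proof -
    have "dg D (\<lambda>i. 1 / sqrt (f i) * sqrt (f i)) = one D" "dg D (\<lambda>i. sqrt (f i) * (1 / sqrt (f i))) = one D"
      using f by (auto intro!: dg_cong) (metis less_irrefl real_sqrt_eq_zero_cancel_iff)+
    then show "R * X = one D" "X * R = one D" unfolding X_def R_def prod by (simp_all only: UU)
  qed
  show ?thesis
  proof (rule that[of "\<lambda>i. R * T' i * R"])
    fix i assume i: "i \<in> S"
    show "0 \<le> R * T' i * R \<and> supp D (R * T' i * R)"
      using sandwich_nonneg[of "T' i" R] R T'0 i by auto
    define Q where "Q = (\<Sum>j\<in>S - {i}. T' j)"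
    have WQ: "W = T' i + Q" using S i by (simp add: W_def Q_def sum.remove)
    have Q: "0 \<le> Q" "supp D Q" using T'0 by (auto simp: Q_def intro!: sum_nonneg)
    have "one D - R * T' i * R \<le> 2 *\<^sub>R (one D - T' i) + 4 *\<^sub>R Q"
      by (rule hayashi_nagaoka[of "T' i" D Q R X]) (use T'0[OF i] Q R X XX WQ RX in auto)
    also have "\<dots> \<le> 2 *\<^sub>R (one D - T i) + 4 *\<^sub>R ((\<Sum>j\<in>S - {i}. T j) + (card S * h) *\<^sub>R one D)"
    proof (intro add_mono scaleR_left_mono T'0(6) i)
      have "Q \<le> (\<Sum>j\<in>S - {i}. T j + h *\<^sub>R one D)" unfolding Q_def by (intro sum_mono T'0(4)) auto
      also have "\<dots> = (\<Sum>j\<in>S - {i}. T j) + (card (S - {i}) * h) *\<^sub>R one D"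
        by (simp add: sum.distrib sum_constant_scaleR)
      also have "\<dots> \<le> (\<Sum>j\<in>S - {i}. T j) + (card S * h) *\<^sub>R one D"
        using h S by (intro add_mono scaleR_right_mono mult_right_mono order_refl) (auto intro: card_mono)
      finally show "Q \<le> \<dots>" .
    qed auto
    also have "\<dots> = 2 *\<^sub>R (one D - T i) + 4 *\<^sub>R (\<Sum>j\<in>S - {i}. T j) + (4 * (card S * h)) *\<^sub>R one D"
      by (simp add: scaleR_add_right)
    also have "\<dots> \<le> 2 *\<^sub>R (one D - T i) + 4 *\<^sub>R (\<Sum>j\<in>S - {i}. T j) + \<eta> *\<^sub>R one D"
      using h by (intro add_mono scaleR_right_mono order_refl) auto
    finally show "one D - R * T' i * R \<le> 2 *\<^sub>R (one D - T i) + 4 *\<^sub>R (\<Sum>j\<in>S - {i}. T j) + \<eta> *\<^sub>R one D" .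
  next
    have "(\<Sum>i\<in>S. R * T' i * R) = R * W * R" by (simp add: W_def sum_distrib_left sum_distrib_right)
    also have "\<dots> = (R * X) * (X * R)" by (simp only: XX[symmetric] mult.assoc)
    finally show "(\<Sum>i\<in>S. R * T' i * R) = one D" by (simp add: RX)
  qed
qed

section \<open>Random codebooks\<close>

text \<open>The expectation over words drawn independently for the messages in \<open>J\<close>, as
  a finite sum. Extensional functions make the set of codebooks finite.\<close>

definition pexp :: "'i set \<Rightarrow> 'a set \<Rightarrow> ('a \<Rightarrow> real) \<Rightarrow> (('i \<Rightarrow> 'a) \<Rightarrow> real) \<Rightarrow> real" where
  "pexp J X p g = (\<Sum>c\<in>J \<rightarrow>\<^sub>E X. (\<Prod>j\<in>J. p (c j)) * g c)"

text \<open>Conditioning on the word of one message. Peeling off one or two messages leaves a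
  function that ignores all other words, whose weights then sum to 1.\<close>

lemma pexp_insert:
  assumes "finite J" "j \<notin> J"
  shows "pexp (insert j J) X p g = (\<Sum>x\<in>X. p x * pexp J X p (\<lambda>c. g (c(j := x))))"
proof -
  have inj: "inj_on (\<lambda>(y, c). c(j := y)) (X \<times> (J \<rightarrow>\<^sub>E X))"
    using assms(2) by (rule inj_combinator)
  have "pexp (insert j J) X p g = (\<Sum>(y, c)\<in>X \<times> (J \<rightarrow>\<^sub>E X). (\<Prod>i\<in>insert j J. p ((c(j := y)) i)) * g (c(j := y)))"
    unfolding pexp_def PiE_insert_eq by (subst sum.reindex[OF inj]) (simp add: o_def case_prod_beta)
  also have "\<dots> = (\<Sum>(y, c)\<in>X \<times> (J \<rightarrow>\<^sub>E X). p y * ((\<Prod>i\<in>J. p (c i)) * g (c(j := y))))"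
  proof (intro sum.cong refl, clarify)
    fix y c
    have "(\<Prod>i\<in>J. p ((c(j := y)) i)) = (\<Prod>i\<in>J. p (c i))"
      using assms by (intro prod.cong) auto
    then show "(\<Prod>i\<in>insert j J. p ((c(j := y)) i)) * g (c(j := y)) = p y * ((\<Prod>i\<in>J. p (c i)) * g (c(j := y)))"
      using assms by simp
  qed
  also have "\<dots> = (\<Sum>x\<in>X. p x * pexp J X p (\<lambda>c. g (c(j := x))))"
    by (simp add: pexp_def sum.cartesian_product sum_distrib_left)
  finally show ?thesis .
qed

lemma pexp_add: "pexp J X p (\<lambda>c. f c + g c) = pexp J X p f + pexp J X p g"
  by (simp add: pexp_def distrib_left sum.distrib)

lemma pexp_sum: "pexp J X p (\<lambda>c. \<Sum>s\<in>S. f s c) = (\<Sum>s\<in>S. pexp J X p (f s))"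
  unfolding pexp_def by (simp add: sum_distrib_left) (rule sum.swap)

lemma pexp_cmult: "pexp J X p (\<lambda>c. r * f c) = r * pexp J X p f"
  by (simp add: pexp_def sum_distrib_left mult.left_commute)

locale distr =
  fixes X :: "'a set" and p :: "'a \<Rightarrow> real"
  assumes fin: "finite X" and nonneg: "x \<in> X \<Longrightarrow> 0 \<le> p x" and sum1: "sum p X = 1"
begin

lemma pexp_mono:
  assumes "\<And>c. c \<in> J \<rightarrow>\<^sub>E X \<Longrightarrow> f c \<le> g c"
  shows "pexp J X p f \<le> pexp J X p g"
  unfolding pexp_def
  by (intro sum_mono mult_left_mono assms prod_nonneg) (auto intro: nonneg)

lemma pexp_const: "finite J \<Longrightarrow> pexp J X p (\<lambda>_. r) = r"
  by (induction J rule: finite_induct)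
    (simp_all add: pexp_def[of "{}"] pexp_insert sum_distrib_right[symmetric] sum1)

lemma pexp_single:
  assumes "finite J" "m \<in> J"
  shows "pexp J X p (\<lambda>c. f (c m)) = (\<Sum>x\<in>X. p x * f x)"
proof -
  have "pexp (insert m (J - {m})) X p (\<lambda>c. f (c m)) = (\<Sum>x\<in>X. p x * f x)"
    using assms by (subst pexp_insert) (auto simp: pexp_const)
  then show ?thesis using assms by (simp add: insert_absorb)
qed

lemma pexp_pair:
  assumes "finite J" "m \<in> J" "m' \<in> J" "m \<noteq> m'"
  shows "pexp J X p (\<lambda>c. f (c m) (c m')) = (\<Sum>x\<in>X. p x * (\<Sum>x'\<in>X. p x' * f x x'))"
proof -
  have "pexp (insert m (J - {m})) X p (\<lambda>c. f (c m) (c m')) = (\<Sum>x\<in>X. p x * (\<Sum>x'\<in>X. p x' * f x x'))"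
    using assms by (subst pexp_insert) (auto simp: pexp_single)
  then show ?thesis using assms by (simp add: insert_absorb)
qed

lemma weighted_le:
  assumes "\<And>x. x \<in> X \<Longrightarrow> f x \<le> r"
  shows "(\<Sum>x\<in>X. p x * f x) \<le> r"
proof -
  have "(\<Sum>x\<in>X. p x * f x) \<le> (\<Sum>x\<in>X. p x * r)"
    by (intro sum_mono mult_left_mono assms nonneg)
  then show ?thesis by (simp add: sum_distrib_right[symmetric] sum1)
qed

end

section \<open>Packing with a smoothed state\<close>

definition proj :: "nat \<Rightarrow> fop \<Rightarrow> bool" where
  "proj D P \<longleftrightarrow> supp D P \<and> adj P = P \<and> P * P = P"

lemma proj_compl: "proj D P \<Longrightarrow> proj D (one D - P)"
  by (simp add: proj_def left_diff_distrib right_diff_distrib)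

lemma proj_nonneg: "proj D P \<Longrightarrow> 0 \<le> P"
  using adj_self_nonneg[of P] by (simp add: proj_def)

lemma proj_le_one: "proj D P \<Longrightarrow> P \<le> one D"
  using proj_nonneg[OF proj_compl] by fastforce

lemma proj_sandwich_le:
  assumes "proj D P" "A \<le> r *\<^sub>R one D" "0 \<le> r"
  shows "P * A * P \<le> r *\<^sub>R one D"
proof -
  have "P * A * P \<le> P * (r *\<^sub>R one D) * P"
    using assms by (intro sandwich_herm_mono) (auto simp: proj_def)
  also have "\<dots> = r *\<^sub>R P" using assms by (simp add: proj_def)
  also have "\<dots> \<le> r *\<^sub>R one D" using assms by (intro scaleR_left_mono proj_le_one)
  finally show ?thesis .
qed

text \<open>With Q = 1 - P, the parallelogram law for the form of E: the sandwiches by P + Q and P -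
  Q add up to 2 P E P + 2 Q E Q, those by 1 - Q and 1 + Q to 2 E + 2 Q E Q. In each case one
  sandwich is dropped as nonnegative, and Q E Q \<le> Q.\<close>

lemma effect_split:
  assumes P: "proj D P" and E: "0 \<le> E" "E \<le> one D" "supp D E"
  shows "E \<le> 2 *\<^sub>R (P * E * P) + 2 *\<^sub>R (one D - P)"
    and "P * E * P \<le> 2 *\<^sub>R E + 2 *\<^sub>R (one D - P)"
proof -
  define Q where "Q = one D - P"
  have Q: "proj D Q" using proj_compl[OF P] by (simp add: Q_def)
  have QEQ: "Q * E * Q \<le> Q"
    using sandwich_herm_mono[OF E(2), of Q] Q by (simp add: proj_def)
  have s: "supp D (P * E)" "supp D (E * P)" "supp D (P * (E * P))" using P E by (auto simp: proj_def)
  have "0 \<le> (P - Q) * E * (P - Q)"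
    using sandwich_nonneg[OF E(1), of "P - Q"] P Q by (simp add: proj_def)
  also have "\<dots> = 2 *\<^sub>R (P * E * P) + 2 *\<^sub>R (Q * E * Q) - E"
    by (rule fop_eqI) (simp add: Q_def left_diff_distrib right_diff_distrib mult.assoc s E)
  finally have "E \<le> 2 *\<^sub>R (P * E * P) + 2 *\<^sub>R (Q * E * Q)" by simp
  also have "\<dots> \<le> 2 *\<^sub>R (P * E * P) + 2 *\<^sub>R Q"
    by (intro add_mono scaleR_left_mono QEQ) auto
  finally show "E \<le> 2 *\<^sub>R (P * E * P) + 2 *\<^sub>R (one D - P)" by (simp add: Q_def)
  have "0 \<le> (one D + Q) * E * (one D + Q)"
    using sandwich_nonneg[OF E(1), of "one D + Q"] Q by (simp add: proj_def)
  also have "\<dots> = 2 *\<^sub>R E + 2 *\<^sub>R (Q * E * Q) - P * E * P"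
    by (rule fop_eqI) (simp add: Q_def left_diff_distrib right_diff_distrib distrib_left distrib_right mult.assoc s E)
  finally have "P * E * P \<le> 2 *\<^sub>R E + 2 *\<^sub>R (Q * E * Q)" by simp
  also have "\<dots> \<le> 2 *\<^sub>R E + 2 *\<^sub>R Q"
    by (intro add_mono scaleR_left_mono QEQ) auto
  finally show "P * E * P \<le> 2 *\<^sub>R E + 2 *\<^sub>R (one D - P)" by (simp add: Q_def)
qed

text \<open>The complement of P E P is (1 - P) + P (1 - E) P. Splitting the last term costs 2 (1 -
  E) + 2 (1 - P), hence the constants 3 and 2.\<close>

lemma effect_sandwich:
  assumes P: "proj D P" and E: "0 \<le> E" "E \<le> one D" "supp D E"
  shows "0 \<le> P * E * P" "P * E * P \<le> one D" "supp D (P * E * P)"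
    and "one D - P * E * P \<le> 3 *\<^sub>R (one D - P) + 2 *\<^sub>R (one D - E)"
proof -
  show "0 \<le> P * E * P" using sandwich_nonneg[OF E(1), of P] P by (simp add: proj_def)
  show "P * E * P \<le> one D" using proj_sandwich_le[OF P, of E 1] E by simp
  show "supp D (P * E * P)" using P E by (auto simp: proj_def)
  have "one D - P * E * P = (one D - P) + P * (one D - E) * P"
    using P E by (simp add: proj_def left_diff_distrib right_diff_distrib)
  also have "\<dots> \<le> (one D - P) + (2 *\<^sub>R (one D - E) + 2 *\<^sub>R (one D - P))"
    by (intro add_mono order_refl effect_split P) (use E in auto)
  also have "\<dots> = 3 *\<^sub>R (one D - P) + 2 *\<^sub>R (one D - E)"
    by (rule fop_eqI) (simp add: algebra_simps)
  finally show "one D - P * E * P \<le> 3 *\<^sub>R (one D - P) + 2 *\<^sub>R (one D - E)" .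
qed

text \<open>The one-shot setting, in which whole words will be the letters. \<open>1 / a\<close> is
  the eigenvalue threshold of \<open>P12\<close>, and \<open>b0\<close>, \<open>b1\<close>,
  \<open>b2\<close> are those of \<open>P0\<close>, \<open>P1\<close>, \<open>P2\<close>. The second
  clause on \<open>P1\<close> allows this projection to be discarded after averaging over y, when
  the bound through \<open>P0\<close> is wanted.\<close>

locale mac_tests = X: distr X p + Y: distr Y q
  for X :: "'a set" and p and Y :: "'b set" and q +
  fixes D :: nat and \<rho> :: "'a \<Rightarrow> 'b \<Rightarrow> fop"
    and P0 and P1 :: "'a \<Rightarrow> fop" and P2 :: "'b \<Rightarrow> fop" and P12 :: "'a \<Rightarrow> 'b \<Rightarrow> fop"
    and a b0 b1 b2 :: real
  assumes state: "x \<in> X \<Longrightarrow> y \<in> Y \<Longrightarrow> 0 \<le> \<rho> x y \<and> supp D (\<rho> x y) \<and> tr (\<rho> x y) = 1"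
    and projs: "proj D P0" "x \<in> X \<Longrightarrow> proj D (P1 x)" "y \<in> Y \<Longrightarrow> proj D (P2 y)"
      "x \<in> X \<Longrightarrow> y \<in> Y \<Longrightarrow> proj D (P12 x y)"
    and nonneg_bounds: "0 \<le> a" "0 \<le> b0" "0 \<le> b1" "0 \<le> b2"
    and P12: "x \<in> X \<Longrightarrow> y \<in> Y \<Longrightarrow> P12 x y \<le> a *\<^sub>R \<rho> x y"
    and P1: "x \<in> X \<Longrightarrow> P1 x * (\<Sum>y\<in>Y. q y *\<^sub>R \<rho> x y) * P1 x \<le> b1 *\<^sub>R one D"
      "x \<in> X \<Longrightarrow> P1 x * (\<Sum>y\<in>Y. q y *\<^sub>R \<rho> x y) * P1 x \<le> (\<Sum>y\<in>Y. q y *\<^sub>R \<rho> x y)"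
    and P2: "y \<in> Y \<Longrightarrow> P2 y * (\<Sum>x\<in>X. p x *\<^sub>R \<rho> x y) * P2 y \<le> b2 *\<^sub>R one D"
    and P0: "P0 * (\<Sum>x\<in>X. p x *\<^sub>R (\<Sum>y\<in>Y. q y *\<^sub>R \<rho> x y)) * P0 \<le> b0 *\<^sub>R one D"
begin

text \<open>The nesting order matters: with \<open>P1\<close> inside, it can be discarded before
  averaging over x, and the fully averaged output then stands directly between the two copies of
  \<open>P0\<close>.\<close>

definition test :: "'a \<Rightarrow> 'b \<Rightarrow> fop" where
  "test x y = P0 * (P1 x * P12 x y * P1 x) * P0"

definition smooth :: "'a \<Rightarrow> 'b \<Rightarrow> fop" where
  "smooth x y = P2 y * \<rho> x y * P2 y"

definition miss :: "'a \<Rightarrow> 'b \<Rightarrow> real" where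
  "miss x y = tr ((one D - P0) * \<rho> x y) + tr ((one D - P1 x) * \<rho> x y)
     + tr ((one D - P2 y) * \<rho> x y) + tr ((one D - P12 x y) * \<rho> x y)"

text \<open>The outer sandwich charges 3 for \<open>P0\<close> and doubles the cost of the inner
  one, which is 3 for \<open>P1\<close> and 2 for \<open>P12\<close>.\<close>

lemma test:
  assumes "x \<in> X" "y \<in> Y"
  shows "0 \<le> test x y" "test x y \<le> one D" "supp D (test x y)"
    and "one D - test x y \<le> 3 *\<^sub>R (one D - P0) + 6 *\<^sub>R (one D - P1 x) + 4 *\<^sub>R (one D - P12 x y)"
proof -
  have pr: "proj D P0" "proj D (P1 x)" "proj D (P12 x y)" using projs assms by auto
  have s: "supp D (P12 x y)" using pr by (simp add: proj_def)
  note e1 = effect_sandwich[OF pr(2) proj_nonneg[OF pr(3)] proj_le_one[OF pr(3)] s]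
  note e0 = effect_sandwich[OF pr(1) e1(1-3)]
  show "0 \<le> test x y" "test x y \<le> one D" "supp D (test x y)" unfolding test_def by (fact e0)+
  have "one D - test x y \<le> 3 *\<^sub>R (one D - P0) + 2 *\<^sub>R (one D - P1 x * P12 x y * P1 x)"
    unfolding test_def by (fact e0)
  also have "\<dots> \<le> 3 *\<^sub>R (one D - P0) + 2 *\<^sub>R (3 *\<^sub>R (one D - P1 x) + 2 *\<^sub>R (one D - P12 x y))"
    by (intro add_mono scaleR_left_mono e1(4)) auto
  also have "\<dots> = 3 *\<^sub>R (one D - P0) + 6 *\<^sub>R (one D - P1 x) + 4 *\<^sub>R (one D - P12 x y)"
    by (simp add: scaleR_add_right)
  finally show "one D - test x y \<le> 3 *\<^sub>R (one D - P0) + 6 *\<^sub>R (one D - P1 x) + 4 *\<^sub>R (one D - P12 x y)" .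
qed

lemma smooth:
  assumes "x \<in> X" "y \<in> Y"
  shows "0 \<le> smooth x y" "supp D (smooth x y)" "tr (smooth x y) \<le> 1"
    and "tr (A * smooth x y) = tr (P2 y * A * P2 y * \<rho> x y)"
proof -
  have P: "supp D (P2 y)" "adj (P2 y) = P2 y" "P2 y * P2 y = P2 y" "proj D (P2 y)"
    using projs(3)[OF assms(2)] by (auto simp: proj_def)
  note r = state[OF assms]
  show "0 \<le> smooth x y" using sandwich_nonneg[of "\<rho> x y" "P2 y"] P r by (simp add: smooth_def)
  show "supp D (smooth x y)" using P r by (simp add: smooth_def)
  show tA: "tr (A * smooth x y) = tr (P2 y * A * P2 y * \<rho> x y)" for A
    using tr_commute[of "A * P2 y * \<rho> x y" "P2 y"] by (simp add: smooth_def mult.assoc)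
  have "tr (smooth x y) = tr (one D * smooth x y)" using \<open>supp D (smooth x y)\<close> by simp
  also have "\<dots> = tr (P2 y * \<rho> x y)" unfolding tA using P by simp
  also have "\<dots> \<le> tr (one D * \<rho> x y)" using r P by (intro tr_mult_mono proj_le_one) auto
  also have "\<dots> = 1" using r by simp
  finally show "tr (smooth x y) \<le> 1" .
qed

text \<open>The operator Cauchy--Schwarz inequality \<open>effect_split\<close> replaces the trace-norm form
  of the gentle measurement lemma when \<open>\<rho>\<close> is exchanged for its smoothed version.\<close>
lemma decoding_error:
  assumes x: "x \<in> X" and y: "y \<in> Y"
    and \<Lambda>: "0 \<le> \<Lambda>" "\<Lambda> \<le> one D" "supp D \<Lambda>"
    and le: "one D - \<Lambda> \<le> 2 *\<^sub>R (one D - test x y) + 4 *\<^sub>R S + \<eta> *\<^sub>R one D"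
    and "0 \<le> \<eta>"
  shows "tr ((one D - \<Lambda>) * \<rho> x y) \<le> 48 * miss x y + 8 * tr (S * smooth x y) + 2 * \<eta>"
proof -
  define E where "E = one D - \<Lambda>"
  have E: "0 \<le> E" "E \<le> one D" "supp D E" using \<Lambda> by (auto simp: E_def)
  have P: "proj D (P2 y)" using projs y by auto
  note r = state[OF x y]
  define t0 t1 t2 t12 where "t0 = tr ((one D - P0) * \<rho> x y)" and "t1 = tr ((one D - P1 x) * \<rho> x y)"
    and "t2 = tr ((one D - P2 y) * \<rho> x y)" and "t12 = tr ((one D - P12 x y) * \<rho> x y)"
  have t: "0 \<le> t0" "0 \<le> t1" "0 \<le> t2" "0 \<le> t12"
    unfolding t0_def t1_def t2_def t12_def using r projs x y
    by (auto intro!: tr_mult_nonneg proj_nonneg[OF proj_compl])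
  have "tr (E * \<rho> x y) \<le> tr ((2 *\<^sub>R (P2 y * E * P2 y) + 2 *\<^sub>R (one D - P2 y)) * \<rho> x y)"
    by (intro tr_mult_mono effect_split P E) (use r in auto)
  also have "\<dots> = 2 * tr (E * smooth x y) + 2 * t2"
    unfolding smooth(4)[OF x y] t2_def by (simp add: distrib_right)
  finally have 1: "tr (E * \<rho> x y) \<le> 2 * tr (E * smooth x y) + 2 * t2" .
  have "tr (E * smooth x y) \<le> tr ((2 *\<^sub>R (one D - test x y) + 4 *\<^sub>R S + \<eta> *\<^sub>R one D) * smooth x y)"
    by (intro tr_mult_mono smooth x y) (use le E_def in auto)
  also have "\<dots> = 2 * tr ((one D - test x y) * smooth x y) + 4 * tr (S * smooth x y) + \<eta> * tr (one D * smooth x y)"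
    by (simp add: distrib_right)
  also have "\<eta> * tr (one D * smooth x y) \<le> \<eta> * 1"
    using smooth(2,3)[OF x y] \<open>0 \<le> \<eta>\<close> by (intro mult_left_mono) auto
  finally have 2: "tr (E * smooth x y) \<le> 2 * tr ((one D - test x y) * smooth x y) + 4 * tr (S * smooth x y) + \<eta>"
    by simp
  have "tr ((one D - test x y) * smooth x y) = tr (P2 y * (one D - test x y) * P2 y * \<rho> x y)"
    by (rule smooth(4)[OF x y])
  also have "\<dots> \<le> tr ((2 *\<^sub>R (one D - test x y) + 2 *\<^sub>R (one D - P2 y)) * \<rho> x y)"
    by (intro tr_mult_mono effect_split P) (use r test[OF x y] in auto)
  also have "\<dots> = 2 * tr ((one D - test x y) * \<rho> x y) + 2 * t2"
    by (simp add: distrib_right t2_def)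
  finally have 3: "tr ((one D - test x y) * smooth x y) \<le> 2 * tr ((one D - test x y) * \<rho> x y) + 2 * t2" .
  have "tr ((one D - test x y) * \<rho> x y)
    \<le> tr ((3 *\<^sub>R (one D - P0) + 6 *\<^sub>R (one D - P1 x) + 4 *\<^sub>R (one D - P12 x y)) * \<rho> x y)"
    by (intro tr_mult_mono test x y) (use r in auto)
  also have "\<dots> = 3 * t0 + 6 * t1 + 4 * t12"
    by (simp add: distrib_right t0_def t1_def t12_def)
  finally have 4: "tr ((one D - test x y) * \<rho> x y) \<le> 3 * t0 + 6 * t1 + 4 * t12" .
  have m: "miss x y = t0 + t1 + t2 + t12"
    by (simp add: miss_def t0_def t1_def t2_def t12_def)
  \<comment> \<open>The chain yields \<open>24 * t0 + 48 * t1 + 10 * t2 + 32 * t12\<close>; the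
    largest coefficient is then used for all four.\<close>
  have "tr (E * \<rho> x y) \<le> 2 * (2 * (2 * (3 * t0 + 6 * t1 + 4 * t12) + 2 * t2) + 4 * tr (S * smooth x y) + \<eta>) + 2 * t2"
    using 1 order_trans[OF 2 add_right_mono[OF add_right_mono[OF mult_left_mono[OF order_trans[OF 3 add_right_mono[OF mult_left_mono[OF 4]]]]]]]
    by simp
  then show ?thesis unfolding E_def[symmetric] m using t by simp
qed

section \<open>Averages of wrong tests\<close>

lemma test_le_state:
  assumes x: "x \<in> X" and y: "y \<in> Y"
  shows "test x y \<le> a *\<^sub>R (P0 * (P1 x * \<rho> x y * P1 x) * P0)"
proof -
  have "test x y \<le> P0 * (P1 x * (a *\<^sub>R \<rho> x y) * P1 x) * P0"
    unfolding test_def using projs x y by (intro sandwich_herm_mono P12) (auto simp: proj_def)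
  then show ?thesis by simp
qed

text \<open>Averaging over y turns the output inside the test into the one averaged for x. The first
  bound applies the threshold of \<open>P1\<close> to it, for a wrong second message; the second
  discards \<open>P1\<close> and keeps the output, for a wrong pair.\<close>

lemma average_test:
  assumes x: "x \<in> X"
  shows "(\<Sum>y\<in>Y. q y *\<^sub>R test x y) \<le> (a * b1) *\<^sub>R one D"
    and "(\<Sum>y\<in>Y. q y *\<^sub>R test x y) \<le> a *\<^sub>R (P0 * (\<Sum>y\<in>Y. q y *\<^sub>R \<rho> x y) * P0)"
proof -
  let ?r = "\<Sum>y\<in>Y. q y *\<^sub>R \<rho> x y"
  have "(\<Sum>y\<in>Y. q y *\<^sub>R test x y) \<le> (\<Sum>y\<in>Y. q y *\<^sub>R a *\<^sub>R (P0 * (P1 x * \<rho> x y * P1 x) * P0))"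
    by (intro sum_mono scaleR_left_mono test_le_state x Y.nonneg)
  also have "\<dots> = a *\<^sub>R (P0 * (P1 x * ?r * P1 x) * P0)"
    by (simp add: sum_distrib_left sum_distrib_right scaleR_sum_right mult.commute)
  finally have le: "(\<Sum>y\<in>Y. q y *\<^sub>R test x y) \<le> a *\<^sub>R (P0 * (P1 x * ?r * P1 x) * P0)" .
  also have "\<dots> \<le> a *\<^sub>R (b1 *\<^sub>R one D)"
    by (intro scaleR_left_mono proj_sandwich_le projs P1 x nonneg_bounds)
  finally show "(\<Sum>y\<in>Y. q y *\<^sub>R test x y) \<le> (a * b1) *\<^sub>R one D" by simp
  note le
  also have "a *\<^sub>R (P0 * (P1 x * ?r * P1 x) * P0) \<le> a *\<^sub>R (P0 * ?r * P0)"
    using projs by (intro scaleR_left_mono sandwich_herm_mono P1 x nonneg_bounds) (auto simp: proj_def)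
  finally show "(\<Sum>y\<in>Y. q y *\<^sub>R test x y) \<le> a *\<^sub>R (P0 * ?r * P0)" .
qed

lemma average_test2:
  "(\<Sum>x\<in>X. p x *\<^sub>R (\<Sum>y\<in>Y. q y *\<^sub>R test x y)) \<le> (a * b0) *\<^sub>R one D"
proof -
  have "(\<Sum>x\<in>X. p x *\<^sub>R (\<Sum>y\<in>Y. q y *\<^sub>R test x y))
    \<le> (\<Sum>x\<in>X. p x *\<^sub>R a *\<^sub>R (P0 * (\<Sum>y\<in>Y. q y *\<^sub>R \<rho> x y) * P0))"
    by (intro sum_mono scaleR_left_mono average_test X.nonneg)
  also have "\<dots> = a *\<^sub>R (P0 * (\<Sum>x\<in>X. p x *\<^sub>R (\<Sum>y\<in>Y. q y *\<^sub>R \<rho> x y)) * P0)"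
    by (simp add: sum_distrib_left sum_distrib_right scaleR_sum_right mult_ac)
  also have "\<dots> \<le> a *\<^sub>R (b0 *\<^sub>R one D)"
    by (intro scaleR_left_mono P0 nonneg_bounds)
  finally show ?thesis by simp
qed

text \<open>Sandwiching by a projection does not increase the trace, and \<open>P12 x y\<close> lies
  below \<open>a\<close> times an operator of trace 1. A wrong first message needs this trace bound,
  since there the norm bound falls on the output.\<close>

lemma tr_test_le:
  assumes x: "x \<in> X" and y: "y \<in> Y"
  shows "tr (test x y) \<le> a"
proof -
  have pr: "proj D P0" "proj D (P1 x)" "proj D (P12 x y)" using projs assms by auto
  have sandwich: "tr (P * A * P) \<le> tr A" if "proj D P" "0 \<le> A" "supp D A" for P A
  proof -
    have "tr (P * A * P) = tr (P * A)"
      using that tr_commute[of "P * A" P] by (simp add: proj_def mult.assoc[symmetric])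
    also have "\<dots> \<le> tr (one D * A)" using that by (intro tr_mult_mono proj_le_one)
    finally show ?thesis using that by simp
  qed
  have s: "supp D (P12 x y)" using pr by (simp add: proj_def)
  note e1 = effect_sandwich[OF pr(2) proj_nonneg[OF pr(3)] proj_le_one[OF pr(3)] s]
  have "tr (test x y) \<le> tr (P1 x * P12 x y * P1 x)"
    unfolding test_def by (rule sandwich[OF pr(1) e1(1,3)])
  also have "\<dots> \<le> tr (P12 x y)" by (rule sandwich[OF pr(2) proj_nonneg[OF pr(3)] s])
  also have "\<dots> \<le> tr (a *\<^sub>R \<rho> x y)" by (intro tr_mono P12 x y)
  finally show ?thesis using state[OF x y] by simp
qed

lemma tr_le_smooth:
  assumes "A \<le> r *\<^sub>R one D" "0 \<le> r" "x \<in> X" "y \<in> Y"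
  shows "tr (A * smooth x y) \<le> r"
proof -
  have "tr (A * smooth x y) \<le> tr ((r *\<^sub>R one D) * smooth x y)"
    by (intro tr_mult_mono assms smooth)
  also have "\<dots> \<le> r * 1"
    using assms smooth[OF assms(3,4)] by (simp add: mult_left_le)
  finally show ?thesis by simp
qed

text \<open>In the first bound the true input x is averaged, the test \<open>x' y\<close> being
  independent of it; the compression by \<open>P2 y\<close> then bounds the averaged output by
  \<open>b2\<close>. In the other two the smoothed output is fixed and the competing test is
  averaged.\<close>

lemma confusion:
  shows "x' \<in> X \<Longrightarrow> y \<in> Y \<Longrightarrow> (\<Sum>x\<in>X. p x * tr (test x' y * smooth x y)) \<le> a * b2"
    and "x \<in> X \<Longrightarrow> y \<in> Y \<Longrightarrow> (\<Sum>y'\<in>Y. q y' * tr (test x y' * smooth x y)) \<le> a * b1"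
    and "x \<in> X \<Longrightarrow> y \<in> Y \<Longrightarrow>
      (\<Sum>x'\<in>X. p x' * (\<Sum>y'\<in>Y. q y' * tr (test x' y' * smooth x y))) \<le> a * b0"
proof -
  assume x: "x' \<in> X" and y: "y \<in> Y"
  have "(\<Sum>x\<in>X. p x * tr (test x' y * smooth x y))
    = tr (test x' y * (P2 y * (\<Sum>x\<in>X. p x *\<^sub>R \<rho> x y) * P2 y))"
    by (simp add: smooth_def sum_distrib_left sum_distrib_right)
  also have "\<dots> \<le> tr (test x' y * (b2 *\<^sub>R one D))"
    by (intro tr_mult_mono' P2 test x y)
  also have "\<dots> = b2 * tr (test x' y)" using test[OF x y] by simp
  also have "\<dots> \<le> b2 * a" by (intro mult_left_mono tr_test_le x y nonneg_bounds)
  finally show "(\<Sum>x\<in>X. p x * tr (test x' y * smooth x y)) \<le> a * b2" by (simp add: mult.commute)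
next
  assume x: "x \<in> X" and y: "y \<in> Y"
  have "(\<Sum>y'\<in>Y. q y' * tr (test x y' * smooth x y)) = tr ((\<Sum>y'\<in>Y. q y' *\<^sub>R test x y') * smooth x y)"
    by (simp add: sum_distrib_right)
  also have "\<dots> \<le> a * b1"
    by (intro tr_le_smooth average_test x y mult_nonneg_nonneg nonneg_bounds)
  finally show "(\<Sum>y'\<in>Y. q y' * tr (test x y' * smooth x y)) \<le> a * b1" .
  have "(\<Sum>x'\<in>X. p x' * (\<Sum>y'\<in>Y. q y' * tr (test x' y' * smooth x y)))
    = tr ((\<Sum>x'\<in>X. p x' *\<^sub>R (\<Sum>y'\<in>Y. q y' *\<^sub>R test x' y')) * smooth x y)"
    by (simp add: sum_distrib_right sum_distrib_left)
  also have "\<dots> \<le> a * b0"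
    by (intro tr_le_smooth average_test2 x y mult_nonneg_nonneg nonneg_bounds)
  finally show "(\<Sum>x'\<in>X. p x' * (\<Sum>y'\<in>Y. q y' * tr (test x' y' * smooth x y))) \<le> a * b0" .
qed

text \<open>A competitor differs from the sent pair in the first message, in the second, or in both.
  Words of different messages are independent, so each kind reduces to one of the averages in
  \<open>confusion\<close>.\<close>

lemma expected_competitors:
  fixes M1 M2 :: nat
  assumes m: "m1 < M1" "m2 < M2"
  shows "pexp {..<M1} X p (\<lambda>c. pexp {..<M2} Y q (\<lambda>d.
      \<Sum>(k1,k2)\<in>{..<M1} \<times> {..<M2} - {(m1,m2)}. tr (test (c k1) (d k2) * smooth (c m1) (d m2))))
    \<le> real (M1 - 1) * (a * b2) + real (M2 - 1) * (a * b1) + real (M1 - 1) * real (M2 - 1) * (a * b0)"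
proof -
  define G where "G k1 k2 = pexp {..<M1} X p (\<lambda>c. pexp {..<M2} Y q (\<lambda>d.
      tr (test (c k1) (d k2) * smooth (c m1) (d m2))))" for k1 k2
  have G2: "G k1 m2 \<le> a * b2" if "k1 < M1" "k1 \<noteq> m1" for k1
  proof -
    have "G k1 m2 = pexp {..<M1} X p (\<lambda>c. \<Sum>y\<in>Y. q y * tr (test (c k1) y * smooth (c m1) y))"
    proof -
      have "pexp {..<M2} Y q (\<lambda>d. tr (test (c k1) (d m2) * smooth (c m1) (d m2)))
        = (\<Sum>y\<in>Y. q y * tr (test (c k1) y * smooth (c m1) y))" for c
        using m Y.pexp_single[of "{..<M2}" m2 "\<lambda>y. tr (test (c k1) y * smooth (c m1) y)"] by simp
      then show ?thesis by (simp only: G_def)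
    qed
    also have "\<dots> = (\<Sum>x'\<in>X. p x' * (\<Sum>x\<in>X. p x * (\<Sum>y\<in>Y. q y * tr (test x' y * smooth x y))))"
      using m that by (intro X.pexp_pair) auto
    \<comment> \<open>The average over the sent x moves innermost, since for a wrong first message
      it acts on the output with y fixed.\<close>
    also have "\<dots> = (\<Sum>x'\<in>X. p x' * (\<Sum>y\<in>Y. q y * (\<Sum>x\<in>X. p x * tr (test x' y * smooth x y))))"
      unfolding sum_distrib_left by (intro sum.cong refl) (subst sum.swap, simp add: mult.left_commute)
    also have "\<dots> \<le> a * b2"
      by (rule X.weighted_le, rule Y.weighted_le, rule confusion(1))
    finally show ?thesis .
  qed
  have G1: "G m1 k2 \<le> a * b1" if "k2 < M2" "k2 \<noteq> m2" for k2
  proof -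
    have "G m1 k2 = pexp {..<M1} X p (\<lambda>c. \<Sum>y\<in>Y. q y * (\<Sum>y'\<in>Y. q y' * tr (test (c m1) y' * smooth (c m1) y)))"
    proof -
      have "pexp {..<M2} Y q (\<lambda>d. tr (test (c m1) (d k2) * smooth (c m1) (d m2)))
        = (\<Sum>y\<in>Y. q y * (\<Sum>y'\<in>Y. q y' * tr (test (c m1) y' * smooth (c m1) y)))" for c
        using m that by (intro Y.pexp_pair[of "{..<M2}" m2 k2 "\<lambda>y y'. tr (test (c m1) y' * smooth (c m1) y)"]) auto
      then show ?thesis by (simp only: G_def)
    qed
    also have "\<dots> \<le> pexp {..<M1} X p (\<lambda>c. a * b1)"
      by (rule X.pexp_mono, rule Y.weighted_le, rule confusion(2)) (use m in auto)
    finally show ?thesis by (simp add: X.pexp_const)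
  qed
  have G0: "G k1 k2 \<le> a * b0" if "k1 < M1" "k1 \<noteq> m1" "k2 < M2" "k2 \<noteq> m2" for k1 k2
  proof -
    have "G k1 k2 = pexp {..<M1} X p (\<lambda>c. \<Sum>y\<in>Y. q y * (\<Sum>y'\<in>Y. q y' * tr (test (c k1) y' * smooth (c m1) y)))"
    proof -
      have "pexp {..<M2} Y q (\<lambda>d. tr (test (c k1) (d k2) * smooth (c m1) (d m2)))
        = (\<Sum>y\<in>Y. q y * (\<Sum>y'\<in>Y. q y' * tr (test (c k1) y' * smooth (c m1) y)))" for c
        using m that by (intro Y.pexp_pair[of "{..<M2}" m2 k2 "\<lambda>y y'. tr (test (c k1) y' * smooth (c m1) y)"]) auto
      then show ?thesis by (simp only: G_def)
    qed
    also have "\<dots> = (\<Sum>x\<in>X. p x * (\<Sum>x'\<in>X. p x' * (\<Sum>y\<in>Y. q y * (\<Sum>y'\<in>Y. q y' * tr (test x' y' * smooth x y)))))"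
      using m that by (subst X.pexp_pair[of _ m1 k1 "\<lambda>x x'. \<Sum>y\<in>Y. q y * (\<Sum>y'\<in>Y. q y' * tr (test x' y' * smooth x y))", symmetric]) auto
    also have "\<dots> = (\<Sum>x\<in>X. p x * (\<Sum>y\<in>Y. q y * (\<Sum>x'\<in>X. p x' * (\<Sum>y'\<in>Y. q y' * tr (test x' y' * smooth x y)))))"
      unfolding sum_distrib_left[of _ _ X] sum_distrib_left[of _ _ Y]
      by (intro sum.cong refl) (subst sum.swap, simp add: mult.left_commute sum_distrib_left)
    also have "\<dots> \<le> a * b0"
      by (rule X.weighted_le, rule Y.weighted_le, rule confusion(3))
    finally show ?thesis .
  qed
  have dec: "{..<M1} \<times> {..<M2} - {(m1,m2)}
    = (({..<M1} - {m1}) \<times> {m2} \<union> {m1} \<times> ({..<M2} - {m2})) \<union> ({..<M1} - {m1}) \<times> ({..<M2} - {m2})"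
    using m by auto
  have "pexp {..<M1} X p (\<lambda>c. pexp {..<M2} Y q (\<lambda>d.
      \<Sum>(k1,k2)\<in>{..<M1} \<times> {..<M2} - {(m1,m2)}. tr (test (c k1) (d k2) * smooth (c m1) (d m2))))
    = (\<Sum>(k1,k2)\<in>{..<M1} \<times> {..<M2} - {(m1,m2)}. G k1 k2)"
    by (simp add: pexp_sum G_def case_prod_beta)
  also have "\<dots> = (\<Sum>k1\<in>{..<M1} - {m1}. G k1 m2) + (\<Sum>k2\<in>{..<M2} - {m2}. G m1 k2)
      + (\<Sum>k1\<in>{..<M1} - {m1}. \<Sum>k2\<in>{..<M2} - {m2}. G k1 k2)"
    unfolding dec by (subst sum.union_disjoint, auto)+ (simp add: sum.cartesian_product[symmetric])
  also have "\<dots> \<le> (\<Sum>k1\<in>{..<M1} - {m1}. a * b2) + (\<Sum>k2\<in>{..<M2} - {m2}. a * b1)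
      + (\<Sum>k1\<in>{..<M1} - {m1}. \<Sum>k2\<in>{..<M2} - {m2}. a * b0)"
    by (intro add_mono sum_mono G0 G1 G2) auto
  also have "\<dots> = real (M1 - 1) * (a * b2) + real (M2 - 1) * (a * b1) + real (M1 - 1) * real (M2 - 1) * (a * b0)"
    using m by simp
  finally show ?thesis .
qed

text \<open>A square-root measurement is taken separately for each pair of codebooks. The bound on
  the expected error is the same for all message pairs and therefore survives the average over
  messages.\<close>

lemma random_coding:
  fixes M1 M2 :: nat
  assumes M: "0 < M1" "0 < M2" and \<eta>: "0 < \<eta>"
  obtains \<Lambda> :: "(nat \<Rightarrow> 'a) \<Rightarrow> (nat \<Rightarrow> 'b) \<Rightarrow> nat \<Rightarrow> nat \<Rightarrow> fop"
  where "\<And>c d m1 m2. c \<in> {..<M1} \<rightarrow>\<^sub>E X \<Longrightarrow> d \<in> {..<M2} \<rightarrow>\<^sub>E Y \<Longrightarrow> m1 < M1 \<Longrightarrow> m2 < M2 \<Longrightarrow>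
      0 \<le> \<Lambda> c d m1 m2 \<and> supp D (\<Lambda> c d m1 m2)"
    "\<And>c d. c \<in> {..<M1} \<rightarrow>\<^sub>E X \<Longrightarrow> d \<in> {..<M2} \<rightarrow>\<^sub>E Y \<Longrightarrow>
      (\<Sum>(m1,m2)\<in>{..<M1} \<times> {..<M2}. \<Lambda> c d m1 m2) = one D"
    "pexp {..<M1} X p (\<lambda>c. pexp {..<M2} Y q (\<lambda>d. 1 / (real M1 * real M2) *
        (\<Sum>m1<M1. \<Sum>m2<M2. tr ((one D - \<Lambda> c d m1 m2) * \<rho> (c m1) (d m2)))))
      \<le> 48 * (\<Sum>x\<in>X. p x * (\<Sum>y\<in>Y. q y * miss x y))
        + 8 * (real (M1 - 1) * (a * b2) + real (M2 - 1) * (a * b1) + real (M1 - 1) * real (M2 - 1) * (a * b0))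
        + 2 * \<eta>"
proof -
  let ?S = "{..<M1} \<times> {..<M2}"
  let ?C = "{..<M1} \<rightarrow>\<^sub>E X" and ?D = "{..<M2} \<rightarrow>\<^sub>E Y"
  \<comment> \<open>The guards make the requirement vacuous outside the codebooks, so that the
    measurements can be collected by a total choice function.\<close>
  have "\<forall>c d. \<exists>L. c \<in> ?C \<longrightarrow> d \<in> ?D \<longrightarrow> (\<forall>i\<in>?S. 0 \<le> L i \<and> supp D (L i)) \<and> (\<Sum>i\<in>?S. L i) = one D \<and>
    (\<forall>i\<in>?S. one D - L i \<le> 2 *\<^sub>R (one D - test (c (fst i)) (d (snd i)))
      + 4 *\<^sub>R (\<Sum>j\<in>?S - {i}. test (c (fst j)) (d (snd j))) + \<eta> *\<^sub>R one D)"
    (is "\<forall>c d. \<exists>L. ?P c d L")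
  proof (intro allI)
    fix c d
    show "\<exists>L. ?P c d L"
    proof (cases "c \<in> ?C \<and> d \<in> ?D")
      case True
      have S: "finite ?S" "?S \<noteq> {}" using M by auto
      have T: "0 \<le> test (c (fst i)) (d (snd i)) \<and> test (c (fst i)) (d (snd i)) \<le> one D
          \<and> supp D (test (c (fst i)) (d (snd i)))" if "i \<in> ?S" for i
        using test[of "c (fst i)" "d (snd i)"] True that by (auto simp: PiE_iff)
      show ?thesis
      proof (rule square_root_measurement[OF S T \<eta>])
        fix L assume L: "\<And>i. i \<in> ?S \<Longrightarrow> 0 \<le> L i \<and> supp D (L i)" "sum L ?S = one D"
          "\<And>i. i \<in> ?S \<Longrightarrow> one D - L i \<le> 2 *\<^sub>R (one D - test (c (fst i)) (d (snd i)))
          + 4 *\<^sub>R (\<Sum>j\<in>?S - {i}. test (c (fst j)) (d (snd j))) + \<eta> *\<^sub>R one D"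
        show "\<exists>L. ?P c d L"
          by (intro exI[of _ L] impI conjI ballI L(1)[THEN conjunct1] L(1)[THEN conjunct2] L(2,3))
      qed
    qed auto
  qed
  then have "\<exists>L. \<forall>c d. ?P c d (L c d)" by (simp only: choice_iff)
  then obtain L where L: "\<forall>c d. ?P c d (L c d)" ..
  define R where "R = real (M1 - 1) * (a * b2) + real (M2 - 1) * (a * b1) + real (M1 - 1) * real (M2 - 1) * (a * b0)"
  define \<mu> where "\<mu> = (\<Sum>x\<in>X. p x * (\<Sum>y\<in>Y. q y * miss x y))"
  define err where "err c d m1 m2 = tr ((one D - L c d (m1,m2)) * \<rho> (c m1) (d m2))" for c d m1 m2
  define cmp where "cmp c d m1 m2 = (\<Sum>(k1,k2)\<in>?S - {(m1,m2)}. tr (test (c k1) (d k2) * smooth (c m1) (d m2)))" for c d m1 m2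
  have err_le: "err c d m1 m2 \<le> 48 * miss (c m1) (d m2) + 8 * cmp c d m1 m2 + 2 * \<eta>"
    if c: "c \<in> ?C" and d: "d \<in> ?D" and m: "m1 < M1" "m2 < M2" for c d m1 m2
  proof -
    have i: "(m1,m2) \<in> ?S" using m by auto
    have Li: "\<And>i. i \<in> ?S \<Longrightarrow> 0 \<le> L c d i" "(\<Sum>i\<in>?S. L c d i) = one D" "supp D (L c d (m1,m2))"
      and le: "one D - L c d (m1,m2) \<le> 2 *\<^sub>R (one D - test (c m1) (d m2))
          + 4 *\<^sub>R (\<Sum>j\<in>?S - {(m1,m2)}. test (c (fst j)) (d (snd j))) + \<eta> *\<^sub>R one D"
    proof -
      note Lcd = L[rule_format, OF c d]
      show "\<And>i. i \<in> ?S \<Longrightarrow> 0 \<le> L c d i" "(\<Sum>i\<in>?S. L c d i) = one D" "supp D (L c d (m1,m2))"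
        using Lcd i by blast+
      show "one D - L c d (m1,m2) \<le> 2 *\<^sub>R (one D - test (c m1) (d m2))
          + 4 *\<^sub>R (\<Sum>j\<in>?S - {(m1,m2)}. test (c (fst j)) (d (snd j))) + \<eta> *\<^sub>R one D"
        using bspec[OF conjunct2[OF conjunct2[OF Lcd]] i] by (simp only: fst_conv snd_conv)
    qed
    have "L c d (m1,m2) \<le> one D"
    proof -
      have "0 \<le> (\<Sum>i\<in>?S - {(m1,m2)}. L c d i)" using Li(1) by (intro sum_nonneg) auto
      moreover have "one D = L c d (m1,m2) + (\<Sum>i\<in>?S - {(m1,m2)}. L c d i)"
        using Li(2) i by (simp add: sum.remove)
      ultimately show ?thesis by simp
    qed
    then have "err c d m1 m2 \<le> 48 * miss (c m1) (d m2)
        + 8 * tr ((\<Sum>j\<in>?S - {(m1,m2)}. test (c (fst j)) (d (snd j))) * smooth (c m1) (d m2)) + 2 * \<eta>"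
      unfolding err_def using c d m Li i \<eta> by (intro decoding_error le) auto
    then show ?thesis by (simp add: cmp_def sum_distrib_right case_prod_beta)
  qed
  have exp_le: "pexp {..<M1} X p (\<lambda>c. pexp {..<M2} Y q (\<lambda>d. err c d m1 m2)) \<le> 48 * \<mu> + 8 * R + 2 * \<eta>"
    if m: "m1 < M1" "m2 < M2" for m1 m2
  proof -
    have "pexp {..<M1} X p (\<lambda>c. pexp {..<M2} Y q (\<lambda>d. err c d m1 m2))
      \<le> pexp {..<M1} X p (\<lambda>c. pexp {..<M2} Y q (\<lambda>d. 48 * miss (c m1) (d m2) + 8 * cmp c d m1 m2 + 2 * \<eta>))"
      using m by (intro X.pexp_mono Y.pexp_mono err_le)
    also have "\<dots> = 48 * pexp {..<M1} X p (\<lambda>c. pexp {..<M2} Y q (\<lambda>d. miss (c m1) (d m2)))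
        + 8 * pexp {..<M1} X p (\<lambda>c. pexp {..<M2} Y q (\<lambda>d. cmp c d m1 m2)) + 2 * \<eta>"
      by (simp add: pexp_add pexp_cmult X.pexp_const Y.pexp_const)
    also have "pexp {..<M1} X p (\<lambda>c. pexp {..<M2} Y q (\<lambda>d. miss (c m1) (d m2))) = \<mu>"
    proof -
      have "pexp {..<M2} Y q (\<lambda>d. miss x (d m2)) = (\<Sum>y\<in>Y. q y * miss x y)" for x
        using m by (intro Y.pexp_single) auto
      then show ?thesis
        using m X.pexp_single[of "{..<M1}" m1 "\<lambda>x. \<Sum>y\<in>Y. q y * miss x y"] by (simp add: \<mu>_def)
    qed
    also have "pexp {..<M1} X p (\<lambda>c. pexp {..<M2} Y q (\<lambda>d. cmp c d m1 m2)) \<le> R"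
      unfolding cmp_def R_def by (rule expected_competitors[OF m])
    finally show ?thesis by simp
  qed
  show ?thesis
  proof (rule that[of "\<lambda>c d m1 m2. L c d (m1,m2)"])
    fix c d assume "c \<in> ?C" "d \<in> ?D"
    then show "(\<Sum>(m1,m2)\<in>?S. L c d (m1,m2)) = one D" using L[rule_format, of c d] by simp
    fix m1 m2 assume "m1 < M1" "m2 < M2"
    then show "0 \<le> L c d (m1,m2) \<and> supp D (L c d (m1,m2))"
      using L[rule_format, of c d] \<open>c \<in> ?C\<close> \<open>d \<in> ?D\<close> by auto
  next
    have "pexp {..<M1} X p (\<lambda>c. pexp {..<M2} Y q (\<lambda>d. 1 / (real M1 * real M2) * (\<Sum>m1<M1. \<Sum>m2<M2. err c d m1 m2)))
      = 1 / (real M1 * real M2) * (\<Sum>m1<M1. \<Sum>m2<M2. pexp {..<M1} X p (\<lambda>c. pexp {..<M2} Y q (\<lambda>d. err c d m1 m2)))"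
      by (simp only: pexp_cmult pexp_sum)
    also have "\<dots> \<le> 1 / (real M1 * real M2) * (\<Sum>m1<M1. \<Sum>m2<M2. 48 * \<mu> + 8 * R + 2 * \<eta>)"
      by (intro mult_left_mono sum_mono exp_le) auto
    also have "\<dots> = 48 * \<mu> + 8 * R + 2 * \<eta>" using M by simp
    finally show "pexp {..<M1} X p (\<lambda>c. pexp {..<M2} Y q (\<lambda>d. 1 / (real M1 * real M2) *
        (\<Sum>m1<M1. \<Sum>m2<M2. tr ((one D - L c d (m1,m2)) * \<rho> (c m1) (d m2)))))
      \<le> 48 * (\<Sum>x\<in>X. p x * (\<Sum>y\<in>Y. q y * miss x y))
        + 8 * (real (M1 - 1) * (a * b2) + real (M2 - 1) * (a * b1) + real (M1 - 1) * real (M2 - 1) * (a * b0))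
        + 2 * \<eta>"
      unfolding err_def \<mu>_def R_def .
  qed
qed

end

section \<open>Tensor powers\<close>

text \<open>Splits an index of a tensor product into the indices of its two factors. Matrix
  products, spectra, block operators and partial traces all reduce to it.\<close>

lemma sum_div_mod:
  fixes f :: "nat \<Rightarrow> nat \<Rightarrow> 'a::comm_monoid_add"
  assumes "0 < b"
  shows "(\<Sum>k<m * b. f (k div b) (k mod b)) = (\<Sum>i<m. \<Sum>j<b. f i j)"
proof (induction m)
  case (Suc m)
  let ?g = "\<lambda>k. f (k div b) (k mod b)"
  have "sum ?g {..<Suc m * b} = sum ?g {..<m * b} + sum ?g {0 + m * b..<b + m * b}"
    using sum.atLeastLessThan_concat[of 0 "m * b" "b + m * b" ?g] by (simp add: lessThan_atLeast0)
  also have "sum ?g {0 + m * b..<b + m * b} = (\<Sum>j<b. f m j)"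
    unfolding sum.shift_bounds_nat_ivl lessThan_atLeast0 using assms by (intro sum.cong) auto
  finally show ?case using Suc.IH by simp
qed simp

text \<open>The Kronecker product. Operators carry no dimension of their own, so that of the second
  factor is a parameter.\<close>

definition krf :: "nat \<Rightarrow> fop \<Rightarrow> fop \<Rightarrow> fop" where
  "krf b A B = Op (\<lambda>i j. ent A (i div b) (j div b) * ent B (i mod b) (j mod b))"

lemma div_ge_of_le_mult: "0 < b \<Longrightarrow> m * b \<le> i \<Longrightarrow> m \<le> i div (b :: nat)"
  by (simp add: less_eq_div_iff_mult_less_eq)

lemma ent_krf: "0 < b \<Longrightarrow> ent (krf b A B) i j = ent A (i div b) (j div b) * ent B (i mod b) (j mod b)"
proof -
  assume b: "0 < b"
  obtain m where m: "supp m A" using ex_supp by metis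
  show ?thesis unfolding krf_def
    using m b by (subst ent_Op[of "m * b"]) (auto simp: supp_def dest: div_ge_of_le_mult)
qed

lemma supp_krf: "0 < b \<Longrightarrow> supp m A \<Longrightarrow> supp (m * b) (krf b A B)"
  unfolding supp_def[of "m * b"] by (auto simp: ent_krf supp_def dest: div_ge_of_le_mult)

lemma krf_times:
  assumes b: "0 < b" and B: "supp b B"
  shows "krf b A B * krf b C E = krf b (A * C) (B * E)"
proof (rule fop_eqI)
  fix i j
  obtain m where m: "supp m A" using ex_supp by metis
  have "ent (krf b A B * krf b C E) i j =
    (\<Sum>k<m * b. (ent A (i div b) (k div b) * ent B (i mod b) (k mod b)) *
      (ent C (k div b) (j div b) * ent E (k mod b) (j mod b)))"
    using b m by (simp add: ent_times_left[OF supp_krf] ent_krf)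
  also have "\<dots> = (\<Sum>k<m. \<Sum>l<b. (ent A (i div b) k * ent B (i mod b) l) * (ent C k (j div b) * ent E l (j mod b)))"
    by (rule sum_div_mod[OF b, of "\<lambda>k l. (ent A (i div b) k * ent B (i mod b) l) * (ent C k (j div b) * ent E l (j mod b))"])
  also have "\<dots> = ent (krf b (A * C) (B * E)) i j"
    using b by (simp add: ent_krf ent_times_left[OF m] ent_times_left[OF B] sum_product mult_ac)
  finally show "ent (krf b A B * krf b C E) i j = ent (krf b (A * C) (B * E)) i j" .
qed

lemma krf_dg: "0 < b \<Longrightarrow> krf b (dg m f) (dg b g) = dg (m * b) (\<lambda>i. f (i div b) * g (i mod b))"
proof (rule fop_eqI)
  fix i j assume b: "0 < b"
  have "i = j \<longleftrightarrow> i div b = j div b \<and> i mod b = j mod b" by (metis div_mult_mod_eq)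
  moreover have "i div b < m \<longleftrightarrow> i < m * b" using b by (simp add: div_less_iff_less_mult)
  ultimately show "ent (krf b (dg m f) (dg b g)) i j = ent (dg (m * b) (\<lambda>i. f (i div b) * g (i mod b))) i j"
    using b by (auto simp: ent_krf)
qed

lemma krf_scaleR: "0 < b \<Longrightarrow> krf b (r *\<^sub>R A) (s *\<^sub>R B) = (r * s) *\<^sub>R krf b A B"
  and krf_sum: "0 < b \<Longrightarrow> krf b (sum F S) (sum G T) = (\<Sum>x\<in>S. \<Sum>y\<in>T. krf b (F x) (G y))"
  and adj_krf: "0 < b \<Longrightarrow> adj (krf b A B) = krf b (adj A) (adj B)"
  by (auto intro!: fop_eqI simp: ent_krf sum_product)

fun ten :: "nat \<Rightarrow> (nat \<Rightarrow> fop) \<Rightarrow> nat \<Rightarrow> fop" where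
  "ten d r 0 = one 1"
| "ten d r (Suc n) = krf d (ten d r n) (r n)"

text \<open>The spectrum of a tensor product: the base-d digits of the index select one eigenvalue
  in each factor, the last factor reading the lowest digit.\<close>

fun dten :: "nat \<Rightarrow> (nat \<Rightarrow> nat \<Rightarrow> real) \<Rightarrow> nat \<Rightarrow> nat \<Rightarrow> real" where
  "dten d f 0 i = 1"
| "dten d f (Suc n) i = dten d f n (i div d) * f n (i mod d)"

context
  fixes d :: nat assumes d: "0 < d"
begin

lemma supp_ten: "supp (d ^ n) (ten d r n)"
  using d by (induction n) (simp_all add: supp_krf power_Suc2 del: power_Suc)

lemma ten_times:
  "(\<And>i. i < n \<Longrightarrow> supp d (r i)) \<Longrightarrow> ten d r n * ten d s n = ten d (\<lambda>i. r i * s i) n"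
  using d by (induction n) (auto simp: krf_times)

lemma adj_ten: "adj (ten d r n) = ten d (\<lambda>i. adj (r i)) n"
  using d by (induction n) (auto simp: adj_krf)

lemma ten_cong: "(\<And>i. i < n \<Longrightarrow> r i = s i) \<Longrightarrow> ten d r n = ten d s n"
  by (induction n) auto

lemma ten_dg: "ten d (\<lambda>i. dg d (f i)) n = dg (d ^ n) (dten d f n)"
  using d by (induction n) (auto simp: krf_dg mult.commute intro!: dg_cong)

lemma ten_one: "ten d (\<lambda>_. one d) n = one (d ^ n)"
proof -
  have "dten d (\<lambda>_ _. 1) n i = 1" for i by (induction n arbitrary: i) auto
  then show ?thesis unfolding ten_dg by (intro dg_cong)
qed

lemma dten_nonneg: "(\<And>l j. l < n \<Longrightarrow> j < d \<Longrightarrow> 0 \<le> f l j) \<Longrightarrow> 0 \<le> dten d f n i"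
  using d by (induction n arbitrary: i) auto

text \<open>A multiplicative \<open>h\<close> factors over the digits of the index. It is used with
  powers, for Chernoff moments, and with the identity, for the trace.\<close>

lemma sum_dten:
  fixes h :: "real \<Rightarrow> real"
  assumes "\<And>l j. l < n \<Longrightarrow> j < d \<Longrightarrow> 0 \<le> f l j" and h1: "h 1 = 1"
    and h: "\<And>x y. 0 \<le> x \<Longrightarrow> 0 \<le> y \<Longrightarrow> h (x * y) = h x * h y"
  shows "(\<Sum>i<d ^ n. h (dten d f n i)) = (\<Prod>l<n. \<Sum>j<d. h (f l j))"
  using assms(1)
proof (induction n)
  case (Suc n)
  have "(\<Sum>i<d ^ Suc n. h (dten d f (Suc n) i))
    = (\<Sum>i<d ^ n * d. h (dten d f n (i div d)) * h (f n (i mod d)))"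
    using Suc.prems d by (intro sum.cong) (auto simp: mult.commute intro!: h dten_nonneg)
  also have "\<dots> = (\<Sum>i<d ^ n. \<Sum>j<d. h (dten d f n i) * h (f n j))"
    by (rule sum_div_mod[OF d, of "\<lambda>i j. h (dten d f n i) * h (f n j)"])
  also have "\<dots> = (\<Sum>i<d ^ n. h (dten d f n i)) * (\<Sum>j<d. h (f n j))"
    by (simp add: sum_product)
  finally show ?case using Suc by simp
qed (simp add: h1)

text \<open>Multilinearity of the tensor product: averaging over independent letters may be done
  factor by factor. The induction peels off the last letter.\<close>

lemma ten_average:
  assumes "finite X"
  shows "(\<Sum>u\<in>{..<n} \<rightarrow>\<^sub>E X. (\<Prod>i<n. p (u i)) *\<^sub>R ten d (\<lambda>i. G i (u i)) n) = ten d (\<lambda>i. \<Sum>x\<in>X. p x *\<^sub>R G i x) n"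
proof (induction n)
  case (Suc n)
  have inj: "inj_on (\<lambda>(y, c). c(n := y)) (X \<times> ({..<n} \<rightarrow>\<^sub>E X))"
    by (rule inj_combinator) simp
  have "(\<Sum>u\<in>{..<Suc n} \<rightarrow>\<^sub>E X. (\<Prod>i<Suc n. p (u i)) *\<^sub>R ten d (\<lambda>i. G i (u i)) (Suc n))
    = (\<Sum>(y, c)\<in>X \<times> ({..<n} \<rightarrow>\<^sub>E X). (\<Prod>i<Suc n. p ((c(n := y)) i)) *\<^sub>R ten d (\<lambda>i. G i ((c(n := y)) i)) (Suc n))"
    unfolding lessThan_Suc PiE_insert_eq by (subst sum.reindex[OF inj]) (simp add: o_def case_prod_beta)
  also have "\<dots> = (\<Sum>(y, c)\<in>X \<times> ({..<n} \<rightarrow>\<^sub>E X). krf d ((\<Prod>i<n. p (c i)) *\<^sub>R ten d (\<lambda>i. G i (c i)) n) (p y *\<^sub>R G n y))"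
  proof (intro sum.cong refl, clarify)
    fix y c
    have "(\<Prod>i<n. p ((c(n := y)) i)) = (\<Prod>i<n. p (c i))" by (intro prod.cong) auto
    moreover have "ten d (\<lambda>i. G i ((c(n := y)) i)) n = ten d (\<lambda>i. G i (c i)) n" by (intro ten_cong) auto
    ultimately show "(\<Prod>i<Suc n. p ((c(n := y)) i)) *\<^sub>R ten d (\<lambda>i. G i ((c(n := y)) i)) (Suc n)
      = krf d ((\<Prod>i<n. p (c i)) *\<^sub>R ten d (\<lambda>i. G i (c i)) n) (p y *\<^sub>R G n y)"
      using d by (simp add: krf_scaleR del: fun_upd_apply) simp
  qed
  also have "\<dots> = ten d (\<lambda>i. \<Sum>x\<in>X. p x *\<^sub>R G i x) (Suc n)"
    using d by (simp add: Suc.IH[symmetric] krf_sum sum.cartesian_product[symmetric]) (rule sum.swap)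
  finally show ?case .
qed simp

section \<open>Spectral threshold projections\<close>

lemma ten_spectral:
  assumes U: "\<And>l. l < n \<Longrightarrow> supp d (U l)" "\<And>l. l < n \<Longrightarrow> adj (U l) * U l = one d"
      "\<And>l. l < n \<Longrightarrow> U l * adj (U l) = one d"
    and r: "\<And>l. l < n \<Longrightarrow> r l = U l * dg d (f l) * adj (U l)"
  shows "adj (ten d U n) * ten d U n = one (d ^ n)" "ten d U n * adj (ten d U n) = one (d ^ n)"
    "ten d r n = ten d U n * dg (d ^ n) (dten d f n) * adj (ten d U n)"
proof -
  show "adj (ten d U n) * ten d U n = one (d ^ n)" "ten d U n * adj (ten d U n) = one (d ^ n)"
    unfolding adj_ten ten_one[symmetric] using U
    by (simp_all add: ten_times) (auto intro!: ten_cong)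
  show "ten d r n = ten d U n * dg (d ^ n) (dten d f n) * adj (ten d U n)"
    unfolding adj_ten ten_dg[symmetric] using U r
    by (simp add: ten_times) (auto intro!: ten_cong)
qed

text \<open>The selection \<open>S\<close> is an arbitrary set of indices, so one computation serves
  the cuts from above and from below.\<close>

lemma spectral_projection:
  fixes F :: "nat \<Rightarrow> real"
  assumes U: "supp D U" "adj U * U = one D" "U * adj U = one D"
  defines "P \<equiv> \<lambda>S. U * dg D (\<lambda>i. if S i then 1 else 0) * adj U"
  assumes A: "A = U * dg D F * adj U"
  shows "proj D (P S)" "tr ((one D - P S) * A) = (\<Sum>i<D. if S i then 0 else F i)"
    "P S * A * P S = U * dg D (\<lambda>i. if S i then F i else 0) * adj U"
proof -
  have mult: "(U * dg D f * adj U) * (U * dg D g * adj U) = U * dg D (\<lambda>i. f i * g i) * adj U" for f g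
  proof -
    have "(U * dg D f * adj U) * (U * dg D g * adj U) = U * (dg D f * ((adj U * U) * dg D g)) * adj U"
      by (simp add: mult.assoc)
    then show ?thesis by (simp add: U)
  qed
  show "proj D (P S)" unfolding proj_def P_def mult using U(1)
    by (simp add: mult.assoc if_distrib[of "\<lambda>x. x * _"] cong: if_cong)
  show "P S * A * P S = U * dg D (\<lambda>i. if S i then F i else 0) * adj U"
    unfolding P_def A mult by (intro arg_cong2[of _ _ _ _ "(*)"] dg_cong refl) auto
  have "one D - P S = U * dg D (\<lambda>i. if S i then 0 else 1) * adj U"
  proof -
    have "one D - P S = U * (one D - dg D (\<lambda>i. if S i then 1 else 0)) * adj U"
      using U by (simp add: P_def right_diff_distrib left_diff_distrib)
    also have "one D - dg D (\<lambda>i. if S i then 1 else 0) = dg D (\<lambda>i. if S i then 0 else 1)"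
      unfolding dg_diff by (intro dg_cong) auto
    finally show ?thesis .
  qed
  then have "(one D - P S) * A = U * dg D (\<lambda>i. (if S i then 0 else 1) * F i) * adj U"
    by (simp only: A mult)
  then have "tr ((one D - P S) * A) = tr (adj U * (U * dg D (\<lambda>i. (if S i then 0 else 1) * F i)))"
    by (simp only: tr_commute[of _ "adj U"])
  also have "\<dots> = tr (adj U * U * dg D (\<lambda>i. (if S i then 0 else 1) * F i))"
    by (simp only: mult.assoc)
  also have "\<dots> = (\<Sum>i<D. if S i then 0 else F i)"
    by (simp add: U) (rule sum.cong, auto)
  finally show "tr ((one D - P S) * A) = (\<Sum>i<D. if S i then 0 else F i)" .
qed

lemma unitary_diag_mono:
  assumes "\<And>i. i < D \<Longrightarrow> f i \<le> g i"
  shows "U * dg D f * adj U \<le> U * dg D g * adj U"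
proof -
  have "0 \<le> dg D g - dg D f" unfolding dg_diff by (intro dg_nonneg) (use assms in auto)
  then have "dg D f \<le> dg D g" by simp
  from sandwich_mono[OF this, of "adj U"] show ?thesis by simp
qed

text \<open>\<open>P\<close> keeps the eigenvalues up to \<open>t\<close>. The lost weight is
  bounded as in Markov's inequality, an eigenvalue F above \<open>t\<close> satisfying F \<le> F
  (F/t)^s, and the resulting power sum factors. Since \<open>P\<close> is diagonal in the eigenbasis
  of the product state, its compression stays below that state.\<close>

lemma upper_projection:
  assumes U: "\<And>l. l < n \<Longrightarrow> supp d (U l)" "\<And>l. l < n \<Longrightarrow> adj (U l) * U l = one d"
      "\<And>l. l < n \<Longrightarrow> U l * adj (U l) = one d"
    and r: "\<And>l. l < n \<Longrightarrow> r l = U l * dg d (f l) * adj (U l)"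
    and f: "\<And>l j. l < n \<Longrightarrow> j < d \<Longrightarrow> 0 \<le> f l j" and t: "0 < t" "0 < s"
  shows "\<exists>P. proj (d ^ n) P \<and> P * ten d r n * P \<le> t *\<^sub>R one (d ^ n) \<and> P * ten d r n * P \<le> ten d r n \<and>
    tr ((one (d ^ n) - P) * ten d r n) \<le> t powr (- s) * (\<Prod>l<n. \<Sum>j<d. f l j powr (1 + s))"
proof -
  define V F where "V = ten d U n" and "F = dten d f n"
  have T: "adj V * V = one (d ^ n)" "V * adj V = one (d ^ n)" "ten d r n = V * dg (d ^ n) F * adj V"
    using ten_spectral[of n U r f] U r by (simp_all only: V_def F_def)
  have sV: "supp (d ^ n) V" by (simp add: V_def supp_ten)
  have F: "0 \<le> F i" for i unfolding F_def by (rule dten_nonneg) (use f in auto)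
  define S where "S i \<longleftrightarrow> F i \<le> t" for i
  note P = spectral_projection[OF sV T(1,2,3), of S]
  have "V * dg (d ^ n) (\<lambda>i. if S i then F i else 0) * adj V \<le> V * dg (d ^ n) (\<lambda>_. t) * adj V"
    by (rule unitary_diag_mono) (use t in \<open>auto simp: S_def\<close>)
  also have "dg (d ^ n) (\<lambda>_. t) = t *\<^sub>R one (d ^ n)" by (simp add: dg_scaleR)
  also have "V * (t *\<^sub>R one (d ^ n)) * adj V = t *\<^sub>R one (d ^ n)" using T sV by simp
  finally have 1: "V * dg (d ^ n) (\<lambda>i. if S i then F i else 0) * adj V \<le> t *\<^sub>R one (d ^ n)" .
  have 2: "V * dg (d ^ n) (\<lambda>i. if S i then F i else 0) * adj V \<le> ten d r n"
    unfolding T(3) by (rule unitary_diag_mono) (use F in auto)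
  have "(\<Sum>i<d ^ n. if S i then 0 else F i) \<le> (\<Sum>i<d ^ n. t powr (- s) * F i powr (1 + s))"
  proof (rule sum_mono)
    fix i
    show "(if S i then 0 else F i) \<le> t powr (- s) * F i powr (1 + s)"
    proof (cases "S i")
      case False
      then have "t < F i" by (simp add: S_def)
      then have "1 \<le> (F i / t) powr s" using t by (intro ge_one_powr_ge_zero) auto
      then have "F i * 1 \<le> F i * (F i / t) powr s" by (intro mult_left_mono F)
      also have "\<dots> = t powr (- s) * F i powr (1 + s)"
        using t \<open>t < F i\<close> by (simp add: powr_divide powr_minus powr_add field_simps)
      finally show ?thesis using False by simp
    qed simp
  qed
  also have "\<dots> = t powr (- s) * (\<Prod>l<n. \<Sum>j<d. f l j powr (1 + s))"
    unfolding sum_distrib_left[symmetric] F_def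
    by (intro arg_cong2[of _ _ _ _ "(*)"] refl sum_dten) (use f in \<open>auto simp: powr_mult\<close>)
  finally show ?thesis
    using P 1 2 by (intro exI[of _ "V * dg (d ^ n) (\<lambda>i. if S i then 1 else 0) * adj V"]) auto
qed

text \<open>\<open>P\<close> keeps the eigenvalues from \<open>t\<close> on, where 1 \<le> F/t;
  hence the bound by \<open>1 / t\<close> times the state. The weight below \<open>t\<close> is
  controlled by F \<le> F (t/F)^s.\<close>

lemma lower_projection:
  assumes U: "\<And>l. l < n \<Longrightarrow> supp d (U l)" "\<And>l. l < n \<Longrightarrow> adj (U l) * U l = one d"
      "\<And>l. l < n \<Longrightarrow> U l * adj (U l) = one d"
    and r: "\<And>l. l < n \<Longrightarrow> r l = U l * dg d (f l) * adj (U l)"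
    and f: "\<And>l j. l < n \<Longrightarrow> j < d \<Longrightarrow> 0 \<le> f l j" and t: "0 < t" "0 < s" "s < 1"
  shows "\<exists>P. proj (d ^ n) P \<and> P \<le> (1 / t) *\<^sub>R ten d r n \<and>
    tr ((one (d ^ n) - P) * ten d r n) \<le> t powr s * (\<Prod>l<n. \<Sum>j<d. f l j powr (1 - s))"
proof -
  define V F where "V = ten d U n" and "F = dten d f n"
  have T: "adj V * V = one (d ^ n)" "V * adj V = one (d ^ n)" "ten d r n = V * dg (d ^ n) F * adj V"
    using ten_spectral[of n U r f] U r by (simp_all only: V_def F_def)
  have sV: "supp (d ^ n) V" by (simp add: V_def supp_ten)
  have F: "0 \<le> F i" for i unfolding F_def by (rule dten_nonneg) (use f in auto)
  define S where "S i \<longleftrightarrow> t \<le> F i" for i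
  note P = spectral_projection[OF sV T(1,2,3), of S]
  have "V * dg (d ^ n) (\<lambda>i. if S i then 1 else 0) * adj V \<le> V * dg (d ^ n) (\<lambda>i. (1 / t) * F i) * adj V"
    by (rule unitary_diag_mono) (use t F in \<open>auto simp: S_def field_simps\<close>)
  also have "dg (d ^ n) (\<lambda>i. (1 / t) * F i) = (1 / t) *\<^sub>R dg (d ^ n) F" by (simp only: dg_scaleR)
  also have "V * ((1 / t) *\<^sub>R dg (d ^ n) F) * adj V = (1 / t) *\<^sub>R ten d r n" by (simp add: T(3))
  finally have 1: "V * dg (d ^ n) (\<lambda>i. if S i then 1 else 0) * adj V \<le> (1 / t) *\<^sub>R ten d r n" .
  have "(\<Sum>i<d ^ n. if S i then 0 else F i) \<le> (\<Sum>i<d ^ n. t powr s * F i powr (1 - s))"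
  proof (rule sum_mono)
    fix i
    show "(if S i then 0 else F i) \<le> t powr s * F i powr (1 - s)"
    \<comment> \<open>Zero eigenvalues have no weight to lose and are set aside before dividing by
      \<open>F i\<close>.\<close>
    proof (cases "S i \<or> F i = 0")
      case False
      then have Fi: "F i < t" "0 < F i" using F[of i] by (auto simp: S_def)
      then have "1 \<le> (t / F i) powr s" using t by (intro ge_one_powr_ge_zero) auto
      then have "F i * 1 \<le> F i * (t / F i) powr s" by (intro mult_left_mono F)
      also have "\<dots> = t powr s * F i powr (1 - s)"
        using t Fi by (simp add: powr_divide powr_diff field_simps)
      finally show ?thesis using False by simp
    qed auto
  qed
  also have "\<dots> = t powr s * (\<Prod>l<n. \<Sum>j<d. f l j powr (1 - s))"
    unfolding sum_distrib_left[symmetric] F_def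
    by (intro arg_cong2[of _ _ _ _ "(*)"] refl sum_dten) (use f in \<open>auto simp: powr_mult\<close>)
  finally show ?thesis
    using P 1 by (intro exI[of _ "V * dg (d ^ n) (\<lambda>i. if S i then 1 else 0) * adj V"]) auto
qed

end

section \<open>Chernoff exponents\<close>

text \<open>\<open>g\<close> is a moment generating function of the logarithm of the eigenvalues. It
  is 1 at 0, and its slope there is \<open>ln 2\<close> times the difference between
  \<open>c\<close> and the entropy; zero eigenvalues match the convention \<open>eta 0 = 0\<close>.
  Positive and negative s serve the two kinds of threshold.\<close>

lemma moment_derivative:
  fixes w l :: "'a \<Rightarrow> real" and c :: real
  assumes "finite A" "\<And>a. a \<in> A \<Longrightarrow> 0 \<le> l a" and one: "(\<Sum>a\<in>A. w a * l a) = 1"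
  defines "g \<equiv> \<lambda>s. 2 powr (s * c) * (\<Sum>a\<in>A. w a * l a powr (1 + s))"
  shows "(g has_real_derivative (ln 2 * (c + (\<Sum>a\<in>A. w a * eta (l a))))) (at 0)" "g 0 = 1"
proof -
  have l: "((\<lambda>s. w a * l a powr (1 + s)) has_real_derivative (ln 2 * (w a * eta (l a)))) (at 0)" if "a \<in> A" for a
  proof (cases "l a = 0")
    case True
    then show ?thesis by (simp add: eta_def)
  next
    case False
    then have "l a > 0" using assms(2)[OF that] by simp
    then show ?thesis
      by (auto intro!: derivative_eq_intros simp: eta_def log_def)
  qed
  have S: "((\<lambda>s. \<Sum>a\<in>A. w a * l a powr (1 + s)) has_real_derivative (\<Sum>a\<in>A. ln 2 * (w a * eta (l a)))) (at 0)"
    by (intro DERIV_sum l)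
  have z: "(\<Sum>a\<in>A. w a * l a powr (1 + 0)) = 1"
  proof -
    have "(\<Sum>a\<in>A. w a * l a powr (1 + 0)) = (\<Sum>a\<in>A. w a * l a)"
      using assms(2) by (intro sum.cong) auto
    then show ?thesis by (simp add: one)
  qed
  have "((\<lambda>s. 2 powr (s * c)) has_real_derivative (ln 2 * c)) (at 0)"
    by (auto intro!: derivative_eq_intros)
  from DERIV_mult[OF this S] show "(g has_real_derivative (ln 2 * (c + (\<Sum>a\<in>A. w a * eta (l a))))) (at 0)"
    unfolding g_def by (rule DERIV_cong) (simp only: z, simp add: sum_distrib_left algebra_simps)
  show "g 0 = 1" unfolding g_def using z by simp
qed

text \<open>A threshold exponent \<open>\<gamma>\<close> below the entropy makes the slope at 0
  negative, so the moment drops under 1 for some small positive s. The lower version reverses both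
  the slope and the side.\<close>

lemma chernoff_upper:
  fixes w l :: "'a \<Rightarrow> real"
  assumes "finite A" "\<And>a. a \<in> A \<Longrightarrow> 0 \<le> l a" "(\<Sum>a\<in>A. w a * l a) = 1" "0 < \<gamma>"
    and H: "H = - (\<Sum>a\<in>A. w a * eta (l a))"
  shows "\<exists>s>0. 2 powr (s * (H - \<gamma>)) * (\<Sum>a\<in>A. w a * l a powr (1 + s)) < 1"
proof -
  note g = moment_derivative[OF assms(1-3), where c = "H - \<gamma>"]
  have "ln 2 * ((H - \<gamma>) + (\<Sum>a\<in>A. w a * eta (l a))) < 0"
    using \<open>0 < \<gamma>\<close> by (simp add: H mult_less_0_iff)
  from DERIV_neg_dec_right[OF g(1) this]
  obtain e where "e > 0" and e: "\<And>h. 0 < h \<Longrightarrow> h < e \<Longrightarrow>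
      2 powr ((0 + h) * (H - \<gamma>)) * (\<Sum>a\<in>A. w a * l a powr (1 + (0 + h)))
      < 2 powr (0 * (H - \<gamma>)) * (\<Sum>a\<in>A. w a * l a powr (1 + 0))"
    by blast
  show ?thesis
    using e[of "e / 2"] \<open>e > 0\<close> g(2) by (intro exI[of _ "e / 2"]) simp
qed

lemma chernoff_lower:
  fixes w l :: "'a \<Rightarrow> real"
  assumes "finite A" "\<And>a. a \<in> A \<Longrightarrow> 0 \<le> l a" "(\<Sum>a\<in>A. w a * l a) = 1" "0 < \<gamma>"
    and H: "H = - (\<Sum>a\<in>A. w a * eta (l a))"
  shows "\<exists>s>0. s < 1 \<and> 2 powr (- s * (H + \<gamma>)) * (\<Sum>a\<in>A. w a * l a powr (1 - s)) < 1"
proof -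
  note g = moment_derivative[OF assms(1-3), where c = "H + \<gamma>"]
  have "0 < ln 2 * ((H + \<gamma>) + (\<Sum>a\<in>A. w a * eta (l a)))"
    using \<open>0 < \<gamma>\<close> by (simp add: H)
  from DERIV_pos_inc_left[OF g(1) this]
  obtain e where "e > 0" and e: "\<And>h. 0 < h \<Longrightarrow> h < e \<Longrightarrow>
      2 powr ((0 - h) * (H + \<gamma>)) * (\<Sum>a\<in>A. w a * l a powr (1 + (0 - h)))
      < 2 powr (0 * (H + \<gamma>)) * (\<Sum>a\<in>A. w a * l a powr (1 + 0))"
    by blast
  show ?thesis
    \<comment> \<open>The cap 1/2 guarantees \<open>s < 1\<close>, so that the exponent
      \<open>1 - s\<close> stays positive.\<close>
    using e[of "min (e / 2) (1 / 2)"] \<open>e > 0\<close> g(2) by (intro exI[of _ "min (e / 2) (1 / 2)"]) simp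
qed

section \<open>Entropy and typical projections\<close>

definition diagonalizes :: "nat \<Rightarrow> fop \<Rightarrow> fop \<Rightarrow> (nat \<Rightarrow> real) \<Rightarrow> bool" where
  "diagonalizes d U A f \<longleftrightarrow> supp d U \<and> adj U * U = one d \<and> U * adj U = one d \<and> A = U * dg d f * adj U"

text \<open>One diagonalization is fixed per operator. The choice is harmless: by
  \<open>vN_entropy_diagonalizes\<close> every diagonalization gives the same entropy.\<close>

definition eigs :: "nat \<Rightarrow> fop \<Rightarrow> nat \<Rightarrow> real" where
  "eigs d A = (SOME f. \<exists>U. diagonalizes d U A f)"

definition entropy :: "nat \<Rightarrow> fop \<Rightarrow> real" where
  "entropy d A = - (\<Sum>j<d. eta (eigs d A j))"

definition state :: "nat \<Rightarrow> fop \<Rightarrow> bool" where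
  "state d A \<longleftrightarrow> 0 \<le> A \<and> supp d A \<and> tr A = 1"

lemma eigs_diagonalizes:
  assumes "supp d A" "adj A = A"
  obtains U where "diagonalizes d U A (eigs d A)"
proof -
  have "\<exists>f U. diagonalizes d U A f"
    using spectral_decomp[OF assms] unfolding diagonalizes_def by metis
  from someI_ex[OF this] show ?thesis using that unfolding eigs_def by blast
qed

lemma state_eigs:
  assumes "state d A"
  obtains U where "diagonalizes d U A (eigs d A)" "\<And>i. i < d \<Longrightarrow> 0 \<le> eigs d A i" "(\<Sum>i<d. eigs d A i) = 1"
proof -
  have A: "0 \<le> A" "supp d A" "tr A = 1" using assms by (auto simp: state_def)
  obtain U where U: "diagonalizes d U A (eigs d A)"
    using eigs_diagonalizes[OF A(2) nonneg_herm[OF A(1)]] by metis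
  then have u: "supp d U" "adj U * U = one d" "U * adj U = one d" "A = U * dg d (eigs d A) * adj U"
    by (auto simp: diagonalizes_def)
  have "0 \<le> eigs d A i" if "i < d" for i
    by (rule spectral_lower_bound[OF u(1-3) _ that]) (use A(1) u(4) in simp)
  moreover have "tr A = tr (adj U * (U * dg d (eigs d A)))"
    by (subst u(4)) (rule tr_commute)
  then have "(\<Sum>i<d. eigs d A i) = 1"
    using A(3) u(2) by (simp add: mult.assoc[symmetric])
  ultimately show ?thesis using U that by blast
qed

lemma eigs_nonneg: "state d A \<Longrightarrow> i < d \<Longrightarrow> 0 \<le> eigs d A i"
  and sum_eigs: "state d A \<Longrightarrow> (\<Sum>i<d. eigs d A i) = 1"
  by (metis state_eigs)+

text \<open>The projection becomes a function of the factors, with \<open>t\<close> and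
  \<open>s\<close> fixed beforehand: one threshold serves all words of length n.\<close>

lemma upper_projections:
  assumes d: "0 < d" and ts: "0 < t" "0 < s"
  obtains P where "\<And>r. (\<And>l. l < n \<Longrightarrow> state d (r l)) \<Longrightarrow> proj (d ^ n) (P r) \<and>
    P r * ten d r n * P r \<le> t *\<^sub>R one (d ^ n) \<and> P r * ten d r n * P r \<le> ten d r n \<and>
    tr ((one (d ^ n) - P r) * ten d r n) \<le> t powr (- s) * (\<Prod>l<n. \<Sum>j<d. eigs d (r l) j powr (1 + s))"
proof -
  have "\<exists>P. proj (d ^ n) P \<and> P * ten d r n * P \<le> t *\<^sub>R one (d ^ n) \<and> P * ten d r n * P \<le> ten d r n \<and>
      tr ((one (d ^ n) - P) * ten d r n) \<le> t powr (- s) * (\<Prod>l<n. \<Sum>j<d. eigs d (r l) j powr (1 + s))"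
    if r: "\<And>l. l < n \<Longrightarrow> state d (r l)" for r
  proof -
    have "\<forall>l. \<exists>U. l < n \<longrightarrow> diagonalizes d U (r l) (eigs d (r l))"
      using r state_eigs by metis
    then obtain U where U: "\<And>l. l < n \<Longrightarrow> diagonalizes d (U l) (r l) (eigs d (r l))" by metis
    show ?thesis
      by (rule upper_projection[OF d, of n U r "\<lambda>l. eigs d (r l)"])
        (use U ts r eigs_nonneg in \<open>auto simp: diagonalizes_def\<close>)
  qed
  then have "\<forall>r. \<exists>P. (\<forall>l<n. state d (r l)) \<longrightarrow> proj (d ^ n) P \<and> P * ten d r n * P \<le> t *\<^sub>R one (d ^ n) \<and> P * ten d r n * P \<le> ten d r n \<and>
      tr ((one (d ^ n) - P) * ten d r n) \<le> t powr (- s) * (\<Prod>l<n. \<Sum>j<d. eigs d (r l) j powr (1 + s))"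
    by blast
  from choice[OF this] show ?thesis using that by blast
qed

lemma lower_projections:
  assumes d: "0 < d" and ts: "0 < t" "0 < s" "s < 1"
  obtains P where "\<And>r. (\<And>l. l < n \<Longrightarrow> state d (r l)) \<Longrightarrow> proj (d ^ n) (P r) \<and>
    P r \<le> (1 / t) *\<^sub>R ten d r n \<and>
    tr ((one (d ^ n) - P r) * ten d r n) \<le> t powr s * (\<Prod>l<n. \<Sum>j<d. eigs d (r l) j powr (1 - s))"
proof -
  have "\<exists>P. proj (d ^ n) P \<and> P \<le> (1 / t) *\<^sub>R ten d r n \<and>
      tr ((one (d ^ n) - P) * ten d r n) \<le> t powr s * (\<Prod>l<n. \<Sum>j<d. eigs d (r l) j powr (1 - s))"
    if r: "\<And>l. l < n \<Longrightarrow> state d (r l)" for r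
  proof -
    have "\<forall>l. \<exists>U. l < n \<longrightarrow> diagonalizes d U (r l) (eigs d (r l))"
      using r state_eigs by metis
    then obtain U where U: "\<And>l. l < n \<Longrightarrow> diagonalizes d (U l) (r l) (eigs d (r l))" by metis
    show ?thesis
      by (rule lower_projection[OF d, of n U r "\<lambda>l. eigs d (r l)"])
        (use U ts r eigs_nonneg in \<open>auto simp: diagonalizes_def\<close>)
  qed
  then have "\<forall>r. \<exists>P. (\<forall>l<n. state d (r l)) \<longrightarrow> proj (d ^ n) P \<and> P \<le> (1 / t) *\<^sub>R ten d r n \<and>
      tr ((one (d ^ n) - P) * ten d r n) \<le> t powr s * (\<Prod>l<n. \<Sum>j<d. eigs d (r l) j powr (1 - s))"
    by blast
  from choice[OF this] show ?thesis using that by blast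
qed

text \<open>Pairs of a label z and an eigenvalue index form a single finite family with weights
  \<open>w z\<close>. The scalar Chernoff lemmas apply to it, and its entropy sum is the conditional
  entropy of the ensemble.\<close>

lemma ensemble_eigs:
  assumes w: "finite Z" "(\<Sum>z\<in>Z. w z) = 1" and \<tau>: "\<And>z. z \<in> Z \<Longrightarrow> state d (\<tau> z)"
  shows "finite (Z \<times> {..<d})" "\<And>a. a \<in> Z \<times> {..<d} \<Longrightarrow> 0 \<le> (case a of (z,j) \<Rightarrow> eigs d (\<tau> z) j)"
    "(\<Sum>a\<in>Z \<times> {..<d}. w (fst a) * (case a of (z,j) \<Rightarrow> eigs d (\<tau> z) j)) = 1"
    "(\<Sum>z\<in>Z. w z * entropy d (\<tau> z)) = - (\<Sum>a\<in>Z \<times> {..<d}. w (fst a) * eta (case a of (z,j) \<Rightarrow> eigs d (\<tau> z) j))"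
proof -
  have prod: "(\<Sum>a\<in>Z \<times> {..<d}. w (fst a) * h (case a of (z,j) \<Rightarrow> eigs d (\<tau> z) j))
    = (\<Sum>z\<in>Z. w z * (\<Sum>j<d. h (eigs d (\<tau> z) j)))" for h
    by (simp add: sum_distrib_left sum.cartesian_product case_prod_beta)
  show "finite (Z \<times> {..<d})" using w by simp
  show "0 \<le> (case a of (z,j) \<Rightarrow> eigs d (\<tau> z) j)" if "a \<in> Z \<times> {..<d}" for a
    using that \<tau> eigs_nonneg by auto
  have "(\<Sum>j<d. eigs d (\<tau> z) j) = 1" if "z \<in> Z" for z by (rule sum_eigs[OF \<tau>[OF that]])
  then show "(\<Sum>a\<in>Z \<times> {..<d}. w (fst a) * (case a of (z,j) \<Rightarrow> eigs d (\<tau> z) j)) = 1"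
    using w prod[of "\<lambda>x. x"] by simp
  show "(\<Sum>z\<in>Z. w z * entropy d (\<tau> z)) = - (\<Sum>a\<in>Z \<times> {..<d}. w (fst a) * eta (case a of (z,j) \<Rightarrow> eigs d (\<tau> z) j))"
    unfolding prod[of eta] by (simp add: entropy_def sum_negf)
qed

lemma ensemble_upper:
  assumes "finite Z" "(\<Sum>z\<in>Z. w z) = 1" "\<And>z. z \<in> Z \<Longrightarrow> state d (\<tau> z)" "0 < \<gamma>"
  shows "\<exists>s>0. 2 powr (s * ((\<Sum>z\<in>Z. w z * entropy d (\<tau> z)) - \<gamma>)) *
    (\<Sum>z\<in>Z. w z * (\<Sum>j<d. eigs d (\<tau> z) j powr (1 + s))) < 1"
  using chernoff_upper[OF ensemble_eigs(1-3)[OF assms(1-3)] assms(4) ensemble_eigs(4)[OF assms(1-3)]]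
  by (simp add: sum_distrib_left sum.cartesian_product case_prod_beta)

lemma ensemble_lower:
  assumes "finite Z" "(\<Sum>z\<in>Z. w z) = 1" "\<And>z. z \<in> Z \<Longrightarrow> state d (\<tau> z)" "0 < \<gamma>"
  shows "\<exists>s>0. s < 1 \<and> 2 powr (- s * ((\<Sum>z\<in>Z. w z * entropy d (\<tau> z)) + \<gamma>)) *
    (\<Sum>z\<in>Z. w z * (\<Sum>j<d. eigs d (\<tau> z) j powr (1 - s))) < 1"
  using chernoff_lower[OF ensemble_eigs(1-3)[OF assms(1-3)] assms(4) ensemble_eigs(4)[OF assms(1-3)]]
  by (simp add: sum_distrib_left sum.cartesian_product case_prod_beta)

text \<open>The average of a product over independent letters is a power. This makes the miss
  probabilities exponentially small in n.\<close>

lemma sum_PiE_prod: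
  fixes p \<phi> :: "'a \<Rightarrow> real" and n :: nat
  assumes "finite X"
  shows "(\<Sum>u\<in>{..<n} \<rightarrow>\<^sub>E X. (\<Prod>i<n. p (u i)) * (\<Prod>i<n. \<phi> (u i))) = (\<Sum>x\<in>X. p x * \<phi> x) ^ n"
  using prod_sum_PiE[of "{..<n}" "\<lambda>_. X" "\<lambda>_ x. p x * \<phi> x"] assms by (simp add: prod.distrib)

lemma sum_PiE_prod2:
  fixes p :: "'a \<Rightarrow> real" and q :: "'b \<Rightarrow> real" and \<phi> :: "'a \<Rightarrow> 'b \<Rightarrow> real" and n :: nat
  assumes "finite X" "finite Y"
  shows "(\<Sum>u\<in>{..<n} \<rightarrow>\<^sub>E X. (\<Prod>i<n. p (u i)) * (\<Sum>v\<in>{..<n} \<rightarrow>\<^sub>E Y. (\<Prod>i<n. q (v i)) * (\<Prod>i<n. \<phi> (u i) (v i))))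
    = (\<Sum>x\<in>X. p x * (\<Sum>y\<in>Y. q y * \<phi> x y)) ^ n"
proof -
  have "(\<Sum>v\<in>{..<n} \<rightarrow>\<^sub>E Y. (\<Prod>i<n. q (v i)) * (\<Prod>i<n. \<phi> (u i) (v i))) = (\<Prod>i<n. \<Sum>y\<in>Y. q y * \<phi> (u i) y)" for u
    using prod_sum_PiE[of "{..<n}" "\<lambda>_. Y" "\<lambda>i y. q y * \<phi> (u i) y"] assms by (simp add: prod.distrib)
  then show ?thesis using sum_PiE_prod[OF assms(1), where n = n and p = p and \<phi> = "\<lambda>x. \<Sum>y\<in>Y. q y * \<phi> x y"] by simp
qed

section \<open>Achievability\<close>

lemma state_average:
  assumes "distr X p" "\<And>x. x \<in> X \<Longrightarrow> state d (\<tau> x)"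
  shows "state d (\<Sum>x\<in>X. p x *\<^sub>R \<tau> x)"
proof -
  interpret distr X p by fact
  show ?thesis
    using assms(2) nonneg sum1 by (auto simp: state_def intro!: sum_nonneg scaleR_nonneg_nonneg)
qed

lemma state_ten:
  assumes d: "0 < d" and r: "\<And>l. l < n \<Longrightarrow> state d (r l)"
  shows "state (d ^ n) (ten d r n)"
proof -
  have "\<forall>l. \<exists>U. l < n \<longrightarrow> diagonalizes d U (r l) (eigs d (r l))"
    using r state_eigs by metis
  then obtain U where U: "\<And>l. l < n \<Longrightarrow> diagonalizes d (U l) (r l) (eigs d (r l))" by metis
  define V F where "V = ten d U n" and "F = dten d (\<lambda>l. eigs d (r l)) n"
  have T: "adj V * V = one (d ^ n)" "V * adj V = one (d ^ n)" "ten d r n = V * dg (d ^ n) F * adj V"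
    using ten_spectral[OF d, of n U r "\<lambda>l. eigs d (r l)"] U by (simp_all add: V_def F_def diagonalizes_def)
  have e0: "0 \<le> eigs d (r l) j" if "l < n" "j < d" for l j
    by (rule eigs_nonneg[OF r[OF that(1)] that(2)])
  have e1: "(\<Sum>j<d. eigs d (r l) j) = 1" if "l < n" for l
    by (rule sum_eigs[OF r[OF that]])
  have F: "0 \<le> F i" for i unfolding F_def by (rule dten_nonneg[OF d]) (use e0 in auto)
  have "0 \<le> adj (adj V) * dg (d ^ n) F * adj V" by (intro sandwich_nonneg dg_nonneg F)
  then have "0 \<le> ten d r n" using T(3) by simp
  moreover have "supp (d ^ n) (ten d r n)" by (rule supp_ten[OF d])
  moreover have "tr (ten d r n) = 1"
  proof -
    have "tr (ten d r n) = tr (adj V * (V * dg (d ^ n) F))" unfolding T(3) by (rule tr_commute)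
    also have "\<dots> = (\<Sum>i<d ^ n. F i)" by (simp add: mult.assoc[symmetric] T(1))
    also have "\<dots> = (\<Prod>l<n. \<Sum>j<d. eigs d (r l) j)"
      unfolding F_def by (rule sum_dten[OF d, where h = "\<lambda>x. x"]) (use e0 in auto)
    also have "\<dots> = 1" by (intro prod.neutral ballI) (use e1 in auto)
    finally show ?thesis .
  qed
  ultimately show ?thesis by (simp add: state_def)
qed

lemma distr_PiE:
  fixes n :: nat
  assumes "distr X p"
  shows "distr ({..<n} \<rightarrow>\<^sub>E X) (\<lambda>u. \<Prod>i<n. p (u i))"
proof -
  interpret distr X p by fact
  show ?thesis
  proof
    show "finite ({..<n} \<rightarrow>\<^sub>E X)" using fin by (intro finite_PiE) auto
    show "0 \<le> (\<Prod>i<n. p (x i))" if "x \<in> {..<n} \<rightarrow>\<^sub>E X" for x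
      using that by (intro prod_nonneg) (auto intro: nonneg)
    show "(\<Sum>u\<in>{..<n} \<rightarrow>\<^sub>E X. \<Prod>i<n. p (u i)) = 1"
      using pexp_const[of "{..<n}" 1] by (simp add: pexp_def)
  qed
qed

locale cq_mac = X: distr X p + Y: distr Y q
  for X :: "'a set" and p and Y :: "'b set" and q +
  fixes d :: nat and \<rho> :: "'a \<Rightarrow> 'b \<Rightarrow> fop"
  assumes d: "0 < d" and \<rho>: "x \<in> X \<Longrightarrow> y \<in> Y \<Longrightarrow> state d (\<rho> x y)"
begin

definition \<rho>1 :: "'a \<Rightarrow> fop" where "\<rho>1 x = (\<Sum>y\<in>Y. q y *\<^sub>R \<rho> x y)"
definition \<rho>2 :: "'b \<Rightarrow> fop" where "\<rho>2 y = (\<Sum>x\<in>X. p x *\<^sub>R \<rho> x y)"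
definition \<rho>0 :: fop where "\<rho>0 = (\<Sum>x\<in>X. p x *\<^sub>R \<rho>1 x)"

text \<open>The four quantities \<open>H12\<close>, \<open>H1\<close>, \<open>H2\<close> and
  \<open>H0\<close> are H(B|X1X2), H(B|X1), H(B|X2) and H(B).\<close>

definition H12 :: real where "H12 = (\<Sum>x\<in>X. p x * (\<Sum>y\<in>Y. q y * entropy d (\<rho> x y)))"
definition H1 :: real where "H1 = (\<Sum>x\<in>X. p x * entropy d (\<rho>1 x))"
definition H2 :: real where "H2 = (\<Sum>y\<in>Y. q y * entropy d (\<rho>2 y))"
definition H0 :: real where "H0 = entropy d \<rho>0"

lemma states: "x \<in> X \<Longrightarrow> state d (\<rho>1 x)" "y \<in> Y \<Longrightarrow> state d (\<rho>2 y)" "state d \<rho>0"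
proof -
  show 1: "state d (\<rho>1 x)" if "x \<in> X" for x
    unfolding \<rho>1_def by (rule state_average[OF Y.distr_axioms]) (use \<rho> that in auto)
  show "state d (\<rho>2 y)" if "y \<in> Y"
    unfolding \<rho>2_def by (rule state_average[OF X.distr_axioms]) (use \<rho> that in auto)
  show "state d \<rho>0"
    unfolding \<rho>0_def by (rule state_average[OF X.distr_axioms 1])
qed

abbreviation pn :: "nat \<Rightarrow> (nat \<Rightarrow> 'a) \<Rightarrow> real" where "pn n u \<equiv> \<Prod>i<n. p (u i)"
abbreviation qn :: "nat \<Rightarrow> (nat \<Rightarrow> 'b) \<Rightarrow> real" where "qn n v \<equiv> \<Prod>i<n. q (v i)"
abbreviation Xn :: "nat \<Rightarrow> (nat \<Rightarrow> 'a) set" where "Xn n \<equiv> {..<n} \<rightarrow>\<^sub>E X"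
abbreviation Yn :: "nat \<Rightarrow> (nat \<Rightarrow> 'b) set" where "Yn n \<equiv> {..<n} \<rightarrow>\<^sub>E Y"
abbreviation out :: "nat \<Rightarrow> (nat \<Rightarrow> 'a) \<Rightarrow> (nat \<Rightarrow> 'b) \<Rightarrow> fop" where
  "out n u v \<equiv> ten d (\<lambda>i. \<rho> (u i) (v i)) n"

lemma average_out:
  "(\<Sum>v\<in>Yn n. qn n v *\<^sub>R out n u v) = ten d (\<lambda>i. \<rho>1 (u i)) n"
  "(\<Sum>u\<in>Xn n. pn n u *\<^sub>R out n u v) = ten d (\<lambda>i. \<rho>2 (v i)) n"
  "(\<Sum>u\<in>Xn n. pn n u *\<^sub>R ten d (\<lambda>i. \<rho>1 (u i)) n) = ten d (\<lambda>i. \<rho>0) n"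
  unfolding \<rho>2_def \<rho>0_def
  using ten_average[OF d Y.fin, where n = n and p = q and G = "\<lambda>i y. \<rho> (u i) y"]
    ten_average[OF d X.fin, where n = n and p = p and G = "\<lambda>i x. \<rho> x (v i)"]
    ten_average[OF d X.fin, where n = n and p = p and G = "\<lambda>i x. \<rho>1 x"]
  by (simp_all add: \<rho>1_def)

text \<open>A threshold 2^(-nh) contributes a factor that is itself an n-th power and merges with
  that of the averaged moments.\<close>

lemma powr_scale: "(2 powr (- real n * h)) powr (- s) = (2 powr (s * h)) ^ n"
  "(2 powr (- real n * h)) powr s = (2 powr (- s * h)) ^ n"
  by (simp_all add: powr_powr flip: powr_realpow) (simp_all add: powr_powr mult_ac)

text \<open>Only \<open>M1 - 1\<close> and \<open>M2 - 1\<close> are bounded, because confusion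
  arises from wrong messages alone; numbers of messages obtained by rounding up satisfy
  this.\<close>

theorem achievability:
  fixes R1 R2 \<epsilon> \<delta> :: real
  assumes R: "R1 \<le> H2 - H12" "R2 \<le> H1 - H12" "R1 + R2 \<le> H0 - H12"
    and \<epsilon>: "0 < \<epsilon>" and \<delta>: "0 < \<delta>"
  shows "\<exists>N. \<forall>n\<ge>N. \<forall>M1 M2. 0 < M1 \<longrightarrow> 0 < M2 \<longrightarrow>
    real (M1 - 1) \<le> 2 powr (real n * (R1 - \<delta>)) \<longrightarrow> real (M2 - 1) \<le> 2 powr (real n * (R2 - \<delta>)) \<longrightarrow>
    (\<exists>\<Lambda>. (\<forall>c\<in>{..<M1} \<rightarrow>\<^sub>E Xn n. \<forall>e\<in>{..<M2} \<rightarrow>\<^sub>E Yn n.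
        (\<forall>m1<M1. \<forall>m2<M2. 0 \<le> \<Lambda> c e m1 m2 \<and> supp (d ^ n) (\<Lambda> c e m1 m2)) \<and>
        (\<Sum>(m1,m2)\<in>{..<M1} \<times> {..<M2}. \<Lambda> c e m1 m2) = one (d ^ n)) \<and>
      pexp {..<M1} (Xn n) (pn n) (\<lambda>c. pexp {..<M2} (Yn n) (qn n) (\<lambda>e. 1 / (real M1 * real M2) *
        (\<Sum>m1<M1. \<Sum>m2<M2. tr ((one (d ^ n) - \<Lambda> c e m1 m2) * out n (c m1) (e m2))))) \<le> \<epsilon>)"
proof -
  \<comment> \<open>Every confusion term meets two thresholds, each off by \<open>\<gamma>\<close>
    in the exponent. Of the gap \<open>\<delta>\<close> in the rate this leaves half, the decay rate
    of \<open>h\<close> below.\<close>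
  define \<gamma> where "\<gamma> = \<delta> / 4"
  have \<gamma>: "0 < \<gamma>" using \<delta> by (simp add: \<gamma>_def)
  obtain s12 where s12: "0 < s12" "s12 < 1" and
    g12: "2 powr (- s12 * (H12 + \<gamma>)) * (\<Sum>x\<in>X. p x * (\<Sum>y\<in>Y. q y * (\<Sum>j<d. eigs d (\<rho> x y) j powr (1 - s12)))) < 1"
  proof -
    have "(\<Sum>z\<in>X \<times> Y. p (fst z) * q (snd z)) = (\<Sum>x\<in>X. \<Sum>y\<in>Y. p x * q y)"
      by (simp add: sum.cartesian_product case_prod_beta)
    also have "\<dots> = 1" by (simp add: sum_product[symmetric] X.sum1 Y.sum1)
    finally have "(\<Sum>z\<in>X \<times> Y. p (fst z) * q (snd z)) = 1" .
    moreover have "state d (\<rho> (fst z) (snd z))" if "z \<in> X \<times> Y" for z using \<rho> that by auto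
    moreover have "finite (X \<times> Y)" using X.fin Y.fin by simp
    ultimately have ex: "\<exists>s>0. s < 1 \<and> 2 powr (- s * ((\<Sum>z\<in>X \<times> Y. p (fst z) * q (snd z) * entropy d (\<rho> (fst z) (snd z))) + \<gamma>)) *
        (\<Sum>z\<in>X \<times> Y. p (fst z) * q (snd z) * (\<Sum>j<d. eigs d (\<rho> (fst z) (snd z)) j powr (1 - s))) < 1"
      using \<gamma> by (intro ensemble_lower)
    have pair: "(\<Sum>z\<in>X \<times> Y. p (fst z) * q (snd z) * f (fst z) (snd z)) = (\<Sum>x\<in>X. p x * (\<Sum>y\<in>Y. q y * f x y))"
      for f :: "'a \<Rightarrow> 'b \<Rightarrow> real"
      by (simp add: sum_distrib_left sum.cartesian_product case_prod_beta mult.assoc)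
    show ?thesis
      using ex that unfolding pair[of "\<lambda>x y. entropy d (\<rho> x y)"] H12_def[symmetric]
        pair[of "\<lambda>x y. \<Sum>j<d. eigs d (\<rho> x y) j powr (1 - _)"] by blast
  qed
  obtain s1 where s1: "0 < s1" and
    g1: "2 powr (s1 * (H1 - \<gamma>)) * (\<Sum>x\<in>X. p x * (\<Sum>j<d. eigs d (\<rho>1 x) j powr (1 + s1))) < 1"
    using ensemble_upper[of X p d \<rho>1 \<gamma>] X.fin X.sum1 states(1) \<gamma> unfolding H1_def by blast
  obtain s2 where s2: "0 < s2" and
    g2: "2 powr (s2 * (H2 - \<gamma>)) * (\<Sum>y\<in>Y. q y * (\<Sum>j<d. eigs d (\<rho>2 y) j powr (1 + s2))) < 1"
    using ensemble_upper[of Y q d \<rho>2 \<gamma>] Y.fin Y.sum1 states(2) \<gamma> unfolding H2_def by blast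
  \<comment> \<open>The unconditional entropy is the case of an ensemble with one member.\<close>
  obtain s0 where s0: "0 < s0" and
    g0: "2 powr (s0 * (H0 - \<gamma>)) * (\<Sum>j<d. eigs d \<rho>0 j powr (1 + s0)) < 1"
    using ensemble_upper[of "{()}" "\<lambda>_. 1" d "\<lambda>_. \<rho>0" \<gamma>] states(3) \<gamma> unfolding H0_def by auto
  define G12 G1 G2 G0 h where
    "G12 = 2 powr (- s12 * (H12 + \<gamma>)) * (\<Sum>x\<in>X. p x * (\<Sum>y\<in>Y. q y * (\<Sum>j<d. eigs d (\<rho> x y) j powr (1 - s12))))"
    and "G1 = 2 powr (s1 * (H1 - \<gamma>)) * (\<Sum>x\<in>X. p x * (\<Sum>j<d. eigs d (\<rho>1 x) j powr (1 + s1)))"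
    and "G2 = 2 powr (s2 * (H2 - \<gamma>)) * (\<Sum>y\<in>Y. q y * (\<Sum>j<d. eigs d (\<rho>2 y) j powr (1 + s2)))"
    and "G0 = 2 powr (s0 * (H0 - \<gamma>)) * (\<Sum>j<d. eigs d \<rho>0 j powr (1 + s0))"
    and "h = 2 powr (- \<delta> / 2)"
  have G: "0 \<le> G12" "G12 < 1" "0 \<le> G1" "G1 < 1" "0 \<le> G2" "G2 < 1" "0 \<le> G0" "G0 < 1" "0 \<le> h" "h < 1"
    using g12 g1 g2 g0 \<delta> X.nonneg Y.nonneg
    unfolding G12_def G1_def G2_def G0_def h_def
    by (auto intro!: mult_nonneg_nonneg sum_nonneg simp: powr_less_one)
  \<comment> \<open>Three kinds of confusion with factor 8 each give 24. The other half of
    \<open>\<epsilon>\<close> is reserved for the perturbation that makes the tests' sum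
    invertible.\<close>
  have "(\<lambda>n. 48 * (G0 ^ n + G1 ^ n + G2 ^ n + G12 ^ n) + 24 * h ^ n) \<longlonglongrightarrow> 48 * (0 + 0 + 0 + 0) + 24 * 0"
    using G by (intro tendsto_intros LIMSEQ_realpow_zero)
  then have "\<forall>\<^sub>F n in sequentially. 48 * (G0 ^ n + G1 ^ n + G2 ^ n + G12 ^ n) + 24 * h ^ n < \<epsilon> / 2"
    using \<epsilon> by (intro order_tendstoD(2)) auto
  then obtain N where N: "\<And>n. n \<ge> N \<Longrightarrow> 48 * (G0 ^ n + G1 ^ n + G2 ^ n + G12 ^ n) + 24 * h ^ n < \<epsilon> / 2"
    by (auto simp: eventually_sequentially)
  show ?thesis
  proof (intro exI[of _ N] allI impI)
    fix n M1 M2 :: nat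
    assume n: "N \<le> n" and M: "0 < M1" "0 < M2"
      and M1: "real (M1 - 1) \<le> 2 powr (real n * (R1 - \<delta>))" and M2: "real (M2 - 1) \<le> 2 powr (real n * (R2 - \<delta>))"
    define t12 t1 t2 t0 where "t12 = 2 powr (- real n * (H12 + \<gamma>))" and "t1 = 2 powr (- real n * (H1 - \<gamma>))"
      and "t2 = 2 powr (- real n * (H2 - \<gamma>))" and "t0 = 2 powr (- real n * (H0 - \<gamma>))"
    have t: "0 < t12" "0 < t1" "0 < t2" "0 < t0" by (simp_all add: t12_def t1_def t2_def t0_def)
    obtain Q12 where Q12: "\<And>r. (\<And>l. l < n \<Longrightarrow> state d (r l)) \<Longrightarrow> proj (d ^ n) (Q12 r) \<and>
        Q12 r \<le> (1 / t12) *\<^sub>R ten d r n \<and>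
        tr ((one (d ^ n) - Q12 r) * ten d r n) \<le> t12 powr s12 * (\<Prod>l<n. \<Sum>j<d. eigs d (r l) j powr (1 - s12))"
      by (rule lower_projections[OF d t(1) s12]) blast
    obtain Q1 where Q1: "\<And>r. (\<And>l. l < n \<Longrightarrow> state d (r l)) \<Longrightarrow> proj (d ^ n) (Q1 r) \<and>
        Q1 r * ten d r n * Q1 r \<le> t1 *\<^sub>R one (d ^ n) \<and> Q1 r * ten d r n * Q1 r \<le> ten d r n \<and>
        tr ((one (d ^ n) - Q1 r) * ten d r n) \<le> t1 powr (- s1) * (\<Prod>l<n. \<Sum>j<d. eigs d (r l) j powr (1 + s1))"
      by (rule upper_projections[OF d t(2) s1]) blast
    obtain Q2 where Q2: "\<And>r. (\<And>l. l < n \<Longrightarrow> state d (r l)) \<Longrightarrow> proj (d ^ n) (Q2 r) \<and>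
        Q2 r * ten d r n * Q2 r \<le> t2 *\<^sub>R one (d ^ n) \<and> Q2 r * ten d r n * Q2 r \<le> ten d r n \<and>
        tr ((one (d ^ n) - Q2 r) * ten d r n) \<le> t2 powr (- s2) * (\<Prod>l<n. \<Sum>j<d. eigs d (r l) j powr (1 + s2))"
      by (rule upper_projections[OF d t(3) s2]) blast
    obtain Q0 where Q0: "\<And>r. (\<And>l. l < n \<Longrightarrow> state d (r l)) \<Longrightarrow> proj (d ^ n) (Q0 r) \<and>
        Q0 r * ten d r n * Q0 r \<le> t0 *\<^sub>R one (d ^ n) \<and> Q0 r * ten d r n * Q0 r \<le> ten d r n \<and>
        tr ((one (d ^ n) - Q0 r) * ten d r n) \<le> t0 powr (- s0) * (\<Prod>l<n. \<Sum>j<d. eigs d (r l) j powr (1 + s0))"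
      by (rule upper_projections[OF d t(4) s0]) blast
    define P12 where "P12 u v = Q12 (\<lambda>i. \<rho> (u i) (v i))" for u v
    define P1 where "P1 u = Q1 (\<lambda>i. \<rho>1 (u i))" for u
    define P2 where "P2 v = Q2 (\<lambda>i. \<rho>2 (v i))" for v
    define P0 where "P0 = Q0 (\<lambda>i. \<rho>0)"
    have st12: "state d (\<rho> (u l) (v l))" if "u \<in> Xn n" "v \<in> Yn n" "l < n" for u v l
      using that by (intro \<rho>) auto
    have st1: "state d (\<rho>1 (u l))" if "u \<in> Xn n" "l < n" for u l using that by (intro states) auto
    have st2: "state d (\<rho>2 (v l))" if "v \<in> Yn n" "l < n" for v l using that by (intro states) auto
    have q12: "proj (d ^ n) (P12 u v) \<and> P12 u v \<le> (1 / t12) *\<^sub>R out n u v \<and>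
        tr ((one (d ^ n) - P12 u v) * out n u v) \<le> t12 powr s12 * (\<Prod>i<n. \<Sum>j<d. eigs d (\<rho> (u i) (v i)) j powr (1 - s12))"
      if "u \<in> Xn n" "v \<in> Yn n" for u v
      unfolding P12_def by (rule Q12) (use st12 that in blast)
    have q1: "proj (d ^ n) (P1 u) \<and> P1 u * ten d (\<lambda>i. \<rho>1 (u i)) n * P1 u \<le> t1 *\<^sub>R one (d ^ n) \<and>
        P1 u * ten d (\<lambda>i. \<rho>1 (u i)) n * P1 u \<le> ten d (\<lambda>i. \<rho>1 (u i)) n \<and>
        tr ((one (d ^ n) - P1 u) * ten d (\<lambda>i. \<rho>1 (u i)) n) \<le> t1 powr (- s1) * (\<Prod>i<n. \<Sum>j<d. eigs d (\<rho>1 (u i)) j powr (1 + s1))"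
      if "u \<in> Xn n" for u
      unfolding P1_def by (rule Q1) (use st1 that in blast)
    have q2: "proj (d ^ n) (P2 v) \<and> P2 v * ten d (\<lambda>i. \<rho>2 (v i)) n * P2 v \<le> t2 *\<^sub>R one (d ^ n) \<and>
        P2 v * ten d (\<lambda>i. \<rho>2 (v i)) n * P2 v \<le> ten d (\<lambda>i. \<rho>2 (v i)) n \<and>
        tr ((one (d ^ n) - P2 v) * ten d (\<lambda>i. \<rho>2 (v i)) n) \<le> t2 powr (- s2) * (\<Prod>i<n. \<Sum>j<d. eigs d (\<rho>2 (v i)) j powr (1 + s2))"
      if "v \<in> Yn n" for v
      unfolding P2_def by (rule Q2) (use st2 that in blast)
    have q0: "proj (d ^ n) (P0) \<and> P0 * ten d (\<lambda>i. \<rho>0) n * P0 \<le> t0 *\<^sub>R one (d ^ n) \<and>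
        P0 * ten d (\<lambda>i. \<rho>0) n * P0 \<le> ten d (\<lambda>i. \<rho>0) n \<and>
        tr ((one (d ^ n) - P0) * ten d (\<lambda>i. \<rho>0) n) \<le> t0 powr (- s0) * (\<Prod>i<n. \<Sum>j<d. eigs d (\<rho>0) j powr (1 + s0))"
      
      unfolding P0_def by (rule Q0) (rule states(3))
    interpret Xn: distr "Xn n" "pn n" by (rule distr_PiE[OF X.distr_axioms])
    interpret Yn: distr "Yn n" "qn n" by (rule distr_PiE[OF Y.distr_axioms])
    interpret mac_tests "Xn n" "pn n" "Yn n" "qn n" "d ^ n" "out n" P0 P1 P2 P12 "1 / t12" t0 t1 t2
    proof
      fix u v assume u: "u \<in> Xn n" and v: "v \<in> Yn n"
      show "0 \<le> out n u v \<and> supp (d ^ n) (out n u v) \<and> tr (out n u v) = 1"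
        using state_ten[OF d st12[OF u v]] by (simp add: state_def)
    qed (unfold average_out, use q12 q1 q2 q0 t in auto)
    have miss: "(\<Sum>u\<in>Xn n. pn n u * (\<Sum>v\<in>Yn n. qn n v * miss u v)) \<le> G0 ^ n + G1 ^ n + G2 ^ n + G12 ^ n"
    proof -
      have "(\<Sum>u\<in>Xn n. pn n u * (\<Sum>v\<in>Yn n. qn n v * miss u v))
        = (\<Sum>u\<in>Xn n. pn n u * (\<Sum>v\<in>Yn n. qn n v * tr ((one (d ^ n) - P0) * out n u v)))
        + (\<Sum>u\<in>Xn n. pn n u * (\<Sum>v\<in>Yn n. qn n v * tr ((one (d ^ n) - P1 u) * out n u v)))
        + (\<Sum>v\<in>Yn n. qn n v * (\<Sum>u\<in>Xn n. pn n u * tr ((one (d ^ n) - P2 v) * out n u v)))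
        + (\<Sum>u\<in>Xn n. pn n u * (\<Sum>v\<in>Yn n. qn n v * tr ((one (d ^ n) - P12 u v) * out n u v)))"
      proof -
        \<comment> \<open>For \<open>P2\<close> the sum over u must be innermost: averaging the
          output over u yields the state that this projection was cut from.\<close>
        have sw: "(\<Sum>v\<in>Yn n. qn n v * (\<Sum>u\<in>Xn n. pn n u * tr ((one (d ^ n) - P2 v) * out n u v)))
          = (\<Sum>u\<in>Xn n. pn n u * (\<Sum>v\<in>Yn n. qn n v * tr ((one (d ^ n) - P2 v) * out n u v)))"
          unfolding sum_distrib_left by (subst sum.swap) (simp add: mult.left_commute)
        show ?thesis unfolding sw miss_def by (simp only: distrib_left sum.distrib)
      qed
      also have "(\<Sum>u\<in>Xn n. pn n u * (\<Sum>v\<in>Yn n. qn n v * tr ((one (d ^ n) - P0) * out n u v)))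
        = tr ((one (d ^ n) - P0) * ten d (\<lambda>i. \<rho>0) n)"
        unfolding average_out(3)[symmetric] average_out(1)[symmetric] by (simp add: sum_distrib_left)
      also have "\<dots> \<le> G0 ^ n"
      proof -
        have "tr ((one (d ^ n) - P0) * ten d (\<lambda>i. \<rho>0) n) \<le> t0 powr (- s0) * (\<Prod>l<n. \<Sum>j<d. eigs d \<rho>0 j powr (1 + s0))"
          using q0 by blast
        also have "\<dots> = G0 ^ n" unfolding t0_def powr_scale G0_def by (simp add: power_mult_distrib)
        finally show ?thesis .
      qed
      also have "(\<Sum>u\<in>Xn n. pn n u * (\<Sum>v\<in>Yn n. qn n v * tr ((one (d ^ n) - P1 u) * out n u v))) \<le> G1 ^ n"
      proof -
        have "(\<Sum>u\<in>Xn n. pn n u * (\<Sum>v\<in>Yn n. qn n v * tr ((one (d ^ n) - P1 u) * out n u v)))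
          = (\<Sum>u\<in>Xn n. pn n u * tr ((one (d ^ n) - P1 u) * ten d (\<lambda>i. \<rho>1 (u i)) n))"
          unfolding average_out(1)[symmetric] by (simp add: sum_distrib_left)
        also have "\<dots> \<le> (\<Sum>u\<in>Xn n. pn n u * (t1 powr (- s1) * (\<Prod>l<n. \<Sum>j<d. eigs d (\<rho>1 (u l)) j powr (1 + s1))))"
          by (intro sum_mono mult_left_mono Xn.nonneg) (use q1 in blast)
        also have "\<dots> = t1 powr (- s1) * (\<Sum>u\<in>Xn n. pn n u * (\<Prod>l<n. \<Sum>j<d. eigs d (\<rho>1 (u l)) j powr (1 + s1)))"
          by (simp only: sum_distrib_left mult.left_commute)
        also have "\<dots> = G1 ^ n"
          unfolding t1_def powr_scale G1_def power_mult_distrib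
          by (subst sum_PiE_prod[OF X.fin, where n = n and p = p and \<phi> = "\<lambda>x. \<Sum>j<d. eigs d (\<rho>1 x) j powr (1 + s1)"]) simp
        finally show ?thesis .
      qed
      also have "(\<Sum>v\<in>Yn n. qn n v * (\<Sum>u\<in>Xn n. pn n u * tr ((one (d ^ n) - P2 v) * out n u v))) \<le> G2 ^ n"
      proof -
        have "(\<Sum>v\<in>Yn n. qn n v * (\<Sum>u\<in>Xn n. pn n u * tr ((one (d ^ n) - P2 v) * out n u v)))
          = (\<Sum>v\<in>Yn n. qn n v * tr ((one (d ^ n) - P2 v) * ten d (\<lambda>i. \<rho>2 (v i)) n))"
          unfolding average_out(2)[symmetric] by (simp add: sum_distrib_left)
        also have "\<dots> \<le> (\<Sum>v\<in>Yn n. qn n v * (t2 powr (- s2) * (\<Prod>l<n. \<Sum>j<d. eigs d (\<rho>2 (v l)) j powr (1 + s2))))"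
          by (intro sum_mono mult_left_mono Yn.nonneg) (use q2 in blast)
        also have "\<dots> = t2 powr (- s2) * (\<Sum>v\<in>Yn n. qn n v * (\<Prod>l<n. \<Sum>j<d. eigs d (\<rho>2 (v l)) j powr (1 + s2)))"
          by (simp only: sum_distrib_left mult.left_commute)
        also have "\<dots> = G2 ^ n"
          unfolding t2_def powr_scale G2_def power_mult_distrib
          by (subst sum_PiE_prod[OF Y.fin, where n = n and p = q and \<phi> = "\<lambda>y. \<Sum>j<d. eigs d (\<rho>2 y) j powr (1 + s2)"]) simp
        finally show ?thesis .
      qed
      also have "(\<Sum>u\<in>Xn n. pn n u * (\<Sum>v\<in>Yn n. qn n v * tr ((one (d ^ n) - P12 u v) * out n u v))) \<le> G12 ^ n"
      proof -
        have "(\<Sum>u\<in>Xn n. pn n u * (\<Sum>v\<in>Yn n. qn n v * tr ((one (d ^ n) - P12 u v) * out n u v)))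
          \<le> (\<Sum>u\<in>Xn n. pn n u * (\<Sum>v\<in>Yn n. qn n v * (t12 powr s12 * (\<Prod>l<n. \<Sum>j<d. eigs d (\<rho> (u l) (v l)) j powr (1 - s12)))))"
          by (intro sum_mono mult_left_mono Xn.nonneg Yn.nonneg) (use q12 in blast)
        also have "\<dots> = t12 powr s12 * (\<Sum>u\<in>Xn n. pn n u * (\<Sum>v\<in>Yn n. qn n v * (\<Prod>l<n. \<Sum>j<d. eigs d (\<rho> (u l) (v l)) j powr (1 - s12))))"
          by (simp only: sum_distrib_left mult.left_commute)
        also have "\<dots> = G12 ^ n"
          unfolding t12_def powr_scale G12_def power_mult_distrib
          by (subst sum_PiE_prod2[OF X.fin Y.fin, where n = n and p = p and q = q and \<phi> = "\<lambda>x y. \<Sum>j<d. eigs d (\<rho> x y) j powr (1 - s12)"]) simp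
        finally show ?thesis .
      qed
      finally show ?thesis by simp
    qed
    have hn: "h ^ n = 2 powr (real n * (- \<delta> / 2))"
      by (simp add: h_def powr_powr mult.commute flip: powr_realpow)
    have inv: "1 / t12 = 2 powr (real n * (H12 + \<gamma>))" by (simp add: t12_def powr_minus_divide)
    \<comment> \<open>In the exponent per letter, \<open>R1 + H12 - H2\<close> is at most 0, so
      \<open>- \<delta>\<close> and the two slacks \<open>\<gamma>\<close> leave at most
      \<open>- \<delta> / 2\<close>.\<close>
    have e1: "real (M1 - 1) * (1 / t12 * t2) \<le> h ^ n"
    proof -
      have "real (M1 - 1) * (1 / t12 * t2) \<le> 2 powr (real n * (R1 - \<delta>)) * (1 / t12 * t2)"
        using t by (intro mult_right_mono M1) auto
      also have "\<dots> = 2 powr (real n * (R1 - \<delta> + (H12 + \<gamma>) - (H2 - \<gamma>)))"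
        unfolding inv t2_def by (simp add: powr_add[symmetric] algebra_simps)
      also have "\<dots> \<le> h ^ n"
        unfolding hn using R by (intro powr_mono mult_left_mono) (auto simp: \<gamma>_def)
      finally show ?thesis .
    qed
    have e2: "real (M2 - 1) * (1 / t12 * t1) \<le> h ^ n"
    proof -
      have "real (M2 - 1) * (1 / t12 * t1) \<le> 2 powr (real n * (R2 - \<delta>)) * (1 / t12 * t1)"
        using t by (intro mult_right_mono M2) auto
      also have "\<dots> = 2 powr (real n * (R2 - \<delta> + (H12 + \<gamma>) - (H1 - \<gamma>)))"
        unfolding inv t1_def by (simp add: powr_add[symmetric] algebra_simps)
      also have "\<dots> \<le> h ^ n"
        unfolding hn using R by (intro powr_mono mult_left_mono) (auto simp: \<gamma>_def)
      finally show ?thesis .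
    qed
    have e0: "real (M1 - 1) * real (M2 - 1) * (1 / t12 * t0) \<le> h ^ n"
    proof -
      have "real (M1 - 1) * real (M2 - 1) * (1 / t12 * t0)
        \<le> 2 powr (real n * (R1 - \<delta>)) * 2 powr (real n * (R2 - \<delta>)) * (1 / t12 * t0)"
        using t by (intro mult_right_mono mult_mono M1 M2) auto
      also have "\<dots> = 2 powr (real n * (R1 - \<delta> + (R2 - \<delta>) + (H12 + \<gamma>) - (H0 - \<gamma>)))"
        unfolding inv t0_def by (simp add: powr_add[symmetric] algebra_simps)
      \<comment> \<open>Both rates lose \<open>\<delta>\<close>, so the exponent per letter is at
        most \<open>- 3 * \<delta> / 2\<close>, more than required.\<close>
      also have "\<dots> \<le> h ^ n"
        unfolding hn using R \<delta> by (intro powr_mono mult_left_mono) (auto simp: \<gamma>_def)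
      finally show ?thesis .
    qed
    \<comment> \<open>The perturbation enters the error with factor 2, so
      \<open>\<epsilon> / 4\<close> uses up the reserved half.\<close>
    have "0 < \<epsilon> / 4" using \<epsilon> by simp
    obtain \<Lambda> where \<Lambda>: "\<And>c e m1 m2. c \<in> {..<M1} \<rightarrow>\<^sub>E Xn n \<Longrightarrow> e \<in> {..<M2} \<rightarrow>\<^sub>E Yn n \<Longrightarrow> m1 < M1 \<Longrightarrow> m2 < M2 \<Longrightarrow>
        0 \<le> \<Lambda> c e m1 m2 \<and> supp (d ^ n) (\<Lambda> c e m1 m2)"
      "\<And>c e. c \<in> {..<M1} \<rightarrow>\<^sub>E Xn n \<Longrightarrow> e \<in> {..<M2} \<rightarrow>\<^sub>E Yn n \<Longrightarrow>
        (\<Sum>(m1,m2)\<in>{..<M1} \<times> {..<M2}. \<Lambda> c e m1 m2) = one (d ^ n)"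
      and err: "pexp {..<M1} (Xn n) (pn n) (\<lambda>c. pexp {..<M2} (Yn n) (qn n) (\<lambda>e. 1 / (real M1 * real M2) *
        (\<Sum>m1<M1. \<Sum>m2<M2. tr ((one (d ^ n) - \<Lambda> c e m1 m2) * out n (c m1) (e m2)))))
        \<le> 48 * (\<Sum>u\<in>Xn n. pn n u * (\<Sum>v\<in>Yn n. qn n v * miss u v))
        + 8 * (real (M1 - 1) * (1 / t12 * t2) + real (M2 - 1) * (1 / t12 * t1) + real (M1 - 1) * real (M2 - 1) * (1 / t12 * t0))
        + 2 * (\<epsilon> / 4)"
      using random_coding[OF M \<open>0 < \<epsilon> / 4\<close>] by blast
    note err
    also have "48 * (\<Sum>u\<in>Xn n. pn n u * (\<Sum>v\<in>Yn n. qn n v * miss u v))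
        + 8 * (real (M1 - 1) * (1 / t12 * t2) + real (M2 - 1) * (1 / t12 * t1) + real (M1 - 1) * real (M2 - 1) * (1 / t12 * t0))
        + 2 * (\<epsilon> / 4) \<le> 48 * (G0 ^ n + G1 ^ n + G2 ^ n + G12 ^ n) + 8 * (h ^ n + h ^ n + h ^ n) + 2 * (\<epsilon> / 4)"
      by (intro add_mono mult_left_mono miss e0 e1 e2) auto
    also have "\<dots> \<le> \<epsilon>" using N[OF n] by simp
    finally show "\<exists>\<Lambda>. (\<forall>c\<in>{..<M1} \<rightarrow>\<^sub>E Xn n. \<forall>e\<in>{..<M2} \<rightarrow>\<^sub>E Yn n.
        (\<forall>m1<M1. \<forall>m2<M2. 0 \<le> \<Lambda> c e m1 m2 \<and> supp (d ^ n) (\<Lambda> c e m1 m2)) \<and>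
        (\<Sum>(m1,m2)\<in>{..<M1} \<times> {..<M2}. \<Lambda> c e m1 m2) = one (d ^ n)) \<and>
      pexp {..<M1} (Xn n) (pn n) (\<lambda>c. pexp {..<M2} (Yn n) (qn n) (\<lambda>e. 1 / (real M1 * real M2) *
        (\<Sum>m1<M1. \<Sum>m2<M2. tr ((one (d ^ n) - \<Lambda> c e m1 m2) * out n (c m1) (e m2))))) \<le> \<epsilon>"
      using \<Lambda> by (intro exI[of _ \<Lambda>] conjI ballI allI impI) auto
  qed
qed

end

section \<open>Matrices as operators\<close>

definition fop_of :: "complex mat \<Rightarrow> fop" where
  "fop_of A = Op (\<lambda>i j. if i < dim_row A \<and> j < dim_col A then A $$ (i,j) else 0)"

definition mat_of :: "nat \<Rightarrow> fop \<Rightarrow> complex mat" where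
  "mat_of n X = mat n n (\<lambda>(i,j). ent X i j)"

lemma ent_fop_of [simp]: "ent (fop_of A) i j = (if i < dim_row A \<and> j < dim_col A then A $$ (i,j) else 0)"
  unfolding fop_of_def by (subst ent_Op[of "dim_row A + dim_col A"]) auto

lemma mat_of_carrier [simp]: "mat_of n X \<in> carrier_mat n n"
  by (simp add: mat_of_def)

lemma supp_fop_of: "A \<in> carrier_mat n n \<Longrightarrow> supp n (fop_of A)"
  by (auto simp: supp_def)

lemma fop_of_mat_of: "supp n X \<Longrightarrow> fop_of (mat_of n X) = X"
  by (rule fop_eqI) (auto simp: mat_of_def supp_def not_le[symmetric])

lemma fop_of_inject: "A \<in> carrier_mat n n \<Longrightarrow> B \<in> carrier_mat n n \<Longrightarrow> fop_of A = fop_of B \<Longrightarrow> A = B"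
proof (rule eq_matI)
  assume c: "A \<in> carrier_mat n n" "B \<in> carrier_mat n n" and e: "fop_of A = fop_of B"
  fix i j assume "i < dim_row B" "j < dim_col B"
  then show "A $$ (i,j) = B $$ (i,j)" using arg_cong[OF e, of "\<lambda>X. ent X i j"] c by auto
qed auto

lemma fop_of_times:
  assumes "A \<in> carrier_mat n n" "B \<in> carrier_mat n n"
  shows "fop_of (A * B) = fop_of A * fop_of B"
proof (rule fop_eqI)
  fix i j
  show "ent (fop_of (A * B)) i j = ent (fop_of A * fop_of B) i j"
    using assms by (simp add: ent_times_left[OF supp_fop_of[OF assms(1)]] scalar_prod_def lessThan_atLeast0)
qed

lemma fop_of_one: "fop_of (1\<^sub>m n) = one n"
  by (rule fop_eqI) auto

lemma fop_of_minus:
  "A \<in> carrier_mat n n \<Longrightarrow> B \<in> carrier_mat n n \<Longrightarrow> fop_of (A - B) = fop_of A - fop_of B"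
  by (rule fop_eqI) auto

lemma fop_of_kron:
  assumes "B \<in> carrier_mat b b" "0 < b"
  shows "fop_of (kron A B) = krf b (fop_of A) (fop_of B)"
  using assms by (intro fop_eqI) (auto simp: kron_def ent_krf div_less_iff_less_mult)

lemma Re_mtrace: "A \<in> carrier_mat n n \<Longrightarrow> Re (mtrace A) = tr (fop_of A)"
  by (simp add: mtrace_def tr_eq[OF supp_fop_of])

lemma tensor_out_carrier:
  assumes "\<And>i. i < n \<Longrightarrow> \<rho> (u i) (v i) \<in> carrier_mat d d"
  shows "tensor_out \<rho> u v n \<in> carrier_mat (d ^ n) (d ^ n)"
  using assms
proof (induction n)
  case (Suc n)
  have "tensor_out \<rho> u v n \<in> carrier_mat (d ^ n) (d ^ n)" "\<rho> (u n) (v n) \<in> carrier_mat d d"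
    using Suc by auto
  then show ?case by (auto simp: kron_def mult.commute)
qed simp

lemma fop_of_tensor_out:
  assumes "\<And>i. i < n \<Longrightarrow> \<rho> (u i) (v i) \<in> carrier_mat d d" "0 < d"
  shows "fop_of (tensor_out \<rho> u v n) = ten d (\<lambda>i. fop_of (\<rho> (u i) (v i))) n"
  using assms by (induction n) (simp_all add: fop_of_one fop_of_kron[where b = d])

text \<open>\<open>psd\<close> only says that the quadratic form is real and nonnegative.
  Hermiticity follows by polarization, from the vectors e_a + e_b and e_a + i e_b; writing them as
  sums of two indicators covers a = b too.\<close>

lemma psd_hermitian:
  assumes "psd n A" "a < n" "b < n"
  shows "A $$ (b,a) = cnj (A $$ (a,b))"
proof -
  define z where "z v = (\<Sum>i<n. \<Sum>j<n. cnj (v i) * A $$ (i,j) * v j)" for v :: "nat \<Rightarrow> complex"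
  have im: "Im (z v) = 0" for v using assms(1) by (auto simp: psd_def z_def Let_def)
  have z: "z (\<lambda>i. (if i = a then x else 0) + (if i = b then y else 0))
    = cnj x * A $$ (a,a) * x + cnj x * A $$ (a,b) * y + cnj y * A $$ (b,a) * x + cnj y * A $$ (b,b) * y" for x y
  proof -
    have "z (\<lambda>i. (if i = a then x else 0) + (if i = b then y else 0))
      = (\<Sum>i<n. \<Sum>j<n. (if i = a then if j = a then cnj x * A $$ (i,j) * x else 0 else 0)
          + (if i = a then if j = b then cnj x * A $$ (i,j) * y else 0 else 0)
          + (if i = b then if j = a then cnj y * A $$ (i,j) * x else 0 else 0)
          + (if i = b then if j = b then cnj y * A $$ (i,j) * y else 0 else 0))"
      unfolding z_def by (intro sum.cong refl) (auto simp: algebra_simps)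
    also have "\<dots> = cnj x * A $$ (a,a) * x + cnj x * A $$ (a,b) * y + cnj y * A $$ (b,a) * x + cnj y * A $$ (b,b) * y"
    proof -
      have s: "(\<Sum>i<n. \<Sum>j<n. if i = k then if j = l then F i j else 0 else 0) = F k l"
        if "k < n" "l < n" for k l and F :: "nat \<Rightarrow> nat \<Rightarrow> complex"
      proof -
        have "(\<Sum>j<n. if i = k then if j = l then F i j else 0 else 0) = (if i = k then F i l else 0)" for i
          using that by simp
        then show ?thesis using that by simp
      qed
      show ?thesis by (simp only: sum.distrib s assms(2,3))
    qed
    finally show ?thesis .
  qed
  have "Im (A $$ (a,a)) = 0" using im[of "\<lambda>i. (if i = a then 1 else 0) + (if i = b then 0 else 0)"] by (simp only: z) simp
  moreover have "Im (A $$ (b,b)) = 0" using im[of "\<lambda>i. (if i = a then 0 else 0) + (if i = b then 1 else 0)"] by (simp only: z) simp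
  moreover note im[of "\<lambda>i. (if i = a then 1 else 0) + (if i = b then 1 else 0)", unfolded z]
    im[of "\<lambda>i. (if i = a then 1 else 0) + (if i = b then \<i> else 0)", unfolded z]
  ultimately show ?thesis by (simp add: complex_eq_iff)
qed

text \<open>The trace of the sandwich by \<open>V\<close> is the sum of the quadratic form over the
  columns of \<open>V\<close>.\<close>

lemma psd_nonneg:
  assumes A: "psd n A" shows "0 \<le> fop_of A"
  unfolding nonneg_fop pos_def herm_def
proof (intro conjI allI)
  have c: "A \<in> carrier_mat n n" using A by (simp add: psd_def)
  show "adj (fop_of A) = fop_of A"
  proof (rule fop_eqI)
    fix i j
    show "ent (adj (fop_of A)) i j = ent (fop_of A) i j"
      using c psd_hermitian[OF A, of j i] by (cases "i < n \<and> j < n") auto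
  qed
  fix V
  obtain m where m: "supp m V" "supp m (fop_of A)" "supp m V" using ex_supp3 by metis
  have sA: "supp n (fop_of A)" by (rule supp_fop_of[OF c])
  have e: "ent (adj V * (fop_of A * V)) k k = (\<Sum>i<n. \<Sum>j<n. cnj (ent V i k) * A $$ (i,j) * ent V j k)" for k
  proof -
    have "ent (adj V * (fop_of A * V)) k k = (\<Sum>i<m. cnj (ent V i k) * ent (fop_of A * V) i k)"
      using m by (simp add: ent_times_right[of m])
    also have "\<dots> = (\<Sum>i<m + n. cnj (ent V i k) * ent (fop_of A * V) i k)"
      using m(1) by (intro sum.mono_neutral_left) (auto simp: supp_def)
    also have "\<dots> = (\<Sum>i<n. cnj (ent V i k) * ent (fop_of A * V) i k)"
      using c by (intro sum.mono_neutral_right) (auto simp: ent_times_left[OF sA])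
    also have "\<dots> = (\<Sum>i<n. \<Sum>j<n. cnj (ent V i k) * A $$ (i,j) * ent V j k)"
      using c by (simp add: ent_times_left[OF sA] sum_distrib_left mult.assoc)
    finally show ?thesis .
  qed
  have "tr (adj V * fop_of A * V) = (\<Sum>k<m. Re (ent (adj V * (fop_of A * V)) k k))"
    using m by (simp add: tr_eq[of m] mult.assoc)
  also have "\<dots> = (\<Sum>k<m. Re (\<Sum>i<n. \<Sum>j<n. cnj (ent V i k) * A $$ (i,j) * ent V j k))"
    by (simp only: e)
  also have "\<dots> \<ge> 0"
    using A by (intro sum_nonneg) (auto simp: psd_def Let_def)
  finally show "0 \<le> tr (adj V * fop_of A * V)" .
qed

text \<open>Conversely, the vector becomes column 0 of an operator, and the trace is the value of
  the form. Column 0 exists only if n is positive, hence the case split.\<close>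

lemma nonneg_psd:
  assumes X: "0 \<le> X" "supp n X" shows "psd n (mat_of n X)"
  unfolding psd_def Let_def
proof (intro conjI allI)
  fix v :: "nat \<Rightarrow> complex"
  let ?z = "\<Sum>i<n. \<Sum>j<n. cnj (v i) * mat_of n X $$ (i,j) * v j"
  define V where "V = Op (\<lambda>i j. if i < n \<and> j < n \<and> j = 0 then v i else 0)"
  have V: "ent V i j = (if i < n \<and> j < n \<and> j = 0 then v i else 0)" for i j
    unfolding V_def by (subst ent_Op[of n]) auto
  have sV: "supp n V" by (auto simp: supp_def V)
  have z: "?z = (\<Sum>i<n. \<Sum>j<n. cnj (v i) * ent X i j * v j)"
    by (intro sum.cong refl) (auto simp: mat_of_def)
  have h: "cnj (ent X i j) = ent X j i" for i j
    using arg_cong[OF nonneg_herm[OF X(1)], of "\<lambda>Y. ent Y j i"] by simp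
  have "cnj ?z = ?z"
    unfolding z cnj_sum by (subst sum.swap) (simp add: h mult_ac)
  then have "?z \<in> \<real>" by (simp only: Reals_cnj_iff)
  then show "Im ?z = 0" by (simp only: complex_is_Real_iff)
  show "0 \<le> Re ?z"
  proof (cases "n = 0")
    case False
    have "ent (adj V * (X * V)) i i = (if i = 0 then ?z else 0)" for i
      unfolding z using sV X(2) False
      by (simp add: ent_times_left[of n] V sum_distrib_left mult.assoc)
    then have "tr (adj V * X * V) = Re ?z"
      using sV X(2) False by (subst tr_eq[of n]) (simp_all add: mult.assoc)
    moreover have "0 \<le> tr (adj V * X * V)" using X(1) by (auto simp: nonneg_fop pos_def)
    ultimately show ?thesis by simp
  qed simp
qed simp

lemma density_state: "density d A \<Longrightarrow> state d (fop_of A)"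
proof -
  assume A: "density d A"
  then have c: "A \<in> carrier_mat d d" and p: "psd d A" and t: "mtrace A = 1"
    by (auto simp: density_def psd_def)
  show ?thesis
    using psd_nonneg[OF p] supp_fop_of[OF c] Re_mtrace[OF c] t by (simp add: state_def)
qed

section \<open>Entropies of the classical-quantum state\<close>

text \<open>\<open>proots\<close> recovers the multiset from the product of linear factors, so the
  definite description has a unique solution.\<close>

lemma eigvals_eq: "char_poly A = (\<Prod>a\<in>#m. [:- a, 1:]) \<Longrightarrow> eigvals A = m"
proof -
  have roots: "proots (\<Prod>a\<in>#m. [:- a, 1:]) = m" for m :: "complex multiset"
  proof (induction m)
    case (add x m)
    have "(\<Prod>a\<in>#m. [:- a, 1:]) \<noteq> 0" by (induction m) (auto simp del: mult_pCons_left)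
    then show ?case using add by (simp add: proots_mult del: mult_pCons_left)
  qed simp
  assume m: "char_poly A = (\<Prod>a\<in>#m. [:- a, 1:])"
  show ?thesis unfolding eigvals_def
  proof (rule the_equality)
    show "char_poly A = (\<Prod>a\<in>#m. [:- a, 1:])" by (fact m)
    fix m' assume "char_poly A = (\<Prod>a\<in>#m'. [:- a, 1:])"
    then show "m' = m" using m roots by metis
  qed
qed

text \<open>Similar matrices share their characteristic polynomial, and that of a diagonal matrix
  lists its diagonal. This connects the definition by roots with any unitary
  diagonalization.\<close>

lemma vN_entropy_diagonalizes:
  assumes M: "M \<in> carrier_mat n n" and D: "diagonalizes n U (fop_of M) f"
  shows "vN_entropy M = - (\<Sum>i<n. eta (f i))"
proof -
  have U: "supp n U" "adj U * U = one n" "U * adj U = one n" "fop_of M = U * dg n f * adj U"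
    using D by (auto simp: diagonalizes_def)
  let ?U = "mat_of n U" and ?V = "mat_of n (adj U)" and ?D = "mat_of n (dg n f)"
  have "similar_mat M ?D"
  proof (rule similar_matI[of _ _ ?U ?V n])
    show "?U * ?V = 1\<^sub>m n"
      by (rule fop_of_inject[of _ n]) (auto intro!: mult_carrier_mat[of _ n n _ n] simp: fop_of_times[of _ n] fop_of_mat_of fop_of_one U(1-3))
    show "?V * ?U = 1\<^sub>m n"
      by (rule fop_of_inject[of _ n]) (auto intro!: mult_carrier_mat[of _ n n _ n] simp: fop_of_times[of _ n] fop_of_mat_of fop_of_one U(1-3))
    show "M = ?U * ?D * ?V"
      by (rule fop_of_inject[of _ n]) (use M U in \<open>auto intro!: mult_carrier_mat[of _ n n _ n]
        simp: fop_of_times[of _ n] mult_carrier_mat[of _ n n _ n] fop_of_mat_of\<close>)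
  qed (use M in auto)
  then have "char_poly M = char_poly ?D" by (rule char_poly_similar)
  also have "\<dots> = (\<Prod>a\<leftarrow>diag_mat ?D. [:- a, 1:])"
    by (rule char_poly_upper_triangular[of _ n]) (auto simp: upper_triangular_def mat_of_def)
  also have "diag_mat ?D = map (\<lambda>i. complex_of_real (f i)) [0..<n]"
    by (auto simp: diag_mat_def mat_of_def)
  finally have "char_poly M = (\<Prod>a\<in>#mset (map (\<lambda>i. complex_of_real (f i)) [0..<n]). [:- a, 1:])"
    by (simp only: mset_map[symmetric] prod_mset_prod_list map_map o_def)
  from eigvals_eq[OF this] have "eigvals M = mset (map (\<lambda>i. complex_of_real (f i)) [0..<n])" .
  then show ?thesis
    by (simp add: vN_entropy_def image_mset.compositionality o_def sum_unfold_sum_mset lessThan_atLeast0)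
qed

lemma vN_entropy_fop:
  assumes "M \<in> carrier_mat n n" "adj (fop_of M) = fop_of M"
  shows "vN_entropy M = entropy n (fop_of M)"
  using eigs_diagonalizes[OF supp_fop_of[OF assms(1)] assms(2)] vN_entropy_diagonalizes[OF assms(1)]
  unfolding entropy_def by metis

lemma vN_entropy_diagonal:
  assumes "M \<in> carrier_mat n n" "\<And>i j. i < n \<Longrightarrow> j < n \<Longrightarrow> M $$ (i,j) = (if i = j then of_real (f i) else 0)"
  shows "vN_entropy M = - (\<Sum>i<n. eta (f i))"
proof (rule vN_entropy_diagonalizes[OF assms(1), of "one n"])
  have "fop_of M = dg n f" by (rule fop_eqI) (use assms in auto)
  then show "diagonalizes n (one n) (fop_of M) f" by (simp add: diagonalizes_def)
qed

section \<open>Block-diagonal operators and the chain rule for entropy\<close>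

definition block :: "nat \<Rightarrow> nat \<Rightarrow> (nat \<Rightarrow> fop) \<Rightarrow> fop" where
  "block K d U = Op (\<lambda>i j. if i div d = j div d \<and> i < K * d \<and> j < K * d then ent (U (i div d)) (i mod d) (j mod d) else 0)"

lemma ent_block: "ent (block K d U) i j =
    (if i div d = j div d \<and> i < K * d \<and> j < K * d then ent (U (i div d)) (i mod d) (j mod d) else 0)"
  unfolding block_def by (subst ent_Op[of "K * d"]) auto

lemma supp_block: "supp (K * d) (block K d U)"
  by (auto simp: supp_def ent_block)

lemma adj_block: "adj (block K d U) = block K d (\<lambda>x. adj (U x))"
  by (rule fop_eqI) (auto simp: ent_block)

lemma block_cong: "(\<And>x. x < K \<Longrightarrow> U x = W x) \<Longrightarrow> block K d U = block K d W"
  by (rule fop_eqI) (auto simp: ent_block less_mult_imp_div_less)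

lemma block_dg:
  assumes "0 < d" shows "block K d (\<lambda>x. dg d (f x)) = dg (K * d) (\<lambda>i. f (i div d) (i mod d))"
proof (rule fop_eqI)
  fix i j
  have "i = j \<longleftrightarrow> i div d = j div d \<and> i mod d = j mod d" by (metis div_mult_mod_eq)
  then show "ent (block K d (\<lambda>x. dg d (f x))) i j = ent (dg (K * d) (\<lambda>i. f (i div d) (i mod d))) i j"
    using assms by (auto simp: ent_block)
qed

lemma block_times:
  assumes d: "0 < d" and U: "\<And>x. x < K \<Longrightarrow> supp d (U x)"
  shows "block K d U * block K d W = block K d (\<lambda>x. U x * W x)"
proof (rule fop_eqI)
  fix i j
  let ?F = "\<lambda>k l. if i < K * d \<and> j < K * d \<and> i div d = k \<and> j div d = k
    then ent (U k) (i mod d) l * ent (W k) l (j mod d) else 0"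
  have "ent (block K d U * block K d W) i j = (\<Sum>k<K * d. ?F (k div d) (k mod d))"
    unfolding ent_times_left[OF supp_block] by (intro sum.cong) (auto simp: ent_block)
  also have "\<dots> = (\<Sum>k<K. \<Sum>l<d. ?F k l)" by (rule sum_div_mod[OF d])
  also have "\<dots> = (\<Sum>k<K. if k = i div d then (\<Sum>l<d. ?F k l) else 0)"
    by (intro sum.cong) auto
  also have "\<dots> = ent (block K d (\<lambda>x. U x * W x)) i j"
    using U[of "i div d"] by (auto simp: ent_block ent_times_left less_mult_imp_div_less)
  finally show "ent (block K d U * block K d W) i j = ent (block K d (\<lambda>x. U x * W x)) i j" .
qed

lemma eta_mult: "0 \<le> x \<Longrightarrow> 0 \<le> y \<Longrightarrow> eta (x * y) = y * eta x + x * eta y"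
  by (auto simp: eta_def mult_le_0_iff log_mult algebra_simps)

text \<open>The chain rule H(XB) = H(X) + H(B|X) for a classical X. Diagonalizing every block
  diagonalizes the whole, with eigenvalues \<open>c x\<close> times those of the block, and
  \<open>eta_mult\<close> separates the two factors.\<close>

lemma vN_entropy_block:
  assumes M: "M \<in> carrier_mat (K * d) (K * d)" and d: "0 < d"
    and \<tau>: "\<And>x. x < K \<Longrightarrow> state d (\<tau> x)" and c: "\<And>x. x < K \<Longrightarrow> 0 \<le> c x"
    and entries: "\<And>i j. i < K * d \<Longrightarrow> j < K * d \<Longrightarrow> M $$ (i,j) =
      (if i div d = j div d then of_real (c (i div d)) * ent (\<tau> (i div d)) (i mod d) (j mod d) else 0)"
  shows "vN_entropy M = (\<Sum>x<K. - eta (c x) + c x * entropy d (\<tau> x))"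
proof -
  have "\<forall>x. \<exists>U. x < K \<longrightarrow> diagonalizes d U (\<tau> x) (eigs d (\<tau> x))"
    using \<tau> state_eigs by metis
  then obtain U where U: "\<And>x. x < K \<Longrightarrow> diagonalizes d (U x) (\<tau> x) (eigs d (\<tau> x))" by metis
  then have u: "supp d (U x)" "adj (U x) * U x = one d" "U x * adj (U x) = one d"
    "\<tau> x = U x * dg d (eigs d (\<tau> x)) * adj (U x)" if "x < K" for x
    using that by (auto simp: diagonalizes_def)
  let ?V = "block K d U" and ?f = "\<lambda>i. c (i div d) * eigs d (\<tau> (i div d)) (i mod d)"
  have one: "block K d (\<lambda>_. one d) = one (K * d)" using block_dg[OF d, of K "\<lambda>_ _. 1"] by simp
  have "fop_of M = block K d (\<lambda>x. c x *\<^sub>R \<tau> x)"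
    by (rule fop_eqI) (use M entries in \<open>auto simp: ent_block\<close>)
  also have "\<dots> = block K d (\<lambda>x. U x * dg d (\<lambda>j. c x * eigs d (\<tau> x) j) * adj (U x))"
    by (rule block_cong, subst u(4)) (auto simp: dg_scaleR[symmetric])
  also have "\<dots> = ?V * dg (K * d) ?f * adj ?V"
    unfolding adj_block block_dg[OF d, of K "\<lambda>x j. c x * eigs d (\<tau> x) j", symmetric]
    using u(1) by (simp add: block_times[OF d])
  finally have "diagonalizes (K * d) ?V (fop_of M) ?f"
    unfolding diagonalizes_def adj_block
    using u(1) u(2,3) by (auto simp: supp_block block_times[OF d] one[symmetric] intro!: block_cong)
  from vN_entropy_diagonalizes[OF M this]
  have "vN_entropy M = - (\<Sum>i<K * d. eta (?f i))" .
  also have "(\<Sum>i<K * d. eta (?f i)) = (\<Sum>x<K. \<Sum>j<d. eta (c x * eigs d (\<tau> x) j))"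
    by (rule sum_div_mod[OF d, of "\<lambda>x j. eta (c x * eigs d (\<tau> x) j)"])
  also have "\<dots> = (\<Sum>x<K. eta (c x) - c x * entropy d (\<tau> x))"
  proof (intro sum.cong refl)
    fix x assume "x \<in> {..<K}"
    then have x: "x < K" by simp
    have "(\<Sum>j<d. eta (c x * eigs d (\<tau> x) j)) = (\<Sum>j<d. eigs d (\<tau> x) j * eta (c x) + c x * eta (eigs d (\<tau> x) j))"
      using c[OF x] eigs_nonneg[OF \<tau>[OF x]] by (intro sum.cong refl eta_mult) auto
    also have "\<dots> = eta (c x) - c x * entropy d (\<tau> x)"
      using sum_eigs[OF \<tau>[OF x]]
      by (simp add: sum.distrib sum_distrib_right[symmetric] sum_distrib_left[symmetric] entropy_def)
    finally show "(\<Sum>j<d. eta (c x * eigs d (\<tau> x) j)) = eta (c x) - c x * entropy d (\<tau> x)" .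
  qed
  finally show ?thesis by (simp add: sum_negf[symmetric] algebra_simps)
qed

section \<open>Marginal entropies of the classical-quantum state\<close>

locale matrix_mac =
  fixes k1 k2 d :: nat and p1 p2 :: "nat \<Rightarrow> real" and \<rho> :: "nat \<Rightarrow> nat \<Rightarrow> complex mat"
  assumes d1: "d \<ge> 1"
    and dens: "\<And>x1 x2. x1 < k1 \<Longrightarrow> x2 < k2 \<Longrightarrow> density d (\<rho> x1 x2)"
    and p1: "\<And>x. x < k1 \<Longrightarrow> p1 x \<ge> 0" "(\<Sum>x<k1. p1 x) = 1"
    and p2: "\<And>x. x < k2 \<Longrightarrow> p2 x \<ge> 0" "(\<Sum>x<k2. p2 x) = 1"
begin

sublocale cq_mac "{..<k1}" p1 "{..<k2}" p2 d "\<lambda>x y. fop_of (\<rho> x y)"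
  by unfold_locales (use d1 p1 p2 dens density_state in auto)

lemma k2_pos: "0 < k2" using p2(2) by (cases k2) auto

lemma carrier_\<rho>: "x < k1 \<Longrightarrow> y < k2 \<Longrightarrow> \<rho> x y \<in> carrier_mat d d"
  using dens by (auto simp: density_def psd_def)

lemma dim_\<rho>: "x < k1 \<Longrightarrow> y < k2 \<Longrightarrow> dim_row (\<rho> x y) = d" "x < k1 \<Longrightarrow> y < k2 \<Longrightarrow> dim_col (\<rho> x y) = d"
  using carrier_\<rho> by auto

lemma trace_\<rho>: "x < k1 \<Longrightarrow> y < k2 \<Longrightarrow> (\<Sum>k<d. \<rho> x y $$ (k,k)) = 1"
  using dens[of x y] dim_\<rho>[of x y] by (auto simp: density_def mtrace_def)

lemma index_less: "i < K \<Longrightarrow> k < (b :: nat) \<Longrightarrow> i * b + k < K * b"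
proof -
  assume "i < K" "k < b"
  then have "i * b + k < Suc i * b" by simp
  also have "\<dots> \<le> K * b" using \<open>i < K\<close> by (intro mult_le_mono1) simp
  finally show ?thesis .
qed

lemma pair_index: "x < k1 * k2 \<Longrightarrow> x div k2 < k1" "x mod k2 < k2"
  using k2_pos by (auto simp: less_mult_imp_div_less)

definition cq :: "complex mat" where "cq = cq_state k1 k2 d p1 p2 \<rho>"
text \<open>An input pair is encoded as \<open>x1 * k2 + x2\<close>, the order used by
  \<open>kron\<close>. In this indexing the state is block diagonal, with weights \<open>w\<close>
  and blocks \<open>\<sigma>\<close>.\<close>

definition w :: "nat \<Rightarrow> real" where "w x = p1 (x div k2) * p2 (x mod k2)"
definition \<sigma> :: "nat \<Rightarrow> complex mat" where "\<sigma> x = \<rho> (x div k2) (x mod k2)"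

lemma w_pair: "y < k2 \<Longrightarrow> w (x * k2 + y) = p1 x * p2 y" "y < k2 \<Longrightarrow> \<sigma> (x * k2 + y) = \<rho> x y"
  by (simp_all add: w_def \<sigma>_def)

lemma w_nonneg: "x < k1 * k2 \<Longrightarrow> 0 \<le> w x"
  using pair_index p1 p2 by (simp add: w_def)

text \<open>Each \<open>ketbra\<close> is nonzero at one diagonal place only, so of the whole sum
  just the input pair encoded by the block index contributes.\<close>

lemma cq_entry:
  assumes "i < k1 * k2 * d" "j < k1 * k2 * d"
  shows "cq $$ (i,j) = (if i div d = j div d then of_real (w (i div d)) * \<sigma> (i div d) $$ (i mod d, j mod d) else 0)"
proof -
  define a b where "a = i div d" and "b = j div d"
  have ab: "a < k1 * k2" "b < k1 * k2" using assms by (simp_all add: a_def b_def less_mult_imp_div_less)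
  note pa = pair_index[of a] pair_index[of b]
  have "cq $$ (i,j) = (\<Sum>s\<in>{..<k1} \<times> {..<k2}. (case s of (x1,x2) \<Rightarrow> complex_of_real (p1 x1 * p2 x2) \<cdot>\<^sub>m
           kron (kron (ketbra k1 x1) (ketbra k2 x2)) (\<rho> x1 x2)) $$ (i,j))"
    using assms by (simp add: cq_def cq_state_def msum_def)
  also have "\<dots> = (\<Sum>s\<in>{..<k1} \<times> {..<k2}. if s = (a div k2, a mod k2)
      then (if a = b then of_real (w a) * \<sigma> a $$ (i mod d, j mod d) else 0) else 0)"
  proof (rule sum.cong[OF refl])
    fix s assume "s \<in> {..<k1} \<times> {..<k2}"
    then obtain x1 x2 where s: "s = (x1, x2)" and x: "x1 < k1" "x2 < k2" by auto
    have eq: "a = b \<longleftrightarrow> a div k2 = b div k2 \<and> a mod k2 = b mod k2" by (metis div_mult_mod_eq)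
    have kb: "dim_row (ketbra k x) = k" "dim_col (ketbra k x) = k" for k x by (simp_all add: ketbra_def)
    have "(complex_of_real (p1 x1 * p2 x2) \<cdot>\<^sub>m kron (kron (ketbra k1 x1) (ketbra k2 x2)) (\<rho> x1 x2)) $$ (i,j)
      = complex_of_real (p1 x1 * p2 x2) * (ketbra k1 x1 $$ (a div k2, b div k2) * ketbra k2 x2 $$ (a mod k2, b mod k2)
          * \<rho> x1 x2 $$ (i mod d, j mod d))"
      using x assms ab by (simp add: kron_def kb dim_\<rho> a_def b_def)
    moreover have "ketbra k1 x1 $$ (a div k2, b div k2) * ketbra k2 x2 $$ (a mod k2, b mod k2)
        = (if s = (a div k2, a mod k2) then if a = b then 1 else 0 else 0)"
      using pa ab unfolding eq by (simp add: s ketbra_def)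
    ultimately show "(case s of (x1,x2) \<Rightarrow> complex_of_real (p1 x1 * p2 x2) \<cdot>\<^sub>m
           kron (kron (ketbra k1 x1) (ketbra k2 x2)) (\<rho> x1 x2)) $$ (i,j)
      = (if s = (a div k2, a mod k2)
          then (if a = b then of_real (w a) * \<sigma> a $$ (i mod d, j mod d) else 0) else 0)"
      by (simp add: s w_def \<sigma>_def)
  qed
  also have "\<dots> = (if a = b then of_real (w a) * \<sigma> a $$ (i mod d, j mod d) else 0)"
    using pa ab by (simp add: sum.delta)
  finally show ?thesis by (simp add: a_def b_def)
qed

lemma cq_entry':
  assumes "a < k1 * k2" "b < k1 * k2" "k < d" "l < d"
  shows "cq $$ (a * d + k, b * d + l) = (if a = b then of_real (w a) * \<sigma> a $$ (k, l) else 0)"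
  using assms d by (subst cq_entry) (auto simp: index_less)

lemma pair_less: "x < k1 \<Longrightarrow> y < k2 \<Longrightarrow> x * k2 + y < k1 * k2"
  by (rule index_less)

lemma ent_\<rho>1: "x < k1 \<Longrightarrow> a < d \<Longrightarrow> b < d \<Longrightarrow> ent (\<rho>1 x) a b = (\<Sum>y<k2. of_real (p2 y) * \<rho> x y $$ (a,b))"
  and ent_\<rho>2: "y < k2 \<Longrightarrow> a < d \<Longrightarrow> b < d \<Longrightarrow> ent (\<rho>2 y) a b = (\<Sum>x<k1. of_real (p1 x) * \<rho> x y $$ (a,b))"
  by (simp_all add: \<rho>1_def \<rho>2_def dim_\<rho>)

lemma H_X1X2B: "H_X1X2B k1 k2 d p1 p2 \<rho> = (\<Sum>x<k1 * k2. - eta (w x)) + H12"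
proof -
  have st: "state d (fop_of (\<sigma> x))" if "x < k1 * k2" for x
    unfolding \<sigma>_def by (rule density_state[OF dens]) (use pair_index that in auto)
  have "vN_entropy cq = (\<Sum>x<k1 * k2. - eta (w x) + w x * entropy d (fop_of (\<sigma> x)))"
  proof (rule vN_entropy_block[OF _ d st w_nonneg])
    show "cq \<in> carrier_mat (k1 * k2 * d) (k1 * k2 * d)" by (simp add: cq_def cq_state_def msum_def)
    fix i j assume ij: "i < k1 * k2 * d" "j < k1 * k2 * d"
    have "i div d < k1 * k2" using ij by (simp add: less_mult_imp_div_less)
    then have "dim_row (\<sigma> (i div d)) = d" "dim_col (\<sigma> (i div d)) = d"
      using pair_index[of "i div d"] by (simp_all add: \<sigma>_def dim_\<rho>)
    then have "ent (fop_of (\<sigma> (i div d))) (i mod d) (j mod d) = \<sigma> (i div d) $$ (i mod d, j mod d)"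
      using d by simp
    then show "cq $$ (i,j) = (if i div d = j div d then of_real (w (i div d)) * ent (fop_of (\<sigma> (i div d))) (i mod d) (j mod d) else 0)"
      by (simp only: cq_entry[OF ij])
  qed
  also have "\<dots> = (\<Sum>x<k1 * k2. - eta (w x)) + (\<Sum>x<k1 * k2. w x * entropy d (fop_of (\<sigma> x)))"
    by (rule sum.distrib)
  also have "(\<Sum>x<k1 * k2. w x * entropy d (fop_of (\<sigma> x)))
      = (\<Sum>x<k1. \<Sum>y<k2. (p1 x * p2 y) * entropy d (fop_of (\<rho> x y)))"
    unfolding w_def \<sigma>_def
    by (rule sum_div_mod[OF k2_pos, of "\<lambda>x y. (p1 x * p2 y) * entropy d (fop_of (\<rho> x y))"])
  also have "\<dots> = H12" by (simp add: H12_def sum_distrib_left mult.assoc)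
  finally show ?thesis by (simp add: H_X1X2B_def cq_def)
qed

lemma ptrace_B_entry:
  assumes "i < k1 * k2" "j < k1 * k2"
  shows "ptrace_mid (k1 * k2) d 1 cq $$ (i,j) = (if i = j then of_real (w i) else 0)"
proof -
  have "ptrace_mid (k1 * k2) d 1 cq $$ (i,j) = (\<Sum>k<d. cq $$ (i * d + k, j * d + k))"
    using assms by (simp add: ptrace_mid_def)
  also have "\<dots> = (\<Sum>k<d. if i = j then of_real (w i) * \<sigma> i $$ (k, k) else 0)"
    using assms by (intro sum.cong refl cq_entry') auto
  also have "\<dots> = (if i = j then of_real (w i) else 0)"
    using trace_\<rho>[of "i div k2" "i mod k2"] pair_index(1)[OF assms(1)] pair_index(2)[of i]
    by (cases "i = j") (auto simp: sum_distrib_left[symmetric] \<sigma>_def)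
  finally show ?thesis .
qed

lemma H_X1X2: "H_X1X2 k1 k2 d p1 p2 \<rho> = (\<Sum>x<k1 * k2. - eta (w x))"
  unfolding H_X1X2_def cq_def[symmetric] sum_negf
  by (rule vN_entropy_diagonal) (simp_all add: ptrace_B_entry del: One_nat_def, simp add: ptrace_mid_def)

lemma H_X2: "H_X2 k1 k2 d p1 p2 \<rho> = (\<Sum>y<k2. - eta (p2 y))"
  unfolding H_X2_def cq_def[symmetric] sum_negf
proof (rule vN_entropy_diagonal)
  let ?D = "ptrace_mid (k1 * k2) d 1 cq"
  show "ptrace_mid 1 k1 k2 ?D \<in> carrier_mat k2 k2" by (simp add: ptrace_mid_def)
  fix i j assume ij: "i < k2" "j < k2"
  have "ptrace_mid 1 k1 k2 ?D $$ (i,j) = (\<Sum>k<k1. ?D $$ (k * k2 + i, k * k2 + j))"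
    using ij by (simp add: ptrace_mid_def[of 1] del: One_nat_def)
  also have "\<dots> = (\<Sum>k<k1. if i = j then of_real (p1 k) * of_real (p2 i) else 0)"
    using ij by (intro sum.cong refl) (auto simp: ptrace_B_entry pair_less w_pair simp del: One_nat_def)
  also have "\<dots> = (if i = j then of_real (p2 i) else 0)"
    using p1(2) by (simp add: sum_distrib_right[symmetric] flip: of_real_sum)
  finally show "ptrace_mid 1 k1 k2 ?D $$ (i,j) = (if i = j then of_real (p2 i) else 0)" .
qed

lemma H_X1: "H_X1 k1 k2 d p1 p2 \<rho> = (\<Sum>x<k1. - eta (p1 x))"
  unfolding H_X1_def cq_def[symmetric] sum_negf
proof (rule vN_entropy_diagonal)
  show "ptrace_mid k1 (k2 * d) 1 cq \<in> carrier_mat k1 k1" by (simp add: ptrace_mid_def)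
  fix i j assume ij: "i < k1" "j < k1"
  let ?F = "\<lambda>y l. if i = j then of_real (p1 i) * (of_real (p2 y) * \<rho> i y $$ (l,l)) else 0"
  have "ptrace_mid k1 (k2 * d) 1 cq $$ (i,j) = (\<Sum>k<k2 * d. cq $$ (i * (k2 * d) + k, j * (k2 * d) + k))"
    using ij by (simp add: ptrace_mid_def)
  also have "\<dots> = (\<Sum>k<k2 * d. ?F (k div d) (k mod d))"
  proof (intro sum.cong refl)
    fix k assume "k \<in> {..<k2 * d}"
    then have k: "k div d < k2" "k mod d < d" using d by (simp_all add: less_mult_imp_div_less)
    \<comment> \<open>Tracing out X2 and B together uses one offset \<open>k\<close>, to be read as
      a letter \<open>k div d\<close> and a position \<open>k mod d\<close> in the output
      space.\<close>
    have idx: "i * (k2 * d) + k = (i * k2 + k div d) * d + k mod d" for i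
      by (simp add: algebra_simps)
    show "cq $$ (i * (k2 * d) + k, j * (k2 * d) + k) = ?F (k div d) (k mod d)"
      unfolding idx using ij k by (subst cq_entry') (auto simp: pair_less w_pair)
  qed
  also have "\<dots> = (\<Sum>y<k2. \<Sum>l<d. ?F y l)" by (rule sum_div_mod[OF d])
  also have "\<dots> = (if i = j then of_real (p1 i) else 0)"
    using ij trace_\<rho> p2(2) by (simp add: sum_distrib_left[symmetric] flip: of_real_sum)
  finally show "ptrace_mid k1 (k2 * d) 1 cq $$ (i,j) = (if i = j then of_real (p1 i) else 0)" .
qed

lemma H_X2B: "H_X2B k1 k2 d p1 p2 \<rho> = (\<Sum>y<k2. - eta (p2 y)) + H2"
proof -
  have "vN_entropy (ptrace_mid 1 k1 (k2 * d) cq) = (\<Sum>y<k2. - eta (p2 y) + p2 y * entropy d (\<rho>2 y))"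
  proof (rule vN_entropy_block[OF _ d _ p2(1)])
    show "ptrace_mid 1 k1 (k2 * d) cq \<in> carrier_mat (k2 * d) (k2 * d)" by (simp add: ptrace_mid_def)
    show "state d (\<rho>2 x)" if "x < k2" for x using states(2) that by simp
    fix i j assume ij: "i < k2 * d" "j < k2 * d"
    have b: "i div d < k2" "j div d < k2" "i mod d < d" "j mod d < d"
      using ij d by (simp_all add: less_mult_imp_div_less)
    have idx: "k * (k2 * d) + i = (k * k2 + i div d) * d + i mod d" for i k
      by (simp add: algebra_simps)
    have "ptrace_mid 1 k1 (k2 * d) cq $$ (i,j) = (\<Sum>k<k1. cq $$ (k * (k2 * d) + i, k * (k2 * d) + j))"
      using ij by (simp add: ptrace_mid_def)
    also have "\<dots> = (\<Sum>k<k1. if i div d = j div d then of_real (p2 (i div d)) * (of_real (p1 k) * \<rho> k (i div d) $$ (i mod d, j mod d)) else 0)"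
      unfolding idx using b by (intro sum.cong refl) (auto simp: cq_entry' pair_less w_pair)
    also have "\<dots> = (if i div d = j div d then of_real (p2 (i div d)) * ent (\<rho>2 (i div d)) (i mod d) (j mod d) else 0)"
      using b by (simp add: ent_\<rho>2 sum_distrib_left)
    finally show "ptrace_mid 1 k1 (k2 * d) cq $$ (i,j)
      = (if i div d = j div d then of_real (p2 (i div d)) * ent (\<rho>2 (i div d)) (i mod d) (j mod d) else 0)" .
  qed
  then show ?thesis by (simp only: H_X2B_def H2_def cq_def[symmetric] sum.distrib)
qed

lemma H_X1B: "H_X1B k1 k2 d p1 p2 \<rho> = (\<Sum>x<k1. - eta (p1 x)) + H1"
proof -
  have "vN_entropy (ptrace_mid k1 k2 d cq) = (\<Sum>x<k1. - eta (p1 x) + p1 x * entropy d (\<rho>1 x))"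
  proof (rule vN_entropy_block[OF _ d _ p1(1)])
    show "ptrace_mid k1 k2 d cq \<in> carrier_mat (k1 * d) (k1 * d)" by (simp add: ptrace_mid_def)
    show "state d (\<rho>1 x)" if "x < k1" for x using states(1) that by simp
    fix i j assume ij: "i < k1 * d" "j < k1 * d"
    have b: "i div d < k1" "j div d < k1" "i mod d < d" "j mod d < d"
      using ij d by (simp_all add: less_mult_imp_div_less)
    have idx: "i div d * (k2 * d) + k * d + i mod d = (i div d * k2 + k) * d + i mod d" for i k
      by (simp add: algebra_simps)
    have "ptrace_mid k1 k2 d cq $$ (i,j)
      = (\<Sum>k<k2. cq $$ (i div d * (k2 * d) + k * d + i mod d, j div d * (k2 * d) + k * d + j mod d))"
      using ij by (simp add: ptrace_mid_def)
    also have "\<dots> = (\<Sum>k<k2. if i div d = j div d then of_real (p1 (i div d)) * (of_real (p2 k) * \<rho> (i div d) k $$ (i mod d, j mod d)) else 0)"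
      unfolding idx using b by (intro sum.cong refl) (auto simp: cq_entry' pair_less w_pair)
    also have "\<dots> = (if i div d = j div d then of_real (p1 (i div d)) * ent (\<rho>1 (i div d)) (i mod d) (j mod d) else 0)"
      using b by (simp add: ent_\<rho>1 sum_distrib_left)
    finally show "ptrace_mid k1 k2 d cq $$ (i,j)
      = (if i div d = j div d then of_real (p1 (i div d)) * ent (\<rho>1 (i div d)) (i mod d) (j mod d) else 0)" .
  qed
  then show ?thesis by (simp only: H_X1B_def H1_def cq_def[symmetric] sum.distrib)
qed

lemma H_B: "H_B k1 k2 d p1 p2 \<rho> = H0"
proof -
  let ?M = "ptrace_mid 1 (k1 * k2) d cq"
  have M: "?M \<in> carrier_mat d d" by (simp add: ptrace_mid_def)
  have s0: "supp d \<rho>0" "adj \<rho>0 = \<rho>0" using states(3) nonneg_herm by (auto simp: state_def)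
  have e: "?M $$ (i,j) = ent \<rho>0 i j" if ij: "i < d" "j < d" for i j
  proof -
    have "?M $$ (i,j) = (\<Sum>k<k1 * k2. cq $$ (k * d + i, k * d + j))"
      using ij by (simp add: ptrace_mid_def)
    also have "\<dots> = (\<Sum>k<k1 * k2. of_real (p1 (k div k2) * p2 (k mod k2)) * \<rho> (k div k2) (k mod k2) $$ (i,j))"
      using ij by (intro sum.cong refl) (simp add: cq_entry' w_def \<sigma>_def)
    also have "\<dots> = (\<Sum>x<k1. \<Sum>y<k2. of_real (p1 x * p2 y) * \<rho> x y $$ (i,j))"
      by (rule sum_div_mod[OF k2_pos, of "\<lambda>x y. of_real (p1 x * p2 y) * \<rho> x y $$ (i,j)"])
    also have "\<dots> = ent \<rho>0 i j"
      using ij by (simp add: \<rho>0_def ent_\<rho>1 sum_distrib_left mult.assoc)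
    finally show ?thesis .
  qed
  have "fop_of ?M = \<rho>0"
    using M e s0(1) by (intro fop_eqI) (auto simp: supp_def not_less)
  then show ?thesis
    using vN_entropy_fop[OF M] s0(2) by (simp add: H_B_def H0_def cq_def)
qed

text \<open>All classical entropies cancel, H(X1X2) without being split into H(X1) and H(X2). What
  remains are differences of conditional output entropies.\<close>

lemma mutual_informations:
  "I_X1_B_given_X2 k1 k2 d p1 p2 \<rho> = H2 - H12"
  "I_X2_B_given_X1 k1 k2 d p1 p2 \<rho> = H1 - H12"
  "I_X1X2_B k1 k2 d p1 p2 \<rho> = H0 - H12"
  unfolding I_X1_B_given_X2_def I_X2_B_given_X1_def I_X1X2_B_def
  by (simp_all add: H_X1X2B H_X1X2 H_X2 H_X1 H_X2B H_X1B H_B)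

end

section \<open>Codebooks as matrices of letters\<close>

text \<open>In the theorem a codebook assigns a letter to each pair of message and position, whereas
  \<open>pexp\<close> needs a word for each message. The restrictions keep the result extensional,
  so that currying is a bijection.\<close>

definition curry_code :: "nat \<Rightarrow> nat \<Rightarrow> (nat \<times> nat \<Rightarrow> nat) \<Rightarrow> nat \<Rightarrow> nat \<Rightarrow> nat" where
  "curry_code M n C = (\<lambda>m\<in>{..<M}. \<lambda>i\<in>{..<n}. C (m,i))"

lemma curry_code_apply [simp]: "m < M \<Longrightarrow> i < n \<Longrightarrow> curry_code M n C m i = C (m,i)"
  by (simp add: curry_code_def)

lemma curry_code_PiE: "C \<in> ({..<M} \<times> {..<n}) \<rightarrow>\<^sub>E X \<Longrightarrow> curry_code M n C \<in> {..<M} \<rightarrow>\<^sub>E ({..<n} \<rightarrow>\<^sub>E X)"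
  by (auto simp: curry_code_def)

lemma sum_curry_code:
  "(\<Sum>C\<in>({..<M} \<times> {..<n}) \<rightarrow>\<^sub>E X. (\<Prod>m<M. \<Prod>i<n. p (C (m,i))) * F (curry_code M n C))
    = pexp {..<M} ({..<n} \<rightarrow>\<^sub>E X) (\<lambda>u. \<Prod>i<n. p (u i)) F"
  unfolding pexp_def
proof (rule sum.reindex_bij_witness[of _ "\<lambda>c. \<lambda>(m,i)\<in>{..<M} \<times> {..<n}. c m i" "curry_code M n"])
  fix C assume C: "C \<in> ({..<M} \<times> {..<n}) \<rightarrow>\<^sub>E X"
  show "(\<lambda>(m,i)\<in>{..<M} \<times> {..<n}. curry_code M n C m i) = C"
  proof (rule ext)
    fix x show "(\<lambda>(m,i)\<in>{..<M} \<times> {..<n}. curry_code M n C m i) x = C x"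
      using PiE_arb[OF C, of x] by (cases x) (simp add: restrict_def)
  qed
  show "curry_code M n C \<in> {..<M} \<rightarrow>\<^sub>E ({..<n} \<rightarrow>\<^sub>E X)" using C by (rule curry_code_PiE)
  show "(\<Prod>m<M. \<Prod>i<n. p (curry_code M n C m i)) * F (curry_code M n C)
    = (\<Prod>m<M. \<Prod>i<n. p (C (m,i))) * F (curry_code M n C)" by simp
next
  fix c assume c: "c \<in> {..<M} \<rightarrow>\<^sub>E ({..<n} \<rightarrow>\<^sub>E X)"
  show "(\<lambda>(m,i)\<in>{..<M} \<times> {..<n}. c m i) \<in> ({..<M} \<times> {..<n}) \<rightarrow>\<^sub>E X" using c by auto
  show "curry_code M n (\<lambda>(m,i)\<in>{..<M} \<times> {..<n}. c m i) = c"
  proof (rule ext)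
    fix m
    show "curry_code M n (\<lambda>(m,i)\<in>{..<M} \<times> {..<n}. c m i) m = c m"
    proof (cases "m < M")
      case True
      then have "c m \<in> {..<n} \<rightarrow>\<^sub>E X" using c by auto
      then show ?thesis using True
        using PiE_arb[of "c m" "{..<n}" "\<lambda>_. X"] by (intro ext) (auto simp: curry_code_def restrict_def)
    next
      case False
      then show ?thesis using PiE_arb[OF c, of m] by (simp add: curry_code_def)
    qed
  qed
qed

text \<open>Rounding up adds less than one message, so the number of wrong messages obeys the exact
  bound; and there is at least one message even at a negative exponent.\<close>

lemma real_nat_ceiling_pred: "real (nat \<lceil>2 powr x\<rceil> - 1) \<le> 2 powr x" "0 < nat \<lceil>2 powr x\<rceil>"
proof -
  show pos: "0 < nat \<lceil>2 powr x\<rceil>" by simp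
  then obtain k where k: "nat \<lceil>2 powr x\<rceil> = Suc k" using gr0_implies_Suc by blast
  have "real (nat \<lceil>2 powr x\<rceil>) < 2 powr x + 1"
    using ceiling_correct[of "2 powr x"] by simp
  then show "real (nat \<lceil>2 powr x\<rceil> - 1) \<le> 2 powr x" unfolding k by simp
qed

section \<open>From the operator decoder back to matrices\<close>

context matrix_mac
begin

text \<open>The matrix decoder evaluates the operator decoder at the curried codebooks. The double
  sum over tables of letters thereby becomes the nested expectation over words.\<close>

lemma simultaneous_decoding:
  fixes n M1 M2 :: nat and \<epsilon> :: real
  assumes "\<exists>\<Lambda>. (\<forall>c\<in>{..<M1} \<rightarrow>\<^sub>E Xn n. \<forall>e\<in>{..<M2} \<rightarrow>\<^sub>E Yn n.
        (\<forall>m1<M1. \<forall>m2<M2. 0 \<le> \<Lambda> c e m1 m2 \<and> supp (d ^ n) (\<Lambda> c e m1 m2)) \<and>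
        (\<Sum>(m1,m2)\<in>{..<M1} \<times> {..<M2}. \<Lambda> c e m1 m2) = one (d ^ n)) \<and>
      pexp {..<M1} (Xn n) (pn n) (\<lambda>c. pexp {..<M2} (Yn n) (qn n) (\<lambda>e. 1 / (real M1 * real M2) *
        (\<Sum>m1<M1. \<Sum>m2<M2. tr ((one (d ^ n) - \<Lambda> c e m1 m2) * out n (c m1) (e m2))))) \<le> \<epsilon>"
    (is "\<exists>\<Lambda>. ?povm \<Lambda> \<and> ?err \<Lambda>")
  shows "\<exists>\<Lambda>. (\<forall>C1 \<in> ({..<M1} \<times> {..<n}) \<rightarrow>\<^sub>E {..<k1}. \<forall>C2 \<in> ({..<M2} \<times> {..<n}) \<rightarrow>\<^sub>E {..<k2}. povm (d ^ n) M1 M2 (\<Lambda> C1 C2))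
    \<and> (\<Sum>C1 \<in> ({..<M1} \<times> {..<n}) \<rightarrow>\<^sub>E {..<k1}. \<Sum>C2 \<in> ({..<M2} \<times> {..<n}) \<rightarrow>\<^sub>E {..<k2}.
              (\<Prod>m1<M1. \<Prod>i<n. p1 (C1 (m1,i))) * (\<Prod>m2<M2. \<Prod>i<n. p2 (C2 (m2,i))) *
              ((1 / (real M1 * real M2)) *
               (\<Sum>m1<M1. \<Sum>m2<M2.
                  Re (mtrace ((1\<^sub>m (d ^ n) - \<Lambda> C1 C2 m1 m2) *
                     tensor_out \<rho> (\<lambda>i. C1 (m1,i)) (\<lambda>i. C2 (m2,i)) n)))))
           \<le> \<epsilon>"
proof -
  obtain \<Lambda> where \<Lambda>err: "?povm \<Lambda> \<and> ?err \<Lambda>" using assms ..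
  note \<Lambda> = conjunct1[OF \<Lambda>err] and err = conjunct2[OF \<Lambda>err]
  define L where "L C1 C2 m1 m2 = mat_of (d ^ n) (\<Lambda> (curry_code M1 n C1) (curry_code M2 n C2) m1 m2)" for C1 C2 m1 m2
  show ?thesis
  proof (intro exI[of _ L] conjI ballI)
    fix C1 C2 assume C: "C1 \<in> ({..<M1} \<times> {..<n}) \<rightarrow>\<^sub>E {..<k1}" "C2 \<in> ({..<M2} \<times> {..<n}) \<rightarrow>\<^sub>E {..<k2}"
    note c = curry_code_PiE[OF C(1)] curry_code_PiE[OF C(2)]
    note l = \<Lambda>[rule_format, OF c]
    show "povm (d ^ n) M1 M2 (L C1 C2)"
      unfolding povm_def
    proof (intro conjI allI impI)
      show "psd (d ^ n) (L C1 C2 m1 m2)" if "m1 < M1" "m2 < M2" for m1 m2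
        unfolding L_def using l that by (intro nonneg_psd) auto
      show "msum (d ^ n) (\<lambda>(m1,m2). L C1 C2 m1 m2) ({..<M1} \<times> {..<M2}) = 1\<^sub>m (d ^ n)"
      proof (rule eq_matI)
        fix i j assume ij: "i < dim_row (1\<^sub>m (d ^ n) :: complex mat)" "j < dim_col (1\<^sub>m (d ^ n) :: complex mat)"
        have "msum (d ^ n) (\<lambda>(m1,m2). L C1 C2 m1 m2) ({..<M1} \<times> {..<M2}) $$ (i,j)
          = ent (\<Sum>(m1,m2)\<in>{..<M1} \<times> {..<M2}. \<Lambda> (curry_code M1 n C1) (curry_code M2 n C2) m1 m2) i j"
          using ij by (simp add: msum_def L_def mat_of_def case_prod_beta)
        also have "\<dots> = (1\<^sub>m (d ^ n) :: complex mat) $$ (i,j)"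
          using conjunct2[OF l] ij by simp
        finally show "msum (d ^ n) (\<lambda>(m1,m2). L C1 C2 m1 m2) ({..<M1} \<times> {..<M2}) $$ (i,j) = 1\<^sub>m (d ^ n) $$ (i,j)" .
      qed (simp_all add: msum_def)
    qed
  next
    let ?T = "\<lambda>c e. 1 / (real M1 * real M2) *
          (\<Sum>m1<M1. \<Sum>m2<M2. tr ((one (d ^ n) - \<Lambda> c e m1 m2) * out n (c m1) (e m2)))"
    let ?W1 = "\<lambda>C. \<Prod>m<M1. \<Prod>i<n. p1 (C (m,i))" and ?W2 = "\<lambda>C. \<Prod>m<M2. \<Prod>i<n. p2 (C (m,i))"
    let ?S1 = "({..<M1} \<times> {..<n}) \<rightarrow>\<^sub>E {..<k1}" and ?S2 = "({..<M2} \<times> {..<n}) \<rightarrow>\<^sub>E {..<k2}"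
    let ?E = "\<lambda>C1 C2. (1 / (real M1 * real M2)) * (\<Sum>m1<M1. \<Sum>m2<M2.
        Re (mtrace ((1\<^sub>m (d ^ n) - L C1 C2 m1 m2) * tensor_out \<rho> (\<lambda>i. C1 (m1,i)) (\<lambda>i. C2 (m2,i)) n)))"
    have E: "?E C1 C2 = ?T (curry_code M1 n C1) (curry_code M2 n C2)" if C: "C1 \<in> ?S1" "C2 \<in> ?S2" for C1 C2
    proof (intro arg_cong2[of _ _ _ _ "(*)"] sum.cong refl)
      fix m1 m2
      assume m: "m1 \<in> {..<M1}" "m2 \<in> {..<M2}"
      note c = curry_code_PiE[OF C(1)] curry_code_PiE[OF C(2)]
      have s: "supp (d ^ n) (\<Lambda> (curry_code M1 n C1) (curry_code M2 n C2) m1 m2)"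
        using \<Lambda>[rule_format, OF c] m by auto
      have r: "\<rho> (C1 (m1,i)) (C2 (m2,i)) \<in> carrier_mat d d" if "i < n" for i
        using C m that by (intro carrier_\<rho>) auto
      note T = tensor_out_carrier[of n \<rho> "\<lambda>i. C1 (m1,i)" "\<lambda>i. C2 (m2,i)" d, OF r]
      have L: "L C1 C2 m1 m2 \<in> carrier_mat (d ^ n) (d ^ n)"
        "fop_of (L C1 C2 m1 m2) = \<Lambda> (curry_code M1 n C1) (curry_code M2 n C2) m1 m2"
        using s by (simp_all add: L_def fop_of_mat_of)
      have D: "1\<^sub>m (d ^ n) - L C1 C2 m1 m2 \<in> carrier_mat (d ^ n) (d ^ n)"
        using L(1) by (intro minus_carrier_mat)
      have "Re (mtrace ((1\<^sub>m (d ^ n) - L C1 C2 m1 m2) * tensor_out \<rho> (\<lambda>i. C1 (m1,i)) (\<lambda>i. C2 (m2,i)) n))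
        = tr (fop_of ((1\<^sub>m (d ^ n) - L C1 C2 m1 m2) * tensor_out \<rho> (\<lambda>i. C1 (m1,i)) (\<lambda>i. C2 (m2,i)) n))"
        by (rule Re_mtrace[OF mult_carrier_mat[OF D T]])
      also have "\<dots> = tr ((one (d ^ n) - \<Lambda> (curry_code M1 n C1) (curry_code M2 n C2) m1 m2)
          * ten d (\<lambda>i. fop_of (\<rho> (C1 (m1,i)) (C2 (m2,i)))) n)"
        by (simp only: fop_of_times[OF D T] fop_of_minus[OF one_carrier_mat L(1)] fop_of_one L(2)
            fop_of_tensor_out[of n \<rho> "\<lambda>i. C1 (m1,i)" "\<lambda>i. C2 (m2,i)" d, OF r d])
      also have "ten d (\<lambda>i. fop_of (\<rho> (C1 (m1,i)) (C2 (m2,i)))) n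
        = out n (curry_code M1 n C1 m1) (curry_code M2 n C2 m2)"
        using m by (intro ten_cong[OF d]) auto
      finally show "Re (mtrace ((1\<^sub>m (d ^ n) - L C1 C2 m1 m2) * tensor_out \<rho> (\<lambda>i. C1 (m1,i)) (\<lambda>i. C2 (m2,i)) n))
        = tr ((one (d ^ n) - \<Lambda> (curry_code M1 n C1) (curry_code M2 n C2) m1 m2)
          * out n (curry_code M1 n C1 m1) (curry_code M2 n C2 m2))" .
    qed
    have "(\<Sum>C1\<in>?S1. \<Sum>C2\<in>?S2. ?W1 C1 * ?W2 C2 * ?E C1 C2)
      = (\<Sum>C1\<in>?S1. \<Sum>C2\<in>?S2. ?W1 C1 * ?W2 C2 * ?T (curry_code M1 n C1) (curry_code M2 n C2))"
      by (intro sum.cong refl) (simp only: E)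
    also have "\<dots> = (\<Sum>C1\<in>?S1. ?W1 C1 * (\<Sum>C2\<in>?S2. ?W2 C2 * ?T (curry_code M1 n C1) (curry_code M2 n C2)))"
      by (simp only: sum_distrib_left mult.assoc)
    also have "\<dots> = (\<Sum>C1\<in>?S1. ?W1 C1 * pexp {..<M2} ({..<n} \<rightarrow>\<^sub>E {..<k2}) (qn n) (?T (curry_code M1 n C1)))"
      by (intro sum.cong arg_cong2[of _ _ _ _ "(*)"] refl sum_curry_code)
    also have "\<dots> = pexp {..<M1} ({..<n} \<rightarrow>\<^sub>E {..<k1}) (pn n) (\<lambda>c. pexp {..<M2} ({..<n} \<rightarrow>\<^sub>E {..<k2}) (qn n) (?T c))"
      by (rule sum_curry_code)
    also note err
    finally show "(\<Sum>C1 \<in> ({..<M1} \<times> {..<n}) \<rightarrow>\<^sub>E {..<k1}. \<Sum>C2 \<in> ({..<M2} \<times> {..<n}) \<rightarrow>\<^sub>E {..<k2}.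
                (\<Prod>m1<M1. \<Prod>i<n. p1 (C1 (m1,i))) * (\<Prod>m2<M2. \<Prod>i<n. p2 (C2 (m2,i))) *
                ((1 / (real M1 * real M2)) *
                 (\<Sum>m1<M1. \<Sum>m2<M2.
                    Re (mtrace ((1\<^sub>m (d ^ n) - L C1 C2 m1 m2) *
                       tensor_out \<rho> (\<lambda>i. C1 (m1,i)) (\<lambda>i. C2 (m2,i)) n))))) \<le> \<epsilon>" .
  qed
qed

end

theorem theorem4p2:
  fixes k1 k2 d :: nat
    and \<rho> :: "nat \<Rightarrow> nat \<Rightarrow> complex mat"
    and p1 p2 :: "nat \<Rightarrow> real"
    and R1 R2 :: real
  assumes "k1 \<ge> 1" and "k2 \<ge> 1" and "d \<ge> 1"
    and "\<And>x1 x2. x1 < k1 \<Longrightarrow> x2 < k2 \<Longrightarrow> density d (\<rho> x1 x2)"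
    and "\<And>x. x < k1 \<Longrightarrow> p1 x \<ge> 0" and "(\<Sum>x<k1. p1 x) = 1"
    and "\<And>x. x < k2 \<Longrightarrow> p2 x \<ge> 0" and "(\<Sum>x<k2. p2 x) = 1"
    and "R1 \<ge> 0" and "R2 \<ge> 0"
    and "R1 \<le> I_X1_B_given_X2 k1 k2 d p1 p2 \<rho>"
    and "R2 \<le> I_X2_B_given_X1 k1 k2 d p1 p2 \<rho>"
    and "R1 + R2 \<le> I_X1X2_B k1 k2 d p1 p2 \<rho>"
  shows "\<forall>\<epsilon>>0. \<forall>\<delta>>0. \<exists>N. \<forall>n\<ge>N.
    (let M1 = nat \<lceil>2 powr (real n * (R1 - \<delta>))\<rceil>;
         M2 = nat \<lceil>2 powr (real n * (R2 - \<delta>))\<rceil>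
     in \<exists>\<Lambda> :: (nat \<times> nat \<Rightarrow> nat) \<Rightarrow> (nat \<times> nat \<Rightarrow> nat) \<Rightarrow> nat \<Rightarrow> nat \<Rightarrow> complex mat.
          (\<forall>C1 \<in> ({..<M1} \<times> {..<n}) \<rightarrow>\<^sub>E {..<k1}. \<forall>C2 \<in> ({..<M2} \<times> {..<n}) \<rightarrow>\<^sub>E {..<k2}.
              povm (d ^ n) M1 M2 (\<Lambda> C1 C2))
        \<and> (\<Sum>C1 \<in> ({..<M1} \<times> {..<n}) \<rightarrow>\<^sub>E {..<k1}. \<Sum>C2 \<in> ({..<M2} \<times> {..<n}) \<rightarrow>\<^sub>E {..<k2}.
              (\<Prod>m1<M1. \<Prod>i<n. p1 (C1 (m1,i))) * (\<Prod>m2<M2. \<Prod>i<n. p2 (C2 (m2,i))) *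
              ((1 / (real M1 * real M2)) *
               (\<Sum>m1<M1. \<Sum>m2<M2.
                  Re (mtrace ((1\<^sub>m (d ^ n) - \<Lambda> C1 C2 m1 m2) *
                     tensor_out \<rho> (\<lambda>i. C1 (m1,i)) (\<lambda>i. C2 (m2,i)) n)))))
           \<le> \<epsilon>)"
proof -
  interpret matrix_mac k1 k2 d p1 p2 \<rho>
    by unfold_locales (use assms in auto)
  have R: "R1 \<le> H2 - H12" "R2 \<le> H1 - H12" "R1 + R2 \<le> H0 - H12"
    using assms(11-13) unfolding mutual_informations .
  show ?thesis unfolding Let_def
  proof (intro allI impI, goal_cases)
    case (1 \<epsilon> \<delta>)
    show ?case
    proof (rule ex_forward[OF achievability[OF R 1]], intro allI impI, goal_cases)
      case (1 N n)
      show ?case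
        by (rule simultaneous_decoding, rule 1(1)[rule_format]) (rule 1(2) real_nat_ceiling_pred)+
    qed
  qed
qed

end
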